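(* Let $\mathcal{R}^*$ be a read collection closed under reverse complement, $k$ the order and $m$ the minimum overlap parameter, and consider the rBOSS index of $\mathcal{R}^*$ (the BOSS index of order $k$ together with the balanced-parentheses representation of the overlap tree $T'$). Given a solid node $v$, the function $\texttt{foverlaps}(v)$ can be computed in $\mathcal{O}(k\log\sigma)$ time.
   Context: DNA alphabet $\Sigma=\{\texttt{a},\texttt{c},\texttt{g},\texttt{t}\}$ (size $\sigma$ including the dummy $\$$, which is the smallest symbol). Reverse complement: reverse and exchange $\texttt{a}\leftrightarrow\texttt{t}$, $\texttt{c}\leftrightarrow\texttt{g}$. $\mathcal{R}^*=\mathcal{R}\cup\{R^{rc}:R\in\mathcal{R}\}$ for equal-length reads $\mathcal{R}$. Solid nodes: distinct length-$(k-1)$ substrings of strings of $\mathcal{R}^*$; a p-node is a solid node that is a prefix of a string of $\mathcal{R}^*$. Linker nodes: $\$^{k-1-d}X$ for each prefix $X$ of length $d<k-1$ of a string of $\mathcal{R}^*$, with $\texttt{llabel}(\$^{k-1-d}X)=X$. The matrix $M$ has one row per solid or linker node, sorted colexicographically. BOSS index: sequence $E$ of outgoing edge symbols per row (edge $b$ from solid $w$ if $wb$ occurs in $\mathcal{R}^*$; from linker $\$^{k-1-d}X$ if $Xb$ is a prefix of a string of $\mathcal{R}^*$) in a wavelet tree, bitmap $B$ marking each row's last outgoing symbol, and array $C$. Overlap tree $T'$: take the compact trie $T$ of the reversed rows of $M$ (leaves in row order); delete internal nodes of string depth below $m$ (attaching the remaining subtrees to the root), and delete every internal node whose leftmost child edge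 is not labeled by a dummy string (attaching its children to its parent), recursively. $\texttt{foverlaps}(v)$ is the set of p-nodes $v'$ such that a prefix of $v'$ of length at least $m$ equals a suffix of $v$.
   Formalization: foverlaps(v) can have exponentially many elements in k, so O(k log σ) is proved for a compact output (linker rows, or v, standing for the p-nodes extending their labels); explicit listing is proved in O(k log σ) time per p-node. Assumes k≥2, 1≤m<k and standard operation times. *)

theory Defs
  imports Complex_Main "HOL-Library.Sublist" "HOL-Library.List_Lexorder"
begin

section \<open>Alphabet and reads\<close>

datatype sym = Dollar | Ade | Cyt | Gua | Thy

fun sym_code :: "sym \<Rightarrow> nat" where
  "sym_code Dollar = 0"
| "sym_code Ade = 1"
| "sym_code Cyt = 2"
| "sym_code Gua = 3"
| "sym_code Thy = 4"

lemma sym_code_inject: "sym_code x = sym_code y \<longleftrightarrow> x = y"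
  by (cases x; cases y) simp_all

instantiation sym :: linorder
begin

definition less_eq_sym :: "sym \<Rightarrow> sym \<Rightarrow> bool" where
  "less_eq_sym x y \<longleftrightarrow> sym_code x \<le> sym_code y"

definition less_sym :: "sym \<Rightarrow> sym \<Rightarrow> bool" where
  "less_sym x y \<longleftrightarrow> sym_code x < sym_code y"

instance
  by standard (auto simp: less_eq_sym_def less_sym_def sym_code_inject)

end

definition syms :: "sym list" where
  "syms = [Dollar, Ade, Cyt, Gua, Thy]"

definition sigma :: nat where
  "sigma = card (UNIV :: sym set)"

fun complement :: "sym \<Rightarrow> sym" where
  "complement Dollar = Dollar"
| "complement Ade = Thy"
| "complement Cyt = Gua"
| "complement Gua = Cyt"
| "complement Thy = Ade"

definition rc :: "sym list \<Rightarrow> sym list" where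
  "rc x = rev (map complement x)"

definition read_collection :: "sym list set \<Rightarrow> bool" where
  "read_collection R \<longleftrightarrow>
     finite R \<and> (\<forall>x\<in>R. Dollar \<notin> set x) \<and> (\<exists>r. \<forall>x\<in>R. length x = r)"

definition rc_closure :: "sym list set \<Rightarrow> sym list set" where
  "rc_closure R = R \<union> rc ` R"

section \<open>Nodes and overlaps\<close>

definition solid_nodes :: "sym list set \<Rightarrow> nat \<Rightarrow> sym list set" where
  "solid_nodes R k = {u. length u = k - 1 \<and> (\<exists>x\<in>rc_closure R. sublist u x)}"

definition p_nodes :: "sym list set \<Rightarrow> nat \<Rightarrow> sym list set" where
  "p_nodes R k = {u \<in> solid_nodes R k. \<exists>x\<in>rc_closure R. prefix u x}"

definition linker_nodes :: "sym list set \<Rightarrow> nat \<Rightarrow> sym list set" where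
  "linker_nodes R k =
     {replicate (k - 1 - length X) Dollar @ X | X.
        length X < k - 1 \<and> (\<exists>x\<in>rc_closure R. prefix X x)}"

text \<open>On solid nodes, which contain no dummy, this is the identity.\<close>

definition llabel :: "sym list \<Rightarrow> sym list" where
  "llabel u = dropWhile (\<lambda>b. b = Dollar) u"

definition foverlaps :: "sym list set \<Rightarrow> nat \<Rightarrow> nat \<Rightarrow> sym list \<Rightarrow> sym list set" where
  "foverlaps R k m v =
     {v' \<in> p_nodes R k. \<exists>p. prefix p v' \<and> m \<le> length p \<and> suffix p v}"

text \<open>Rows are numbered from 0. Colexicographic order is the lexicographic order of the
  reversed strings.\<close>

definition rows :: "sym list set \<Rightarrow> nat \<Rightarrow> sym list list" where
  "rows R k = map rev (sorted_list_of_set (rev ` (solid_nodes R k \<union> linker_nodes R k)))"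

section \<open>The BOSS sequences\<close>

definition out_symbols :: "sym list set \<Rightarrow> nat \<Rightarrow> sym list \<Rightarrow> sym set" where
  "out_symbols R k u =
     (if u \<in> solid_nodes R k then {b. \<exists>x\<in>rc_closure R. sublist (u @ [b]) x}
      else {b. \<exists>x\<in>rc_closure R. prefix (llabel u @ [b]) x})"

text \<open>As in the BOSS index of Bowe, Onodera, Sadakane and Shibuya, an outgoing symbol is
  flagged when an earlier row with the same suffix of length \<open>k - 2\<close> has the same outgoing
  symbol (both edges then lead to the same node), and a row without outgoing edges holds one
  dummy symbol, so that the marks of \<open>B\<close> are in bijection with the rows.\<close>

definition row_symbols :: "sym list set \<Rightarrow> nat \<Rightarrow> nat \<Rightarrow> (sym \<times> bool) list" where
  "row_symbols R k i =
     (let M = rows R k; bs = filter (\<lambda>b. b \<in> out_symbols R k (M ! i)) syms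
      in if bs = [] then [(Dollar, False)]
         else map (\<lambda>b. (b, \<exists>j<i. tl (M ! j) = tl (M ! i) \<and> b \<in> out_symbols R k (M ! j))) bs)"

definition E_seq :: "sym list set \<Rightarrow> nat \<Rightarrow> (sym \<times> bool) list" where
  "E_seq R k = concat (map (row_symbols R k) [0..<length (rows R k)])"

definition B_seq :: "sym list set \<Rightarrow> nat \<Rightarrow> bool list" where
  "B_seq R k =
     concat (map (\<lambda>i. replicate (length (row_symbols R k i) - 1) False @ [True])
                 [0..<length (rows R k)])"

definition C_arr :: "sym list set \<Rightarrow> nat \<Rightarrow> nat list" where
  "C_arr R k = map (\<lambda>b. length (filter (\<lambda>u. last u < b) (rows R k))) syms"

section \<open>The overlap tree\<close>

text \<open>Ordered trees whose edges carry strings.\<close>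

datatype ctree = Leaf | Node "(sym list \<times> ctree) list"

lemma sum_list_drop_less:
  assumes "ys \<noteq> []" "\<forall>y\<in>set ys. y \<noteq> []" "0 < n"
  shows "sum_list (map length (map (drop n) ys)) < sum_list (map length (ys :: 'a list list))"
  using assms
proof (induction ys)
  case Nil
  then show ?case by simp
next
  case (Cons y ys)
  then show ?case
    by (cases "ys = []") (auto intro: add_less_le_mono diff_less)
qed

lemma sum_list_filter_le:
  "sum_list (map length (filter P xs)) \<le> sum_list (map length (xs :: 'a list list))"
  by (induction xs) auto

text \<open>The compact trie of a list of strings none of which is a proper prefix of another; the
  leaves appear in the lexicographic order of the strings.\<close>

function ctrie :: "sym list list \<Rightarrow> ctree" where
  "ctrie xs =
     (if length xs \<le> 1 then Leaf
      else Node (map (\<lambda>ys. (Longest_common_prefix (set ys),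
                            ctrie (map (drop (length (Longest_common_prefix (set ys)))) ys)))
                     (filter (\<lambda>ys. ys \<noteq> [])
                        (map (\<lambda>b. filter (\<lambda>x. x \<noteq> [] \<and> hd x = b) xs) syms))))"
  by pat_completeness auto
termination
proof (relation "measure (\<lambda>xs. sum_list (map length xs))", goal_cases)
  case 1
  then show ?case by simp
next
  case (2 xs ys)
  then obtain b where ys: "ys = filter (\<lambda>x. x \<noteq> [] \<and> hd x = b) xs" and ne: "ys \<noteq> []"
    by auto
  have pre: "\<forall>y\<in>set ys. prefix [b] y"
    by (auto simp: ys prefix_def) (metis list.collapse)
  then have "length [b] \<le> length (Longest_common_prefix (set ys))"
    using ne by (intro Longest_common_prefix_longest) auto
  then have "sum_list (map length (map (drop (length (Longest_common_prefix (set ys)))) ys))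
      < sum_list (map length ys)"
    using ne by (intro sum_list_drop_less) (auto simp: ys)
  also have "\<dots> \<le> sum_list (map length xs)"
    unfolding ys by (rule sum_list_filter_le)
  finally show ?case by simp
qed

declare ctrie.simps [simp del]

text \<open>\<open>delete_edge bad d\<close> processes an edge leaving a node of string depth \<open>d\<close>: bottom-up, each
  internal node below it that is \<open>bad\<close> (given its string depth and its current child edges) is
  removed and its children are attached to its parent, in place.\<close>

fun delete_edge ::
  "(nat \<Rightarrow> (sym list \<times> ctree) list \<Rightarrow> bool) \<Rightarrow> nat \<Rightarrow> sym list \<times> ctree \<Rightarrow> (sym list \<times> ctree) list"
where
  "delete_edge bad d (l, Leaf) = [(l, Leaf)]"
| "delete_edge bad d (l, Node es) =
     (let es' = concat (map (delete_edge bad (d + length l)) es)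
      in if bad (d + length l) es' then map (\<lambda>(l', t). (l @ l', t)) es' else [(l, Node es')])"

fun delete_internal ::
  "(nat \<Rightarrow> (sym list \<times> ctree) list \<Rightarrow> bool) \<Rightarrow> ctree \<Rightarrow> ctree" where
  "delete_internal bad Leaf = Leaf"
| "delete_internal bad (Node es) = Node (concat (map (delete_edge bad 0) es))"

definition overlap_tree :: "sym list set \<Rightarrow> nat \<Rightarrow> nat \<Rightarrow> ctree" where
  "overlap_tree R k m =
     delete_internal (\<lambda>d es. \<not> set (fst (hd es)) \<subseteq> {Dollar})
       (delete_internal (\<lambda>d es. d < m) (ctrie (map rev (rows R k))))"

text \<open>Balanced parentheses; \<open>True\<close> is an opening parenthesis.\<close>

fun bp_of :: "ctree \<Rightarrow> bool list" where
  "bp_of Leaf = [True, False]"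
| "bp_of (Node es) = True # concat (map (\<lambda>(l, t). bp_of t) es) @ [False]"

record rboss =
  boss_E :: "(sym \<times> bool) list"
  boss_B :: "bool list"
  boss_C :: "nat list"
  boss_BP :: "bool list"

definition rboss_index :: "sym list set \<Rightarrow> nat \<Rightarrow> nat \<Rightarrow> rboss" where
  "rboss_index R k m =
     \<lparr> boss_E = E_seq R k, boss_B = B_seq R k, boss_C = C_arr R k,
       boss_BP = bp_of (overlap_tree R k m) \<rparr>"

section \<open>Operations supported by the index\<close>

definition rank_seq :: "'a list \<Rightarrow> 'a \<Rightarrow> nat \<Rightarrow> nat" where
  "rank_seq xs c i = length (filter (\<lambda>y. y = c) (take i xs))"

definition nth_or_0 :: "nat list \<Rightarrow> nat \<Rightarrow> nat" where
  "nth_or_0 xs i = (if i < length xs then xs ! i else 0)"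

text \<open>Occurrences are numbered from 0, as are positions.\<close>

definition select_seq :: "'a list \<Rightarrow> 'a \<Rightarrow> nat \<Rightarrow> nat" where
  "select_seq xs c j = nth_or_0 (filter (\<lambda>p. xs ! p = c) [0..<length xs]) j"

definition leaf_positions :: "bool list \<Rightarrow> nat list" where
  "leaf_positions P = filter (\<lambda>p. Suc p < length P \<and> P ! p \<and> \<not> P ! Suc p) [0..<length P]"

text \<open>The excess of opening over closing parentheses in positions \<open>i, \<dots>, j - 1\<close>.\<close>

definition excess :: "bool list \<Rightarrow> nat \<Rightarrow> nat \<Rightarrow> int" where
  "excess P i j = (\<Sum>p\<in>{i..<j}. if P ! p then 1 else - 1)"

definition find_close :: "bool list \<Rightarrow> nat \<Rightarrow> nat" where
  "find_close P i = nth_or_0 (filter (\<lambda>j. i < j \<and> excess P i (Suc j) = 0) [0..<length P]) 0"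

definition find_open :: "bool list \<Rightarrow> nat \<Rightarrow> nat" where
  "find_open P j =
     nth_or_0 (rev (filter (\<lambda>i. i < j \<and> excess P i (Suc j) = 0) [0..<length P])) 0"

text \<open>The opening parenthesis of the parent of the node opening at \<open>i\<close>.\<close>

definition enclose :: "bool list \<Rightarrow> nat \<Rightarrow> nat" where
  "enclose P i = nth_or_0 (rev (filter (\<lambda>j. j < i \<and> excess P j i = 1) [0..<length P])) 0"

fun E_code :: "sym \<times> bool \<Rightarrow> nat" where
  "E_code (b, flag) = sym_code b + (if flag then sigma else 0)"

datatype index_op =
    E_Access | E_Rank | E_Select
  | B_Access | B_Rank | B_Select
  | C_Access
  | BP_Access | BP_Rank | BP_Select
  | BP_Close | BP_Open | BP_Enclose | BP_Leaf_Rank | BP_Leaf_Select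

text \<open>Operations with a single argument ignore the second one.\<close>

fun answer :: "rboss \<Rightarrow> index_op \<Rightarrow> nat \<Rightarrow> nat \<Rightarrow> nat" where
  "answer I E_Access i c = nth_or_0 (map E_code (boss_E I)) i"
| "answer I E_Rank i c = rank_seq (map E_code (boss_E I)) c i"
| "answer I E_Select j c = select_seq (map E_code (boss_E I)) c j"
| "answer I B_Access i c = nth_or_0 (map of_bool (boss_B I)) i"
| "answer I B_Rank i c = rank_seq (boss_B I) True i"
| "answer I B_Select j c = select_seq (boss_B I) True j"
| "answer I C_Access i c = nth_or_0 (boss_C I) i"
| "answer I BP_Access i c = nth_or_0 (map of_bool (boss_BP I)) i"
| "answer I BP_Rank i c = rank_seq (boss_BP I) True i"
| "answer I BP_Select j c = select_seq (boss_BP I) True j"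
| "answer I BP_Close i c = find_close (boss_BP I) i"
| "answer I BP_Open i c = find_open (boss_BP I) i"
| "answer I BP_Enclose i c = enclose (boss_BP I) i"
| "answer I BP_Leaf_Rank i c = length (filter (\<lambda>p. p < i) (leaf_positions (boss_BP I)))"
| "answer I BP_Leaf_Select j c = nth_or_0 (leaf_positions (boss_BP I)) j"

text \<open>The standard operation times: the height of the wavelet tree (over the flagged alphabet)
  for \<open>E\<close>, constant time for bitmaps, arrays and balanced parentheses.\<close>

definition wavelet_height :: nat where
  "wavelet_height = nat \<lceil>log 2 (real (2 * sigma))\<rceil>"

fun op_cost :: "index_op \<Rightarrow> nat" where
  "op_cost E_Access = wavelet_height"
| "op_cost E_Rank = wavelet_height"
| "op_cost E_Select = wavelet_height"
| "op_cost _ = 1"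

section \<open>A word RAM with access to the index\<close>

datatype arith_op = Add | Sub | Mul | Div | Mod | Less | Equal

datatype expr = Num nat | Reg nat | Bin arith_op expr expr

datatype com =
    Assign nat expr
  | Load nat nat expr
  | Store nat expr expr
  | Ask nat index_op expr expr
  | Emit expr
  | Seq com com
  | If expr com com
  | While expr com

record mstate =
  regs :: "nat \<Rightarrow> nat"
  arrs :: "nat \<Rightarrow> nat \<Rightarrow> nat"
  outp :: "nat list"

definition word :: "nat \<Rightarrow> nat \<Rightarrow> nat" where
  "word w n = n mod 2 ^ w"

fun arith :: "arith_op \<Rightarrow> nat \<Rightarrow> nat \<Rightarrow> nat" where
  "arith Add x y = x + y"
| "arith Sub x y = x - y"
| "arith Mul x y = x * y"
| "arith Div x y = x div y"
| "arith Mod x y = x mod y"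
| "arith Less x y = of_bool (x < y)"
| "arith Equal x y = of_bool (x = y)"

fun eval :: "nat \<Rightarrow> mstate \<Rightarrow> expr \<Rightarrow> nat" where
  "eval w s (Num n) = word w n"
| "eval w s (Reg x) = regs s x"
| "eval w s (Bin f e1 e2) = word w (arith f (eval w s e1) (eval w s e2))"

fun ecost :: "expr \<Rightarrow> nat" where
  "ecost (Num n) = 1"
| "ecost (Reg x) = 1"
| "ecost (Bin f e1 e2) = 1 + ecost e1 + ecost e2"

text \<open>\<open>exec I w p s t s'\<close>: with index \<open>I\<close> and words of \<open>w\<close> bits, \<open>p\<close> takes \<open>s\<close> to \<open>s'\<close>
  in time \<open>t\<close>.\<close>

inductive exec :: "rboss \<Rightarrow> nat \<Rightarrow> com \<Rightarrow> mstate \<Rightarrow> nat \<Rightarrow> mstate \<Rightarrow> bool"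
  for I :: rboss and w :: nat where
  exec_Assign:
    "exec I w (Assign x e) s (1 + ecost e) (s\<lparr>regs := (regs s)(x := eval w s e)\<rparr>)"
| exec_Load:
    "exec I w (Load x a e) s (1 + ecost e) (s\<lparr>regs := (regs s)(x := arrs s a (eval w s e))\<rparr>)"
| exec_Store:
    "exec I w (Store a e1 e2) s (1 + ecost e1 + ecost e2)
       (s\<lparr>arrs := (arrs s)(a := (arrs s a)(eval w s e1 := eval w s e2))\<rparr>)"
| exec_Ask:
    "exec I w (Ask x q e1 e2) s (op_cost q + ecost e1 + ecost e2)
       (s\<lparr>regs := (regs s)(x := word w (answer I q (eval w s e1) (eval w s e2)))\<rparr>)"
| exec_Emit:
    "exec I w (Emit e) s (1 + ecost e) (s\<lparr>outp := outp s @ [eval w s e]\<rparr>)"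
| exec_Seq:
    "exec I w p s t s' \<Longrightarrow> exec I w q s' t' s'' \<Longrightarrow> exec I w (Seq p q) s (t + t') s''"
| exec_If_True:
    "eval w s e \<noteq> 0 \<Longrightarrow> exec I w p s t s' \<Longrightarrow> exec I w (If e p q) s (1 + ecost e + t) s'"
| exec_If_False:
    "eval w s e = 0 \<Longrightarrow> exec I w q s t s' \<Longrightarrow> exec I w (If e p q) s (1 + ecost e + t) s'"
| exec_While_False:
    "eval w s e = 0 \<Longrightarrow> exec I w (While e p) s (1 + ecost e) s"
| exec_While_True:
    "eval w s e \<noteq> 0 \<Longrightarrow> exec I w p s t s' \<Longrightarrow> exec I w (While e p) s' t' s'' \<Longrightarrow>
     exec I w (While e p) s (1 + ecost e + t + t') s''"

definition init_state :: "nat list \<Rightarrow> mstate" where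
  "init_state xs = \<lparr> regs = nth_or_0 xs, arrs = (\<lambda>_ _. 0), outp = [] \<rparr>"

definition runs :: "rboss \<Rightarrow> nat \<Rightarrow> com \<Rightarrow> nat list \<Rightarrow> nat \<Rightarrow> nat list \<Rightarrow> bool" where
  "runs I w p xs t ys \<longleftrightarrow> (\<exists>s. exec I w p (init_state xs) t s \<and> outp s = ys)"

text \<open>A word can address every position of the index and hold \<open>k\<close> and every symbol code.\<close>

definition word_fits :: "rboss \<Rightarrow> nat \<Rightarrow> nat \<Rightarrow> bool" where
  "word_fits I k w \<longleftrightarrow>
     length (boss_E I) < 2 ^ w \<and> length (boss_BP I) < 2 ^ w \<and> k < 2 ^ w \<and> 2 * sigma < 2 ^ w"

section \<open>Output formats\<close>

text \<open>\<open>foverlaps\<close> may have exponentially many elements in \<open>k\<close>, so within time \<open>O(k log \<sigma>)\<close> it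
  can only be delivered in a compact form: a linker stands for the p-nodes that extend its
  label, which are those reached from it along outgoing edges; a p-node stands for itself.\<close>

definition p_extensions :: "sym list set \<Rightarrow> nat \<Rightarrow> sym list \<Rightarrow> sym list set" where
  "p_extensions R k u = {v' \<in> p_nodes R k. prefix (llabel u) v'}"

definition represents :: "sym list set \<Rightarrow> nat \<Rightarrow> nat list \<Rightarrow> sym list set \<Rightarrow> bool" where
  "represents R k ys S \<longleftrightarrow>
     distinct ys \<and> (\<forall>i\<in>set ys. i < length (rows R k)) \<and>
     (\<Union>i\<in>set ys. p_extensions R k (rows R k ! i)) = S"

definition enumerates :: "sym list set \<Rightarrow> nat \<Rightarrow> nat list \<Rightarrow> sym list set \<Rightarrow> bool" where
  "enumerates R k ys S \<longleftrightarrow>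
     distinct ys \<and> (\<forall>i\<in>set ys. i < length (rows R k)) \<and> (\<lambda>i. rows R k ! i) ` set ys = S"

end

theory Submission
  imports Defs
begin

text \<open>
  The p-nodes that overlap a solid node \<open>v\<close> are \<open>v\<close> itself, if it is a p-node, and the p-nodes that
  extend a \<^emph>\<open>source\<close>: a proper suffix of \<open>v\<close> of length at least \<open>m\<close> that is a prefix of a read. If \<open>X\<close>
  is a source, then the reversed rows of \<open>v\<close> and of the linker node of \<open>X\<close> diverge in the trie right
  after \<open>X\<close>, where the latter continues with a dummy. Hence the ancestors of the leaf of \<open>v\<close> in the
  overlap tree are exactly the sources, and the leftmost leaf below such an ancestor is the linker
  node of the source. Climbing from the leaf of \<open>v\<close> to the root takes at most \<open>k\<close> steps and yields
  the compact form.

  To list the p-nodes without repetition, the edges of the linker nodes are followed forwards in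
  a breadth-first search from row 0, the linker node with the empty label, so that the length of each
  label is known. The search is restricted to labels that are comparable with a source: the prefixes of
  the sources are marked beforehand by walking backwards from each source until a marked row is met,
  and the other labels are recognised by a flag inherited from the parent. Each visited label is a
  prefix of a reported p-node, so there are at most \<open>k\<close> visits per p-node.
\<close>

section \<open>Rank and select on concatenated blocks\<close>

definition occs :: "'a \<Rightarrow> 'a list \<Rightarrow> nat list" where
  "occs c xs = filter (\<lambda>p. xs ! p = c) [0..<length xs]"

lemma select_seq_occs: "select_seq xs c j = nth_or_0 (occs c xs) j"
  by (simp add: select_seq_def occs_def)

lemma occs_append: "occs c (xs @ ys) = occs c xs @ map ((+) (length xs)) (occs c ys)"
proof -
  have "[0..<length (xs @ ys)] = [0..<length xs] @ map ((+) (length xs)) [0..<length ys]"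
    by (rule nth_equalityI) (auto simp: nth_append)
  then show ?thesis
    by (auto simp: occs_def filter_map o_def nth_append intro!: filter_cong)
qed

lemma length_occs: "length (occs c xs) = length (filter (\<lambda>y. y = c) xs)"
proof (induction xs rule: rev_induct)
  case Nil
  then show ?case by (simp add: occs_def)
next
  case (snoc x xs)
  then show ?case by (simp add: occs_append) (simp add: occs_def)
qed

lemma occs_bounds: "p \<in> set (occs c xs) \<Longrightarrow> p < length xs"
  by (auto simp: occs_def)

lemma rank_seq_append:
  "rank_seq (xs @ ys) c (length xs) = length (filter (\<lambda>y. y = c) xs)"
  by (simp add: rank_seq_def)

definition offset :: "(nat \<Rightarrow> nat) \<Rightarrow> nat \<Rightarrow> nat" where
  "offset len n = (\<Sum>j<n. len j)"

lemma offset_Suc [simp]: "offset len (Suc n) = offset len n + len n"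
  by (simp add: offset_def)

lemma offset_0 [simp]: "offset len 0 = 0"
  by (simp add: offset_def)

lemma offset_mono: "a \<le> b \<Longrightarrow> offset len a \<le> offset len b"
  unfolding offset_def by (rule sum_mono2) auto

lemma length_concat_upt:
  "length (concat (map f [0..<n])) = offset (\<lambda>j. length (f j)) n"
  by (induction n) auto

lemma concat_upt_split:
  assumes "n \<le> N"
  shows "concat (map f [0..<N]) = concat (map f [0..<n]) @ concat (map f [n..<N])"
proof -
  have "[0..<N] = [0..<n] @ [n..<N]"
    using assms upt_add_eq_append[of 0 n "N - n"] by simp
  then show ?thesis by simp
qed

lemma rank_blocks:
  assumes "n \<le> N" "\<And>j. j < N \<Longrightarrow> length (filter (\<lambda>y. y = c) (f j)) = of_bool (P j)"
  shows "rank_seq (concat (map f [0..<N])) c (offset (\<lambda>j. length (f j)) n)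
    = length (filter P [0..<n])"
proof -
  have "length (filter (\<lambda>y. y = c) (concat (map f [0..<n]))) = length (filter P [0..<n])"
    using assms by (induction n) auto
  then show ?thesis
    by (simp add: concat_upt_split[OF assms(1)] rank_seq_append flip: length_concat_upt)
qed

lemma occs_blocks:
  assumes "\<And>j. j < N \<Longrightarrow> length (filter (\<lambda>y. y = c) (f j)) = of_bool (P j)"
  shows "list_all2 (\<lambda>p n. offset (\<lambda>j. length (f j)) n \<le> p \<and> p < offset (\<lambda>j. length (f j)) (Suc n))
    (occs c (concat (map f [0..<N]))) (filter P [0..<N])"
  using assms
proof (induction N)
  case 0
  then show ?case by (simp add: occs_def)
next
  case (Suc N)
  have len: "length (occs c (f N)) = of_bool (P N)"
    using Suc.prems by (simp add: length_occs)
  have "list_all2 (\<lambda>p n. offset (\<lambda>j. length (f j)) n \<le> p \<and> p < offset (\<lambda>j. length (f j)) (Suc n))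
    (map ((+) (length (concat (map f [0..<N])))) (occs c (f N))) (filter P [N])"
  proof (cases "P N")
    case True
    then obtain p where p: "occs c (f N) = [p]"
      using len by (auto simp: length_Suc_conv)
    then have "p < length (f N)" using occs_bounds[of p c "f N"] by simp
    then show ?thesis using True p by (simp only: length_concat_upt) simp
  qed (use len in simp)
  then show ?case using Suc by (simp add: occs_append list_all2_appendI)
qed

lemma select_blocks:
  assumes "\<And>j. j < N \<Longrightarrow> length (filter (\<lambda>y. y = c) (f j)) = of_bool (P j)"
    and "n < N" "P n"
  defines "p \<equiv> select_seq (concat (map f [0..<N])) c (length (filter P [0..<n]))"
  shows "offset (\<lambda>j. length (f j)) n \<le> p \<and> p < offset (\<lambda>j. length (f j)) (Suc n)"
proof -
  have "[0..<N] = [0..<n] @ n # [Suc n..<N]"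
    using \<open>n < N\<close> upt_add_eq_append[of 0 n "N - n"] by (simp add: upt_conv_Cons)
  then have flt: "filter P [0..<N] = filter P [0..<n] @ n # filter P [Suc n..<N]"
    using \<open>P n\<close> by simp
  let ?j = "length (filter P [0..<n])"
  have "?j < length (filter P [0..<N])" and "filter P [0..<N] ! ?j = n"
    by (simp_all add: flt)
  then show ?thesis
    using occs_blocks[of N c f P, OF assms(1)] unfolding p_def select_seq_occs nth_or_0_def
    by (auto simp: list_all2_conv_all_nth)
qed

lemma mark_blocks:
  fixes len :: "nat \<Rightarrow> nat"
  assumes pos: "\<And>j. 0 < len j"
  defines "mk \<equiv> \<lambda>j. replicate (len j - 1) False @ [True]"
  defines "B \<equiv> \<lambda>N. concat (map mk [0..<N])"
  shows rank_mark_blocks: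
      "\<And>n N p. n < N \<Longrightarrow> offset len n \<le> p \<Longrightarrow> p < offset len (Suc n) \<Longrightarrow> rank_seq (B N) True p = n"
    and select_mark_blocks: "\<And>n N. n < N \<Longrightarrow> select_seq (B N) True n = offset len (Suc n) - 1"
proof -
  have lmk: "length (mk j) = len j" for j
    using pos[of j] by (simp add: mk_def)
  have lenB: "length (B N) = offset len N" for N
    unfolding B_def length_concat_upt lmk ..
  have cnt: "length (filter (\<lambda>y. y = True) (B n)) = n" for n
    by (induction n) (auto simp: B_def mk_def)
  show "rank_seq (B N) True p = n" if "n < N" "offset len n \<le> p" "p < offset len (Suc n)" for n N p
  proof -
    have "B N = B n @ mk n @ concat (map mk [Suc n..<N])"
      using that(1) concat_upt_split[of n N mk] by (simp add: B_def upt_conv_Cons)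
    then have "take p (B N) = B n @ replicate (p - offset len n) False"
      using that pos[of n] by (simp add: lenB mk_def)
    then show ?thesis by (simp add: rank_seq_def) (use cnt[of n] in simp)
  qed
  have occ1: "occs True (mk n) = [len n - 1]" for n
    by (auto simp: mk_def occs_append) (auto simp: occs_def filter_empty_conv)
  have "occs True (B N) = map (\<lambda>n. offset len (Suc n) - 1) [0..<N]" for N
  proof (induction N)
    case 0
    then show ?case by (simp add: B_def occs_def)
  next
    case (Suc N)
    have "B (Suc N) = B N @ mk N" by (simp add: B_def)
    then show ?case using Suc pos[of N] by (simp add: occs_append occ1 lenB)
  qed
  then show "select_seq (B N) True n = offset len (Suc n) - 1" if "n < N" for n N
    using that by (simp add: select_seq_occs nth_or_0_def)
qed

section \<open>The edges of the BOSS index\<close>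

lemma Dollar_le [simp]: "Dollar \<le> b"
  by (simp add: less_eq_sym_def)

lemma set_syms: "set syms = UNIV"
  by (auto simp: syms_def) (metis sym.exhaust)

lemma sigma_eq: "sigma = 5"
proof -
  have "sigma = card (set syms)" by (simp add: sigma_def set_syms)
  then show ?thesis by (simp add: syms_def)
qed

lemma syms_nth_code: "syms ! sym_code b = b"
  by (cases b) (auto simp: syms_def numeral_eq_Suc)

lemma sym_code_less: "sym_code b < 5"
  by (cases b) auto

lemma snoc_le_snoc: "a \<le> b \<Longrightarrow> xs @ [a] \<le> xs @ [b :: 'a :: linorder]"
  by (induction xs) auto

lemma butlast_mono:
  "length x = length y \<Longrightarrow> x < y \<Longrightarrow> butlast x \<le> butlast (y :: 'a :: linorder list)"
  by (induction x y rule: list_induct2) auto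

lemma replicate_Dollar_le: "length x = n \<Longrightarrow> replicate n Dollar \<le> x"
proof (induction x arbitrary: n)
  case (Cons a x)
  then show ?case by (cases a) (auto simp: less_sym_def)
qed simp

locale rboss_context =
  fixes R :: "sym list set" and k m :: nat
  assumes reads: "read_collection R" and k2: "2 \<le> k"
    and solid_ne: "solid_nodes R k \<noteq> {}"
begin

abbreviation "nodes \<equiv> solid_nodes R k \<union> linker_nodes R k"
abbreviation "M \<equiv> rows R k"
abbreviation "N \<equiv> length (rows R k)"
abbreviation "outs \<equiv> out_symbols R k"

definition read_prefix :: "sym list \<Rightarrow> bool" where
  "read_prefix X \<longleftrightarrow> (\<exists>x\<in>rc_closure R. prefix X x)"

definition pad :: "sym list \<Rightarrow> sym list" where
  "pad X = replicate (k - 1 - length X) Dollar @ X"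

definition idx :: "sym list \<Rightarrow> nat" where
  "idx u = (THE j. j < N \<and> M ! j = u)"

lemma Dollar_notin_read: "x \<in> rc_closure R \<Longrightarrow> Dollar \<notin> set x"
proof -
  have "complement b = Dollar \<longleftrightarrow> b = Dollar" for b by (cases b) auto
  then show "x \<in> rc_closure R \<Longrightarrow> Dollar \<notin> set x"
    using reads by (auto simp: read_collection_def rc_closure_def rc_def) (metis)
qed

lemma read_length: "x \<in> rc_closure R \<Longrightarrow> k - 1 \<le> length x"
proof -
  obtain r where r: "\<forall>x\<in>R. length x = r" using reads by (auto simp: read_collection_def)
  then have r': "length x = r" if "x \<in> rc_closure R" for x
    using that by (auto simp: rc_closure_def rc_def)
  from solid_ne obtain u y where "length u = k - 1" "y \<in> rc_closure R" "sublist u y"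
    by (auto simp: solid_nodes_def)
  then have "k - 1 \<le> r" using sublist_length_le[of u y] r' by auto
  then show "x \<in> rc_closure R \<Longrightarrow> k - 1 \<le> length x" using r' by auto
qed

lemma finite_reads: "finite (rc_closure R)"
  using reads by (simp add: read_collection_def rc_closure_def)

lemma finite_solid: "finite (solid_nodes R k)"
proof (rule finite_subset)
  show "solid_nodes R k \<subseteq> (\<Union>x\<in>rc_closure R. {u. sublist u x})"
    by (auto simp: solid_nodes_def)
  have "{u. sublist u x} = set (sublists x)" for x :: "sym list"
    by (simp add: set_sublists_eq)
  then show "finite (\<Union>x\<in>rc_closure R. {u. sublist u x})"
    using finite_reads by simp
qed

lemma finite_linker: "finite (linker_nodes R k)"
proof (rule finite_subset)
  show "linker_nodes R k \<subseteq> pad ` (\<Union>x\<in>rc_closure R. set (prefixes x))"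
    by (force simp: linker_nodes_def pad_def intro!: image_eqI)
  show "finite (pad ` (\<Union>x\<in>rc_closure R. set (prefixes x)))"
    using finite_reads by simp
qed

lemma finite_nodes: "finite nodes"
  using finite_solid finite_linker by simp

lemma set_rows: "set M = nodes"
proof -
  have "set (sorted_list_of_set (rev ` nodes)) = rev ` nodes"
    using finite_nodes by (intro set_sorted_list_of_set) simp
  then show ?thesis by (simp add: rows_def image_image)
qed

lemma map_rev_rows: "map rev M = sorted_list_of_set (rev ` nodes)"
  by (simp add: rows_def o_def)

lemma rows_colex: "i < j \<Longrightarrow> j < N \<Longrightarrow> rev (M ! i) < rev (M ! j)"
proof -
  have "sorted_wrt (<) (map rev M)"
    unfolding map_rev_rows by (rule strict_sorted_list_of_set)
  then show "i < j \<Longrightarrow> j < N \<Longrightarrow> rev (M ! i) < rev (M ! j)"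
    by (auto simp: sorted_wrt_iff_nth_less)
qed

lemma distinct_rows: "distinct M"
  unfolding rows_def by (simp add: distinct_map)

lemma idx_nth [simp]: "j < N \<Longrightarrow> idx (M ! j) = j"
  unfolding idx_def using distinct_rows by (intro the_equality) (auto simp: nth_eq_iff_index_eq)

lemma idx_node:
  assumes "u \<in> nodes" shows idx_less: "idx u < N" and nth_idx: "M ! idx u = u"
proof -
  obtain j where "j < N" "M ! j = u" using assms set_rows by (metis in_set_conv_nth)
  then show "idx u < N" "M ! idx u = u" using idx_nth by auto
qed

lemma nth_rows_nodes: "j < N \<Longrightarrow> M ! j \<in> nodes"
  using set_rows nth_mem by blast

lemma length_node: "u \<in> nodes \<Longrightarrow> length u = k - 1"
  by (auto simp: solid_nodes_def linker_nodes_def)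

lemma length_row [simp]: "j < N \<Longrightarrow> length (M ! j) = k - 1"
  using length_node nth_rows_nodes by blast

lemma row_ne [simp]: "j < N \<Longrightarrow> M ! j \<noteq> []"
  using length_row[of j] k2 by (auto simp del: length_row)

lemma read_prefix_mono: "read_prefix X \<Longrightarrow> prefix Y X \<Longrightarrow> read_prefix Y"
  unfolding read_prefix_def using prefix_order.trans by blast

lemma Dollar_notin_read_prefix: "read_prefix X \<Longrightarrow> Dollar \<notin> set X"
  unfolding read_prefix_def using Dollar_notin_read set_mono_prefix by blast

lemma Dollar_notin_solid: "u \<in> solid_nodes R k \<Longrightarrow> Dollar \<notin> set u"
  unfolding solid_nodes_def using Dollar_notin_read set_mono_sublist by blast

lemma read_prefix_Nil: "read_prefix []"
  using solid_ne by (auto simp: read_prefix_def solid_nodes_def)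

lemma linker_nodes_pad: "linker_nodes R k = {pad X | X. length X < k - 1 \<and> read_prefix X}"
  by (simp add: linker_nodes_def pad_def read_prefix_def)

lemma linker_not_solid: "u \<in> linker_nodes R k \<Longrightarrow> u \<notin> solid_nodes R k"
  using Dollar_notin_solid by (fastforce simp: linker_nodes_def)

lemma p_node_iff: "u \<in> p_nodes R k \<longleftrightarrow> length u = k - 1 \<and> read_prefix u"
  unfolding p_nodes_def solid_nodes_def read_prefix_def using prefix_imp_sublist by blast

lemma pad_full: "length X = k - 1 \<Longrightarrow> pad X = X"
  by (simp add: pad_def)

lemma pad_node: "read_prefix X \<Longrightarrow> length X \<le> k - 1 \<Longrightarrow> pad X \<in> nodes"
  using p_node_iff[of X] by (cases "length X = k - 1") (auto simp: pad_full p_nodes_def linker_nodes_pad)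

lemma llabel_pad: "Dollar \<notin> set X \<Longrightarrow> llabel (pad X) = X"
  unfolding llabel_def pad_def
  by (subst dropWhile_append2) (auto, cases X, auto)

lemma pad_inject:
  "Dollar \<notin> set X \<Longrightarrow> Dollar \<notin> set Y \<Longrightarrow> pad X = pad Y \<longleftrightarrow> X = Y"
  by (metis llabel_pad)

lemma outs_solid: "u \<in> solid_nodes R k \<Longrightarrow> outs u = {b. \<exists>x\<in>rc_closure R. sublist (u @ [b]) x}"
  by (simp add: out_symbols_def)

lemma outs_pad:
  assumes "read_prefix X" "length X < k - 1"
  shows "outs (pad X) = {b. read_prefix (X @ [b])}"
proof -
  have "pad X \<notin> solid_nodes R k"
    using assms linker_not_solid linker_nodes_pad by blast
  then show ?thesis
    using llabel_pad[OF Dollar_notin_read_prefix[OF assms(1)]]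
    by (simp add: out_symbols_def read_prefix_def)
qed

lemma outs_not_Dollar: "u \<in> nodes \<Longrightarrow> b \<in> outs u \<Longrightarrow> b \<noteq> Dollar"
proof -
  assume "u \<in> nodes" "b \<in> outs u"
  then consider "u \<in> solid_nodes R k" | X where "u = pad X" "length X < k - 1" "read_prefix X"
    by (auto simp: linker_nodes_pad)
  then show "b \<noteq> Dollar"
  proof cases
    case 1
    then show ?thesis using \<open>b \<in> outs u\<close> Dollar_notin_read
      by (fastforce simp: outs_solid dest: set_mono_sublist)
  next
    case 2
    then show ?thesis using \<open>b \<in> outs u\<close> Dollar_notin_read_prefix[of "X @ [b]"] by (auto simp: outs_pad)
  qed
qed

lemma tl_pad_snoc:
  assumes "length X < k - 1" shows "tl (pad X) @ [b] = pad (X @ [b])"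
proof -
  obtain d where d: "k - 1 - length X = Suc d" using assms by (metis Suc_diff_Suc)
  then have "k - 1 - length (X @ [b]) = d" by simp
  then show ?thesis using d by (simp add: pad_def)
qed

lemma edge_target_node:
  assumes "u \<in> nodes" "b \<in> outs u" shows "tl u @ [b] \<in> nodes"
proof -
  from assms consider "u \<in> solid_nodes R k" | X where "u = pad X" "length X < k - 1" "read_prefix X"
    by (auto simp: linker_nodes_pad)
  then show ?thesis
  proof cases
    case 1
    then obtain x where x: "x \<in> rc_closure R" "sublist (u @ [b]) x" using assms by (auto simp: outs_solid)
    have "length u = k - 1" using 1 by (simp add: solid_nodes_def)
    then have "u \<noteq> []" using k2 by auto
    then have "sublist (tl u @ [b]) (u @ [b])"
      by (metis sublist_tl tl_append2)
    then have "tl u @ [b] \<in> solid_nodes R k"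
      using x \<open>length u = k - 1\<close> \<open>u \<noteq> []\<close> k2 sublist_order.order.trans[of "tl u @ [b]" "u @ [b]"]
      by (auto simp: solid_nodes_def)
    then show ?thesis by simp
  next
    case 2
    then show ?thesis using assms(2) pad_node[of "X @ [b]"] by (simp add: tl_pad_snoc outs_pad)
  qed
qed

lemma ex_edge_source:
  assumes "u \<in> nodes" "last u = b" "b \<noteq> Dollar"
  shows "\<exists>u'\<in>nodes. b \<in> outs u' \<and> tl u' @ [b] = u"
proof -
  have pre: ?thesis if "read_prefix (X @ [b])" "u = pad (X @ [b])" "length X < k - 1" for X
  proof -
    have "read_prefix X" using that read_prefix_mono by auto
    then show ?thesis using that pad_node[of X]
      by (intro bexI[of _ "pad X"]) (auto simp: tl_pad_snoc outs_pad)
  qed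
  have "u \<noteq> []" using assms(1) length_node k2 by fastforce
  then obtain Y where u: "u = Y @ [b]" using assms(2) by (metis append_butlast_last_id)
  from assms consider "u \<in> solid_nodes R k" | X where "u = pad X" "length X < k - 1" "read_prefix X"
    by (auto simp: linker_nodes_pad)
  then show ?thesis
  proof cases
    case 1
    then obtain x as bs where x: "x \<in> rc_closure R" "x = as @ u @ bs" and len: "length u = k - 1"
      by (auto simp: solid_nodes_def sublist_def)
    show ?thesis
    proof (cases as rule: rev_cases)
      case Nil
      then have "read_prefix u" using x unfolding read_prefix_def by (metis append_Nil prefixI)
      then show ?thesis using pre[of Y] u len by (simp add: pad_full)
    next
      case (snoc as' a)
      have "x = as' @ (a # Y) @ ([b] @ bs)" "x = as' @ (a # Y @ [b]) @ bs"
        using x u snoc by simp_all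
      then have "sublist (a # Y) x" "sublist (a # Y @ [b]) x"
        unfolding sublist_def by blast+
      then show ?thesis using x u len
        by (intro bexI[of _ "a # Y"]) (auto simp: solid_nodes_def out_symbols_def)
    qed
  next
    case 2
    have "X \<noteq> []" using 2 assms(2,3) \<open>u \<noteq> []\<close> by (auto simp: pad_def)
    then obtain X' where "X = X' @ [last X]" by (metis append_butlast_last_id)
    moreover have "last X = b" using 2 assms(2) \<open>X \<noteq> []\<close> by (simp add: pad_def)
    ultimately show ?thesis using 2 pre[of X'] by (metis Suc_lessD length_append_singleton)
  qed
qed

definition unflagged :: "sym \<Rightarrow> nat \<Rightarrow> bool" where
  "unflagged b n \<longleftrightarrow> b \<in> outs (M ! n) \<and> \<not> (\<exists>j<n. tl (M ! j) = tl (M ! n) \<and> b \<in> outs (M ! j))"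

definition edge_rank :: "sym \<Rightarrow> nat \<Rightarrow> nat" where
  "edge_rank b n = length (filter (unflagged b) [0..<n])"

definition first_row :: "sym \<Rightarrow> nat" where
  "first_row b = length (filter (\<lambda>u. last u < b) M)"

lemma last_mono: "i < j \<Longrightarrow> j < N \<Longrightarrow> last (M ! i) \<le> last (M ! j)"
proof -
  assume "i < j" "j < N"
  then have "rev (M ! i) < rev (M ! j)" "M ! i \<noteq> []" "M ! j \<noteq> []" using rows_colex by auto
  then show ?thesis
    by (cases "M ! i" rule: rev_cases; cases "M ! j" rule: rev_cases) (auto simp: less_le)
qed

lemma rev_row_less_iff: "i < N \<Longrightarrow> j < N \<Longrightarrow> rev (M ! i) < rev (M ! j) \<longleftrightarrow> i < j"
  using rows_colex[of i j] rows_colex[of j i] by (cases i j rule: linorder_cases) auto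

lemma first_row_le_iff:
  assumes "r < N" shows "first_row c \<le> r \<longleftrightarrow> c \<le> last (M ! r)"
proof -
  have eq: "first_row c = card {j. j < N \<and> last (M ! j) < c}"
    by (simp add: first_row_def length_filter_conv_card)
  show ?thesis
  proof (cases "c \<le> last (M ! r)")
    case True
    have "j < r" if "j < N" "last (M ! j) < c" for j
      using last_mono[of r j] that True by (cases j r rule: linorder_cases) auto
    then have "{j. j < N \<and> last (M ! j) < c} \<subseteq> {..<r}" by auto
    then have "first_row c \<le> card {..<r}" unfolding eq by (rule card_mono[rotated]) simp
    then show ?thesis using True by simp
  next
    case False
    have "last (M ! j) < c" if "j \<le> r" for j
      using last_mono[of j r] that False assms by (cases "j = r") auto
    then have "{..r} \<subseteq> {j. j < N \<and> last (M ! j) < c}" using assms by auto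
    then have "card {..r} \<le> first_row c" unfolding eq by (rule card_mono[rotated]) simp
    then show ?thesis using False by simp
  qed
qed

lemma row_eq_first_row:
  assumes "r < N" "last (M ! r) = b"
  shows "r = first_row b + card {j. j < r \<and> last (M ! j) = b}"
proof -
  have "j < N \<and> last (M ! j) < b \<longleftrightarrow> j < r \<and> last (M ! j) < b" for j
    using last_mono[of r j] assms by (cases j r rule: linorder_cases) auto
  then have "first_row b = card {j. j < r \<and> last (M ! j) < b}"
    by (simp add: first_row_def length_filter_conv_card)
  then have "first_row b + card {j. j < r \<and> last (M ! j) = b}
    = card ({j. j < r \<and> last (M ! j) < b} \<union> {j. j < r \<and> last (M ! j) = b})"
    by (subst card_Un_disjoint) auto
  also have "{j. j < r \<and> last (M ! j) < b} \<union> {j. j < r \<and> last (M ! j) = b} = {..<r}"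
    using last_mono[OF _ assms(1)] assms(2) by (auto simp: le_less)
  finally show ?thesis by simp
qed

definition target :: "sym \<Rightarrow> nat \<Rightarrow> nat" where
  "target b n = idx (tl (M ! n) @ [b])"

lemma target_node:
  assumes "n < N" "b \<in> outs (M ! n)"
  shows target_less: "target b n < N" and nth_target: "M ! target b n = tl (M ! n) @ [b]"
  using edge_target_node[OF nth_rows_nodes assms(2)] assms(1)
  unfolding target_def by (auto simp: idx_node)

lemma unflagged_out: "unflagged b n \<Longrightarrow> b \<in> outs (M ! n)"
  by (simp add: unflagged_def)

lemma target_strict_mono:
  assumes "n' < n" "n < N" "unflagged b n'" "unflagged b n"
  shows "target b n' < target b n"
proof -
  have "butlast (rev (M ! n')) \<le> butlast (rev (M ! n))"
    using assms rows_colex[of n' n] by (intro butlast_mono) auto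
  moreover have "tl (M ! n') \<noteq> tl (M ! n)" using assms by (auto simp: unflagged_def)
  ultimately have "rev (tl (M ! n') @ [b]) < rev (tl (M ! n) @ [b])"
    by (auto simp: butlast_rev less_le)
  then show ?thesis
    using assms target_node[OF _ unflagged_out] by (simp flip: rev_row_less_iff)
qed

lemma target_inj:
  "n < N \<Longrightarrow> n' < N \<Longrightarrow> unflagged b n \<Longrightarrow> unflagged b n' \<Longrightarrow> target b n = target b n' \<Longrightarrow> n = n'"
  by (metis linorder_neqE_nat order_less_irrefl target_strict_mono)

lemma ex_unflagged:
  assumes "r < N" "last (M ! r) = b" "b \<noteq> Dollar"
  shows "\<exists>n<N. unflagged b n \<and> target b n = r"
proof -
  let ?P = "\<lambda>n. n < N \<and> b \<in> outs (M ! n) \<and> tl (M ! n) @ [b] = M ! r"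
  obtain u where u: "u \<in> nodes" "b \<in> outs u" "tl u @ [b] = M ! r"
    using ex_edge_source[OF nth_rows_nodes] assms by blast
  then have ex: "?P (idx u)" by (simp add: idx_node del: Un_iff)
  define n where "n = (LEAST n. ?P n)"
  have "?P n" unfolding n_def using ex by (rule LeastI)
  moreover have "\<not> ?P j" if "j < n" for j using that not_less_Least unfolding n_def by blast
  ultimately have "unflagged b n"
    unfolding unflagged_def by (metis order.strict_trans)
  then show ?thesis using \<open>?P n\<close> assms(1) by (auto simp: target_def)
qed

lemma target_eq:
  assumes "n < N" "unflagged b n"
  shows "target b n = first_row b + edge_rank b n"
proof -
  let ?r = "target b n"
  have out: "b \<in> outs (M ! n)" using assms by (simp add: unflagged_def)
  have b: "b \<noteq> Dollar" using outs_not_Dollar[OF nth_rows_nodes out] assms by simp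
  have r: "?r < N" "last (M ! ?r) = b" using target_node[OF assms(1) out] by auto
  have "bij_betw (target b) {n'. n' < n \<and> unflagged b n'} {j. j < ?r \<and> last (M ! j) = b}"
    unfolding bij_betw_def
  proof (intro conjI set_eqI iffI)
    show "inj_on (target b) {n'. n' < n \<and> unflagged b n'}"
      using assms(1) by (intro inj_onI) (auto intro: target_inj)
  next
    fix j assume "j \<in> target b ` {n'. n' < n \<and> unflagged b n'}"
    then obtain n' where "n' < n" "unflagged b n'" "j = target b n'" by blast
    then show "j \<in> {j. j < ?r \<and> last (M ! j) = b}"
      using assms target_strict_mono[of n' n b] nth_target[of n' b, OF _ unflagged_out] by simp
  next
    fix j assume j: "j \<in> {j. j < ?r \<and> last (M ! j) = b}"
    then obtain n' where n': "n' < N" "unflagged b n'" "target b n' = j"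
      using ex_unflagged[of j b] r b by auto
    moreover have "n' < n"
      using target_strict_mono[of n n' b] n' j assms by (cases n n' rule: linorder_cases) auto
    ultimately show "j \<in> target b ` {n'. n' < n \<and> unflagged b n'}" by auto
  qed
  then have "card {j. j < ?r \<and> last (M ! j) = b} = card {n'. n' < n \<and> unflagged b n'}"
    by (simp add: bij_betw_same_card)
  also have "\<dots> = edge_rank b n"
    unfolding edge_rank_def by (simp add: length_filter_conv_card cong: conj_cong)
  finally show ?thesis using row_eq_first_row[OF r] by simp
qed

lemma edge_rank_Suc: "edge_rank b (Suc n) = edge_rank b n + of_bool (unflagged b n)"
  by (simp add: edge_rank_def)

abbreviation "I \<equiv> rboss_index R k m"

abbreviation "row_len n \<equiv> length (row_symbols R k n)"

lemma row_len_pos: "0 < row_len n"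
  by (auto simp: row_symbols_def Let_def)

lemma code_E_seq: "map E_code (E_seq R k) = concat (map (\<lambda>n. map E_code (row_symbols R k n)) [0..<N])"
  by (simp add: E_seq_def map_concat o_def)

lemma count_code:
  assumes "b \<noteq> Dollar"
  shows "length (filter (\<lambda>y. y = sym_code b) (map E_code (row_symbols R k n))) = of_bool (unflagged b n)"
proof -
  have code: "E_code (b', f) = sym_code b \<longleftrightarrow> b' = b \<and> \<not> f" for b' f
    using sym_code_less[of b] by (auto simp: sigma_eq sym_code_inject)
  have one: "length (filter (\<lambda>x. x = b \<and> P x) syms) = of_bool (P b)" for P
  proof (cases "P b")
    case True
    then have "filter (\<lambda>x. x = b \<and> P x) syms = filter (\<lambda>x. x = b) syms"
      by (intro filter_cong) auto
    then show ?thesis using True by (cases b) (simp_all add: syms_def)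
  qed (auto simp: filter_empty_conv)
  have "filter (\<lambda>x. x \<in> outs (M ! n)) syms = [] \<Longrightarrow> \<not> unflagged b n"
    using set_syms by (auto simp: filter_empty_conv unflagged_def)
  moreover have "E_code (Dollar, False) \<noteq> sym_code b" using assms code by blast
  moreover have "length (filter (\<lambda>x. x = b \<and> (x \<in> outs (M ! n) \<and>
      \<not> (\<exists>j<n. tl (M ! j) = tl (M ! n) \<and> x \<in> outs (M ! j)))) syms) = of_bool (unflagged b n)"
    unfolding one by (simp add: unflagged_def)
  ultimately show ?thesis
    by (auto simp: row_symbols_def Let_def filter_map o_def code conj_ac simp del: E_code.simps)
qed

lemma length_E: "length (boss_E I) = offset row_len N"
  by (simp add: rboss_index_def E_seq_def length_concat_upt)

lemma rows_le_E: "N \<le> length (boss_E I)"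
proof -
  have "n \<le> offset row_len n" for n
  proof (induction n)
    case (Suc n)
    then show ?case using row_len_pos[of n] unfolding offset_Suc by linarith
  qed simp
  then show ?thesis by (simp add: length_E)
qed

lemma E_rank_offset:
  "n \<le> N \<Longrightarrow> b \<noteq> Dollar \<Longrightarrow> answer I E_Rank (offset row_len n) (sym_code b) = edge_rank b n"
  using rank_blocks[of n N "sym_code b" "\<lambda>n. map E_code (row_symbols R k n)" "unflagged b", OF _ count_code]
  by (simp add: rboss_index_def code_E_seq edge_rank_def)

lemma B_select: "n < N \<Longrightarrow> answer I B_Select n c = offset row_len (Suc n) - 1"
  using select_mark_blocks[of row_len n N] row_len_pos
  by (simp add: rboss_index_def B_seq_def)

lemma B_rank_E_select:
  assumes "n < N" "b \<noteq> Dollar" "unflagged b n"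
  shows "answer I B_Rank (answer I E_Select (edge_rank b n) (sym_code b)) c = n"
proof -
  let ?p = "answer I E_Select (edge_rank b n) (sym_code b)"
  have "offset row_len n \<le> ?p \<and> ?p < offset row_len (Suc n)"
    using select_blocks[of N "sym_code b" "\<lambda>n. map E_code (row_symbols R k n)" "unflagged b" n, OF count_code] assms
    by (simp add: rboss_index_def code_E_seq edge_rank_def)
  then show ?thesis
    using rank_mark_blocks[of row_len n N ?p] row_len_pos assms(1)
    by (simp add: rboss_index_def B_seq_def)
qed

lemma E_select_less:
  assumes "n < N" "b \<noteq> Dollar" "unflagged b n"
  shows "answer I E_Select (edge_rank b n) (sym_code b) < length (boss_E I)"
proof -
  let ?p = "answer I E_Select (edge_rank b n) (sym_code b)"
  have "?p < offset row_len (Suc n)"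
    using select_blocks[of N "sym_code b" "\<lambda>n. map E_code (row_symbols R k n)" "unflagged b" n, OF count_code] assms
    by (simp add: rboss_index_def code_E_seq edge_rank_def)
  also have "\<dots> \<le> offset row_len N" using assms(1) by (intro offset_mono) simp
  finally show ?thesis by (simp add: length_E)
qed

lemma C_access: "answer I C_Access (sym_code b) c = first_row b"
proof -
  have "sym_code b < length syms" by (cases b) (auto simp: syms_def)
  then show ?thesis
    by (simp add: rboss_index_def nth_or_0_def C_arr_def syms_nth_code first_row_def)
qed

text \<open>Several edges may lead to row \<open>r\<close>; the unflagged one leaves the smallest row.\<close>

definition pred_row :: "nat \<Rightarrow> nat" where
  "pred_row r = (THE n. n < N \<and> unflagged (last (M ! r)) n \<and> target (last (M ! r)) n = r)"

lemma pred_row: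
  assumes "r < N" "last (M ! r) \<noteq> Dollar"
  shows pred_row_less: "pred_row r < N"
    and unflagged_pred_row: "unflagged (last (M ! r)) (pred_row r)"
    and target_pred_row: "target (last (M ! r)) (pred_row r) = r"
proof -
  obtain n where n: "n < N \<and> unflagged (last (M ! r)) n \<and> target (last (M ! r)) n = r"
    using ex_unflagged[OF assms(1) refl assms(2)] by blast
  then have "n' = n" if "n' < N \<and> unflagged (last (M ! r)) n' \<and> target (last (M ! r)) n' = r" for n'
    using that target_inj by metis
  then have "pred_row r = n" unfolding pred_row_def using n by (intro the_equality)
  then show "pred_row r < N" "unflagged (last (M ! r)) (pred_row r)"
    "target (last (M ! r)) (pred_row r) = r" using n by auto
qed

lemma pred_row_eqI:
  "n < N \<Longrightarrow> unflagged b n \<Longrightarrow> target b n = r \<Longrightarrow> pred_row r = n"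
proof -
  assume n: "n < N" "unflagged b n" "target b n = r"
  have out: "b \<in> outs (M ! n)" using n(2) by (rule unflagged_out)
  have "r < N" "last (M ! r) = b" using target_node[OF n(1) out] n(3) by auto
  moreover have "b \<noteq> Dollar" using outs_not_Dollar[OF nth_rows_nodes[OF n(1)] out] .
  ultimately have "pred_row r < N" "unflagged b (pred_row r)" "target b (pred_row r) = r"
    using pred_row[of r] by auto
  then show ?thesis using n target_inj[of "pred_row r" n b] by simp
qed

lemma pred_row_query:
  assumes "r < N" "last (M ! r) = b" "b \<noteq> Dollar"
  shows "first_row b \<le> r"
    and "answer I E_Select (r - first_row b) (sym_code b) < length (boss_E I)"
    and "answer I B_Rank (answer I E_Select (r - first_row b) (sym_code b)) c = pred_row r"
proof -
  note p = pred_row[of r, unfolded assms(2), OF assms(1,3)]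
  have "r = first_row b + edge_rank b (pred_row r)"
    using target_eq[OF p(1,2)] p(3) by simp
  then have "first_row b \<le> r" and eq: "r - first_row b = edge_rank b (pred_row r)" by linarith+
  then show "first_row b \<le> r" by simp
  show "answer I E_Select (r - first_row b) (sym_code b) < length (boss_E I)"
    unfolding eq by (rule E_select_less[OF p(1) assms(3) p(2)])
  show "answer I B_Rank (answer I E_Select (r - first_row b) (sym_code b)) c = pred_row r"
    unfolding eq by (rule B_rank_E_select[OF p(1) assms(3) p(2)])
qed

abbreviation "row_of X \<equiv> idx (pad X)"

lemma row_of_less: "read_prefix X \<Longrightarrow> length X \<le> k - 1 \<Longrightarrow> row_of X < N"
  using pad_node idx_less by blast

lemma nth_row_of: "read_prefix X \<Longrightarrow> length X \<le> k - 1 \<Longrightarrow> M ! row_of X = pad X"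
  using pad_node nth_idx by blast

lemma row_of_inject:
  "read_prefix X \<Longrightarrow> read_prefix Y \<Longrightarrow> length X \<le> k - 1 \<Longrightarrow> length Y \<le> k - 1 \<Longrightarrow>
    row_of X = row_of Y \<longleftrightarrow> X = Y"
  by (metis nth_row_of pad_inject Dollar_notin_read_prefix)

lemma row_of_Nil: "row_of [] = 0"
proof (rule ccontr)
  assume *: "row_of [] \<noteq> 0"
  have lt: "row_of [] < N" and nth: "M ! row_of [] = replicate (k - 1) Dollar"
    using row_of_less[OF read_prefix_Nil] nth_row_of[OF read_prefix_Nil] by (auto simp: pad_def)
  have "rev (M ! 0) < rev (M ! row_of [])" using * lt by (intro rows_colex) auto
  moreover have "replicate (k - 1) Dollar \<le> rev (M ! 0)"
    using length_row[of 0] lt by (intro replicate_Dollar_le) (cases N, simp_all)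
  ultimately show False by (simp add: nth)
qed

text \<open>Among the nodes that agree with a linker node except in the first symbol, the linker node
  comes first, so its outgoing edges carry no flag.\<close>

lemma unflagged_row_of_iff:
  assumes X: "read_prefix X" "length X < k - 1"
  shows "unflagged b (row_of X) \<longleftrightarrow> read_prefix (X @ [b])"
proof -
  have lt: "row_of X < N" and nth: "M ! row_of X = pad X"
    using row_of_less nth_row_of X by auto
  have "\<not> (\<exists>j<row_of X. tl (M ! j) = tl (M ! row_of X))"
  proof
    assume "\<exists>j<row_of X. tl (M ! j) = tl (M ! row_of X)"
    then obtain j where j: "j < row_of X" "tl (M ! j) = tl (M ! row_of X)" by blast
    have "k - 1 - length X = Suc (k - 1 - Suc (length X))" using X by (simp add: Suc_diff_Suc)
    then have "pad X = Dollar # tl (pad X)" unfolding pad_def by simp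
    then have "M ! row_of X = Dollar # tl (M ! row_of X)" unfolding nth .
    moreover have "M ! j = hd (M ! j) # tl (M ! j)" using row_ne[of j] j(1) lt by simp
    ultimately have "rev (M ! row_of X) \<le> rev (M ! j)"
      using j(2) by (metis Dollar_le snoc_le_snoc rev.simps(2))
    then show False using rows_colex[OF j(1) lt] by simp
  qed
  then show ?thesis unfolding unflagged_def nth outs_pad[OF X] by (metis mem_Collect_eq nth)
qed

lemma target_row_of:
  assumes "read_prefix X" "length X < k - 1"
  shows "target b (row_of X) = row_of (X @ [b])"
  using assms by (simp add: target_def nth_row_of tl_pad_snoc)

lemma pred_row_row_of:
  assumes "read_prefix (X @ [b])" "length X < k - 1"
  shows "pred_row (row_of (X @ [b])) = row_of X"
proof -
  have "read_prefix X" using assms(1) read_prefix_mono by auto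
  then show ?thesis
    using assms by (intro pred_row_eqI[of _ b]) (auto simp: unflagged_row_of_iff target_row_of row_of_less)
qed

lemma last_row_of:
  assumes "read_prefix X" "X \<noteq> []" "length X \<le> k - 1"
  shows "last (M ! row_of X) = last X" and "last X \<noteq> Dollar"
proof -
  show "last (M ! row_of X) = last X"
    unfolding nth_row_of[OF assms(1,3)] using assms(2) by (simp add: pad_def)
  show "last X \<noteq> Dollar"
    using Dollar_notin_read_prefix[OF assms(1)] last_in_set[OF assms(2)] by metis
qed

text \<open>Walking backwards from a solid node for \<open>k - 1\<close> steps reads the node from right to left; the
  walk ends in row \<open>0\<close>, the node without label, exactly for the p-nodes.\<close>

lemma pred_walk_suffix:
  assumes "v \<in> solid_nodes R k" "j \<le> k - 1"
  shows "(pred_row ^^ j) (idx v) < N \<and> suffix (take (k - 1 - j) v) (M ! (pred_row ^^ j) (idx v))"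
  using assms(2)
proof (induction j)
  case 0
  then show ?case using assms by (auto simp: idx_node solid_nodes_def)
next
  case (Suc j)
  let ?r = "(pred_row ^^ j) (idx v)"
  have len: "length v = k - 1" using assms(1) by (simp add: solid_nodes_def)
  define Z where "Z = take (k - 1 - Suc j) v"
  define b where "b = v ! (k - 1 - Suc j)"
  have Zb: "take (k - 1 - j) v = Z @ [b]"
    using Suc.prems len take_Suc_conv_app_nth[of "k - 1 - Suc j" v] by (simp add: Z_def b_def Suc_diff_Suc)
  have r: "?r < N" "suffix (Z @ [b]) (M ! ?r)" using Suc Zb by auto
  have "b \<in> set v" unfolding b_def using Suc.prems len by (intro nth_mem) simp
  then have "b \<noteq> Dollar" using Dollar_notin_solid[OF assms(1)] by metis
  moreover have last: "last (M ! ?r) = b" using r(2) by (auto simp: suffix_def)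
  ultimately have p: "pred_row ?r < N" "unflagged b (pred_row ?r)" "target b (pred_row ?r) = ?r"
    using pred_row[OF r(1)] by auto
  then have "tl (M ! pred_row ?r) @ [b] = M ! ?r"
    using target_node(2) unflagged_out by metis
  then have "suffix Z (tl (M ! pred_row ?r))" using r(2) by (metis snoc_suffix_snoc)
  then have "suffix Z (M ! pred_row ?r)" using suffix_tl suffix_order.trans by blast
  then show ?case using p(1) by (simp add: Z_def)
qed

lemma pred_walk_p_node:
  assumes v: "v \<in> solid_nodes R k"
  shows "(pred_row ^^ (k - 1)) (idx v) = 0 \<longleftrightarrow> v \<in> p_nodes R k"
proof
  assume p: "v \<in> p_nodes R k"
  then have rp: "read_prefix v" and len: "length v = k - 1" by (auto simp: p_node_iff)
  have "j \<le> k - 1 \<Longrightarrow> (pred_row ^^ j) (idx v) = row_of (take (k - 1 - j) v)" for j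
  proof (induction j)
    case 0
    then show ?case using len by (simp add: pad_full)
  next
    case (Suc j)
    have t: "take (k - 1 - j) v = take (k - 1 - Suc j) v @ [v ! (k - 1 - Suc j)]"
      using Suc.prems len take_Suc_conv_app_nth[of "k - 1 - Suc j" v] by (simp add: Suc_diff_Suc)
    have "read_prefix (take (k - 1 - j) v)" using rp read_prefix_mono take_is_prefix by blast
    then show ?case using Suc t len pred_row_row_of by simp
  qed
  from this[of "k - 1"] show "(pred_row ^^ (k - 1)) (idx v) = 0" by (simp add: row_of_Nil)
next
  assume z: "(pred_row ^^ (k - 1)) (idx v) = 0"
  have len: "length v = k - 1" using v by (simp add: solid_nodes_def)
  have "e \<le> k - 1 \<Longrightarrow> read_prefix (take e v) \<and> (pred_row ^^ (k - 1 - e)) (idx v) = row_of (take e v)" for e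
  proof (induction e)
    case 0
    then show ?case using z by (simp add: row_of_Nil read_prefix_Nil)
  next
    case (Suc e)
    let ?r = "(pred_row ^^ (k - 1 - Suc e)) (idx v)"
    have t: "take (Suc e) v = take e v @ [v ! e]"
      using Suc.prems len by (simp add: take_Suc_conv_app_nth)
    have r: "?r < N" "suffix (take (Suc e) v) (M ! ?r)"
      using pred_walk_suffix[OF v, of "k - 1 - Suc e"] Suc.prems by auto
    have "last (M ! ?r) = v ! e" using r(2) by (auto simp: suffix_def t)
    moreover have "v ! e \<noteq> Dollar"
      using Dollar_notin_solid[OF v] Suc.prems len by (metis Suc_le_lessD nth_mem)
    ultimately have p: "unflagged (v ! e) (pred_row ?r)" "target (v ! e) (pred_row ?r) = ?r"
      using pred_row[OF r(1)] by auto
    have "pred_row ?r = (pred_row ^^ (k - 1 - e)) (idx v)"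
      using Suc.prems by (metis Suc_diff_Suc Suc_le_lessD funpow.simps(2) o_apply)
    then have pr: "pred_row ?r = row_of (take e v)" "read_prefix (take e v)" using Suc by auto
    then show ?case
      using p Suc.prems len unfolding t by (simp add: unflagged_row_of_iff target_row_of)
  qed
  from this[of "k - 1"] show "v \<in> p_nodes R k" by (simp add: p_node_iff len)
qed

end

section \<open>Ancestors of a leaf and deletion of internal nodes\<close>

type_synonym forest = "(sym list \<times> ctree) list"

fun nleaves :: "ctree \<Rightarrow> nat" where
  "nleaves Leaf = 1"
| "nleaves (Node es) = sum_list (map (\<lambda>(l, t). nleaves t) es)"

abbreviation fleaves :: "forest \<Rightarrow> nat" where
  "fleaves es \<equiv> sum_list (map (\<lambda>(l, t). nleaves t) es)"

definition dollar_first :: "forest \<Rightarrow> bool" where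
  "dollar_first es \<longleftrightarrow> set (fst (hd es)) \<subseteq> {Dollar}"

abbreviation shift :: "sym list \<Rightarrow> nat \<Rightarrow> sym list \<times> nat \<times> bool \<Rightarrow> sym list \<times> nat \<times> bool" where
  "shift l a \<equiv> (\<lambda>(Y, n, f). (l @ Y, a + n, f))"

text \<open>The internal nodes of a forest above its \<open>i\<close>-th leaf, from the top down, each given by its
  string, the number of leaves to its left, and whether its leftmost edge is dummy.\<close>

fun ancestors :: "forest \<Rightarrow> nat \<Rightarrow> (sym list \<times> nat \<times> bool) list" where
  "ancestors [] i = []"
| "ancestors ((l, Leaf) # es) i = (if i < 1 then [] else map (shift [] 1) (ancestors es (i - 1)))"
| "ancestors ((l, Node es') # es) i =
    (if i < fleaves es' then (l, 0, dollar_first es') # map (shift l 0) (ancestors es' i)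
     else map (shift [] (fleaves es')) (ancestors es (i - fleaves es')))"

fun well_labelled :: "ctree \<Rightarrow> bool" where
  "well_labelled Leaf = True"
| "well_labelled (Node es) \<longleftrightarrow>
    es \<noteq> [] \<and> (\<forall>(l, t)\<in>set es. well_labelled t \<and> (set l \<subseteq> {Dollar} \<longrightarrow> t = Leaf))"

abbreviation well_labelled_forest :: "forest \<Rightarrow> bool" where
  "well_labelled_forest es \<equiv> \<forall>(l, t)\<in>set es. well_labelled t \<and> (set l \<subseteq> {Dollar} \<longrightarrow> t = Leaf)"

lemma shift_shift: "map (shift l a) (map (shift l' b) L) = map (shift (l @ l') (a + b)) L"
  by (auto simp: add.assoc)

lemma shift_id: "map (shift [] 0) L = L"
  by (induction L) auto

lemma ancestors_append:
  "ancestors (es1 @ es2) i =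
    (if i < fleaves es1 then ancestors es1 i
     else map (shift [] (fleaves es1)) (ancestors es2 (i - fleaves es1)))"
proof (induction es1 i rule: ancestors.induct)
  case (1 i)
  then show ?case by (simp add: shift_id)
next
  case (2 l es i)
  then show ?case by (cases i) (auto simp: shift_shift)
next
  case (3 l es' es i)
  then show ?case by (auto simp: shift_shift)
qed

lemma ancestors_prepend:
  "ancestors (map (\<lambda>(l', t). (l @ l', t)) es) i = map (shift l 0) (ancestors es i)"
proof (induction es i rule: ancestors.induct)
  case (1 i)
  then show ?case by simp
next
  case (2 l es i)
  then show ?case by (cases i) (auto simp: shift_shift)
next
  case (3 l es' es i)
  then show ?case by (auto simp: shift_shift)
qed

lemma fleaves_prepend: "fleaves (map (\<lambda>(l', t). (l @ l', t)) es) = fleaves es"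
  by (rule arg_cong[of _ _ sum_list]) auto

abbreviation delete_forest :: "(nat \<Rightarrow> forest \<Rightarrow> bool) \<Rightarrow> nat \<Rightarrow> forest \<Rightarrow> forest" where
  "delete_forest bad d es \<equiv> concat (map (delete_edge bad d) es)"

lemma fleaves_delete_edge: "fleaves (delete_edge bad d e) = nleaves (snd e)"
proof (induction bad d e rule: delete_edge.induct)
  case (2 bad d l es)
  then have "fleaves (delete_forest bad (d + length l) es) = fleaves es"
    by (induction es) (auto simp: case_prod_beta)
  then show ?case using fleaves_prepend[of l "delete_forest bad (d + length l) es"]
    by (simp add: Let_def del: map_map)
qed simp

lemma fleaves_delete_forest: "fleaves (delete_forest bad d es) = fleaves es"
proof (induction es)
  case (Cons e es)
  then show ?case using fleaves_delete_edge[of bad d e] by (cases e) simp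
qed simp

lemma delete_edge_props:
  "well_labelled (snd e) \<Longrightarrow> set (fst e) \<subseteq> {Dollar} \<longrightarrow> snd e = Leaf \<Longrightarrow>
    delete_edge bad d e \<noteq> [] \<and> (dollar_first (delete_edge bad d e) \<longleftrightarrow> set (fst e) \<subseteq> {Dollar}) \<and>
    well_labelled_forest (delete_edge bad d e)"
proof (induction bad d e rule: delete_edge.induct)
  case (1 bad d l)
  then show ?case by (simp add: dollar_first_def)
next
  case (2 bad d l es)
  let ?D = "delete_forest bad (d + length l) es"
  have IH: "delete_edge bad (d + length l) e \<noteq> [] \<and> well_labelled_forest (delete_edge bad (d + length l) e)"
    if "e \<in> set es" for e
  proof -
    have "well_labelled (snd e) \<and> (set (fst e) \<subseteq> {Dollar} \<longrightarrow> snd e = Leaf)"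
      using "2.prems"(1) that by (fastforce simp: case_prod_beta)
    then show ?thesis using "2.IH"[OF that] by blast
  qed
  have "es \<noteq> []" and l: "\<not> set l \<subseteq> {Dollar}" using "2.prems" by auto
  then have "?D \<noteq> []" using IH by (cases es) auto
  moreover have D: "well_labelled_forest ?D" using IH by fastforce
  ultimately show ?case using l
    by (cases "bad (d + length l) ?D") (auto simp: Let_def dollar_first_def hd_map split_beta)
qed

lemma well_labelled_delete_forest:
  "well_labelled_forest es \<Longrightarrow> well_labelled_forest (delete_forest bad d es)"
  using delete_edge_props by fastforce

lemma dollar_first_delete_forest:
  assumes "well_labelled_forest es" "es \<noteq> []"
  shows "dollar_first (delete_forest bad d es) = dollar_first es" "delete_forest bad d es \<noteq> []"
proof -
  obtain e es' where es: "es = e # es'" using assms(2) by (cases es) auto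
  have "well_labelled (snd e)" "set (fst e) \<subseteq> {Dollar} \<longrightarrow> snd e = Leaf"
    using assms(1) es by (auto simp: case_prod_beta)
  from delete_edge_props[OF this, of bad d] have
    "delete_edge bad d e \<noteq> []" "dollar_first (delete_edge bad d e) \<longleftrightarrow> set (fst e) \<subseteq> {Dollar}" by auto
  then show "dollar_first (delete_forest bad d es) = dollar_first es" "delete_forest bad d es \<noteq> []"
    by (auto simp: es dollar_first_def)
qed

lemma ancestors_delete:
  assumes "well_labelled_forest es"
  shows "ancestors (delete_forest (\<lambda>d es. \<beta> d (dollar_first es)) d es) i
    = filter (\<lambda>(Y, n, f). \<not> \<beta> (d + length Y) f) (ancestors es i)"
  using assms
proof (induction es i arbitrary: d rule: ancestors.induct)
  case (1 i)
  then show ?case by simp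
next
  case (2 l es i)
  then show ?case by (cases i) (auto simp: filter_map o_def case_prod_beta)
next
  case (3 l es' es i)
  let ?bad = "\<lambda>d es. \<beta> d (dollar_first es)"
  let ?D = "delete_forest ?bad (d + length l) es'"
  have wl: "well_labelled_forest es'" "es' \<noteq> []" using "3.prems" by auto
  have fl: "fleaves (delete_edge ?bad d (l, Node es')) = fleaves es'"
    using fleaves_delete_edge[of ?bad d "(l, Node es')"] by simp
  show ?case
  proof (cases "i < fleaves es'")
    case True
    have IH: "ancestors ?D i = filter (\<lambda>(Y, n, f). \<not> \<beta> (d + length l + length Y) f) (ancestors es' i)"
      using "3.IH"(1)[OF True wl(1)] .
    have df: "dollar_first ?D = dollar_first es'" using dollar_first_delete_forest(1)[OF wl] .
    have "ancestors (delete_forest ?bad d ((l, Node es') # es)) i = ancestors (delete_edge ?bad d (l, Node es')) i"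
      using True fl by (simp add: ancestors_append del: delete_edge.simps)
    also have "\<dots> = filter (\<lambda>(Y, n, f). \<not> \<beta> (d + length Y) f)
        ((l, 0, dollar_first es') # map (shift l 0) (ancestors es' i))"
    proof (cases "\<beta> (d + length l) (dollar_first es')")
      case bad: True
      have "ancestors (delete_edge ?bad d (l, Node es')) i = map (shift l 0) (ancestors ?D i)"
        using bad df by (simp add: Let_def ancestors_prepend)
      then show ?thesis
        unfolding IH using bad by (simp add: filter_map o_def case_prod_unfold add.assoc)
    next
      case False
      then have "ancestors (delete_edge ?bad d (l, Node es')) i
          = (l, 0, dollar_first es') # map (shift l 0) (ancestors ?D i)"
        using df True fleaves_delete_forest[of ?bad "d + length l" es'] by (simp add: Let_def)
      then show ?thesis
        unfolding IH using False by (simp add: filter_map o_def case_prod_unfold add.assoc)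
    qed
    finally show ?thesis using True by simp
  next
    case False
    then show ?thesis using "3.IH"(2)[OF False] "3.prems" fl
      by (simp add: ancestors_append filter_map o_def case_prod_unfold del: delete_edge.simps)
  qed
qed

section \<open>Balanced parentheses\<close>

definition balance :: "bool list \<Rightarrow> int" where
  "balance xs = sum_list (map (\<lambda>b. if b then 1 else - 1) xs)"

lemma balance_simps [simp]:
  "balance [] = 0" "balance (b # xs) = (if b then 1 else - 1) + balance xs"
  "balance (xs @ ys) = balance xs + balance ys"
  by (simp_all add: balance_def)

lemma excess_segment: "excess (xs @ ys @ zs) (length xs) (length xs + length ys) = balance ys"
proof (induction ys arbitrary: zs rule: rev_induct)
  case Nil
  then show ?case by (simp add: excess_def)
next
  case (snoc y ys)
  have "{length xs..<length xs + length (ys @ [y])} = insert (length xs + length ys) {length xs..<length xs + length ys}"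
    by auto
  then show ?case using snoc[of "y # zs"] by (simp add: excess_def nth_append)
qed

definition balanced :: "bool list \<Rightarrow> bool" where
  "balanced xs \<longleftrightarrow> balance xs = 0 \<and> (\<forall>n. balance (drop n xs) \<le> 0)"

lemma balanced_Nil: "balanced []"
  by (simp add: balanced_def)

lemma balanced_append: "balanced xs \<Longrightarrow> balanced ys \<Longrightarrow> balanced (xs @ ys)"
  by (auto simp: balanced_def intro: add_nonpos_nonpos)

lemma balanced_wrap: "balanced xs \<Longrightarrow> balanced (True # xs @ [False])"
proof -
  assume xs: "balanced xs"
  have "balance (drop n (True # xs @ [False])) \<le> 0" for n
  proof (cases n)
    case (Suc n')
    have "balance (drop (n' - length xs) [False]) \<le> 0" by (cases "n' - length xs") auto
    then show ?thesis using xs Suc by (auto simp: balanced_def intro: add_nonpos_nonpos)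
  qed (use xs in \<open>simp add: balanced_def\<close>)
  then show ?thesis using xs by (simp add: balanced_def)
qed

abbreviation bp_forest :: "forest \<Rightarrow> bool list" where
  "bp_forest es \<equiv> concat (map (\<lambda>(l, t). bp_of t) es)"

lemma balanced_concat: "(\<And>x. x \<in> set xss \<Longrightarrow> balanced x) \<Longrightarrow> balanced (concat xss)"
  by (induction xss) (auto simp: balanced_Nil intro: balanced_append)

lemma balanced_bp_of: "balanced (bp_of t)"
proof (induction t)
  case Leaf
  then show ?case using balanced_wrap[OF balanced_Nil] by simp
next
  case (Node es)
  then have "balanced (bp_forest es)"
    by (intro balanced_concat) fastforce
  then show ?case using balanced_wrap by simp
qed

lemma last_filter_upt:
  assumes "Q a" "a < n" "\<And>j. a < j \<Longrightarrow> j < n \<Longrightarrow> \<not> Q j"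
  shows "nth_or_0 (rev (filter Q [0..<n])) 0 = a"
proof -
  have "[0..<n] = [0..<a] @ a # [Suc a..<n]"
    using \<open>a < n\<close> upt_add_eq_append[of 0 a "n - a"] by (simp add: upt_conv_Cons)
  moreover have "filter Q [Suc a..<n] = []" using assms(3) by (auto simp: filter_empty_conv)
  ultimately have "rev (filter Q [0..<n]) = a # rev (filter Q [0..<a])"
    using assms(1) by simp
  then show ?thesis by (simp add: nth_or_0_def)
qed

lemma enclose_eq:
  assumes "balanced mid"
  shows "enclose (pre @ True # mid @ post) (length (pre @ True # mid)) = length pre"
  unfolding enclose_def
proof (rule last_filter_upt)
  let ?P = "pre @ True # mid @ post" and ?q = "length (pre @ True # mid)"
  show "length pre < ?q \<and> excess ?P (length pre) ?q = 1"
    using excess_segment[of pre "True # mid" post] assms by (simp add: balanced_def)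
  show "length pre < length ?P" by simp
  fix j assume j: "length pre < j" "j < length ?P"
  show "\<not> (j < ?q \<and> excess ?P j ?q = 1)"
  proof
    assume *: "j < ?q \<and> excess ?P j ?q = 1"
    define n where "n = j - Suc (length pre)"
    have n: "n \<le> length mid" "j = Suc (length pre) + n" using * j by (auto simp: n_def)
    have "?P = (pre @ True # take n mid) @ drop n mid @ post"
      by (metis (no_types, lifting) append.assoc append_Cons append_take_drop_id)
    moreover have "length (pre @ True # take n mid) = j" using n by simp
    moreover have "j + length (drop n mid) = ?q" using n by simp
    ultimately have "excess ?P j ?q = balance (drop n mid)"
      using excess_segment[of "pre @ True # take n mid" "drop n mid" post] by metis
    then show False using * assms by (simp add: balanced_def) (metis not_one_le_zero)
  qed
qed

lemma leaf_positions_append: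
  assumes "xs = [] \<or> \<not> last xs \<or> ys = [] \<or> hd ys"
  shows "leaf_positions (xs @ ys) = leaf_positions xs @ map ((+) (length xs)) (leaf_positions ys)"
proof -
  have split: "[0..<length (xs @ ys)] = [0..<length xs] @ map ((+) (length xs)) [0..<length ys]"
    by (rule nth_equalityI) (auto simp: nth_append)
  have 1: "Suc p < length (xs @ ys) \<and> (xs @ ys) ! p \<and> \<not> (xs @ ys) ! Suc p \<longleftrightarrow>
      Suc p < length xs \<and> xs ! p \<and> \<not> xs ! Suc p" if "p < length xs" for p
  proof (cases "Suc p < length xs")
    case False
    then have p: "length xs = Suc p" using that by simp
    then have "xs ! p = last xs" by (cases xs rule: rev_cases) auto
    moreover have "ys \<noteq> [] \<Longrightarrow> (xs @ ys) ! Suc p = hd ys" using p by (simp add: nth_append hd_conv_nth)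
    ultimately show ?thesis using p assms that by (auto simp: nth_append)
  qed (use that in \<open>auto simp: nth_append\<close>)
  have 2: "Suc (length xs + p) < length (xs @ ys) \<and> (xs @ ys) ! (length xs + p) \<and>
      \<not> (xs @ ys) ! Suc (length xs + p) \<longleftrightarrow>
      Suc p < length ys \<and> ys ! p \<and> \<not> ys ! Suc p" for p
    using nth_append_length_plus[of xs ys "Suc p"] by simp
  show ?thesis
    unfolding leaf_positions_def split filter_append filter_map o_def
    using 1 2 by (intro arg_cong2[of _ _ _ _ append] arg_cong[of _ _ "map _"] filter_cong) auto
qed

lemma leaf_positions_singleton [simp]: "leaf_positions [] = []" "leaf_positions [b] = []"
  "leaf_positions [True, False] = [0]"
  by (auto simp: leaf_positions_def)

lemma bp_of_props: "bp_of t \<noteq> []" "hd (bp_of t)" "\<not> last (bp_of t)"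
  by (cases t; simp)+

lemma bp_forest_props:
  assumes "es \<noteq> []" shows "bp_forest es \<noteq> []" "hd (bp_forest es)" "\<not> last (bp_forest es)"
proof -
  obtain l t es' where "es = (l, t) # es'" using assms by (cases es) auto
  then show "bp_forest es \<noteq> []" "hd (bp_forest es)" using bp_of_props[of t] by auto
  obtain l t es' where "es = es' @ [(l, t)]" using assms by (cases es rule: rev_cases) auto
  then show "\<not> last (bp_forest es)" using bp_of_props[of t] by auto
qed

lemma leaf_positions_bp_append:
  "leaf_positions (bp_of t @ ys) = leaf_positions (bp_of t) @ map ((+) (length (bp_of t))) (leaf_positions ys)"
  "leaf_positions (xs @ bp_of t) = leaf_positions xs @ map ((+) (length xs)) (leaf_positions (bp_of t))"
  using bp_of_props[of t] by (simp_all add: leaf_positions_append)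

lemma leaf_positions_Node:
  "es \<noteq> [] \<Longrightarrow> leaf_positions (bp_of (Node es)) = map Suc (leaf_positions (bp_forest es))"
  using leaf_positions_append[of "[True]" "bp_forest es @ [False]"]
    leaf_positions_append[of "bp_forest es" "[False]"] bp_forest_props[of es]
  by (simp add: o_def)

lemma length_leaf_positions:
  "well_labelled t \<Longrightarrow> length (leaf_positions (bp_of t)) = nleaves t"
proof (induction t)
  case Leaf
  then show ?case by simp
next
  case (Node es)
  have "length (leaf_positions (bp_of t)) = nleaves t" if "(l, t) \<in> set es" for l t
    using Node.IH[of "(l, t)" t] Node.prems that by (fastforce simp: case_prod_beta)
  then have "length (leaf_positions (bp_forest es)) = fleaves es"
  proof (induction es)
    case (Cons e es)
    obtain l t where "e = (l, t)" by (cases e)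
    moreover have "length (leaf_positions (bp_of t)) = nleaves t"
      using Cons.prems[of l t] calculation by simp
    moreover have "length (leaf_positions (bp_forest es)) = fleaves es"
      using Cons.prems by (intro Cons.IH) auto
    ultimately show ?case by (simp add: leaf_positions_bp_append)
  qed simp
  then show ?case using leaf_positions_Node Node.prems by simp
qed

fun enclose_chain :: "bool list \<Rightarrow> nat \<Rightarrow> nat list \<Rightarrow> nat \<Rightarrow> bool" where
  "enclose_chain P r [] x \<longleftrightarrow> enclose P x = r"
| "enclose_chain P r (p # ps) x \<longleftrightarrow> enclose P p = r \<and> enclose_chain P p ps x"

lemma enclose_chain_last: "enclose_chain P r ps x \<Longrightarrow> enclose P x = last (r # ps)"
  by (induction ps arbitrary: r) auto

lemma enclose_chain_prefix: "enclose_chain P r (qs @ p # rs) x \<Longrightarrow> enclose_chain P r qs p"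
  by (induction qs arbitrary: r) auto

definition leaf_rank :: "bool list \<Rightarrow> nat \<Rightarrow> nat" where
  "leaf_rank P q = length (filter (\<lambda>p. p < q) (leaf_positions P))"

lemma leaf_rank_length:
  assumes "xs = [] \<or> \<not> last xs \<or> ys = [] \<or> hd ys"
  shows "leaf_rank (xs @ ys) (length xs) = length (leaf_positions xs)"
proof -
  have "\<forall>p\<in>set (leaf_positions xs). p < length xs" by (auto simp: leaf_positions_def)
  then have "filter (\<lambda>p. p < length xs) (leaf_positions xs) = leaf_positions xs"
    by (simp add: filter_id_conv)
  then show ?thesis using assms by (simp add: leaf_rank_def leaf_positions_append filter_map o_def)
qed

lemma bp_ancestors:
  assumes "well_labelled_forest es" "i < fleaves es" "balanced mid"
    and "P = (pre @ True # mid) @ bp_forest es @ post"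
  shows "\<exists>ps. enclose_chain P (length pre) ps (leaf_positions P ! (length (leaf_positions (pre @ True # mid)) + i))
    \<and> map (leaf_rank P) ps = map (\<lambda>(Y, n, f). length (leaf_positions (pre @ True # mid)) + n) (ancestors es i)
    \<and> (\<forall>p\<in>set ps. length pre < p \<and> p < length P)"
  using assms
proof (induction es i arbitrary: pre mid post rule: ancestors.induct)
  case (1 i)
  then show ?case by simp
next
  case (2 l es i)
  let ?A = "pre @ True # mid"
  have P: "P = ?A @ [True, False] @ (bp_forest es @ post)" using "2.prems"(4) by simp
  have A': "leaf_positions (pre @ True # (mid @ [True, False])) = leaf_positions ?A @ [length ?A]"
    using leaf_positions_append[of ?A "[True, False]"] by simp
  show ?case
  proof (cases i)
    case 0
    have "enclose P (length ?A) = length pre"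
      using enclose_eq[OF "2.prems"(3), of pre "[True, False] @ bp_forest es @ post"] P by simp
    moreover have "leaf_positions P ! length (leaf_positions ?A) = length ?A"
      using leaf_positions_append[of "?A @ [True, False]" "bp_forest es @ post"] A' P
      by (simp add: nth_append)
    ultimately show ?thesis using 0 by (intro exI[of _ "[]"]) simp
  next
    case (Suc i')
    have "balanced (mid @ [True, False])"
      using "2.prems"(3) balanced_bp_of[of Leaf] by (intro balanced_append) auto
    then obtain ps where "enclose_chain P (length pre) ps
        (leaf_positions P ! (length (leaf_positions (pre @ True # (mid @ [True, False]))) + i'))
      \<and> map (leaf_rank P) ps = map (\<lambda>(Y, n, f). length (leaf_positions (pre @ True # (mid @ [True, False]))) + n)
          (ancestors es i')
      \<and> (\<forall>p\<in>set ps. length pre < p \<and> p < length P)"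
      using "2.IH"[of "mid @ [True, False]" pre post] "2.prems" Suc by auto
    then show ?thesis using Suc unfolding A' by (intro exI[of _ ps]) (simp add: case_prod_beta)
  qed
next
  case (3 l es' es i)
  let ?A = "pre @ True # mid" and ?t = "Node es'"
  have wl: "well_labelled ?t" using "3.prems"(1) by auto
  then have ne: "es' \<noteq> []" by simp
  have A': "length (leaf_positions (pre @ True # (mid @ bp_of ?t))) = length (leaf_positions ?A) + fleaves es'"
    using leaf_positions_bp_append(2)[of ?A ?t] length_leaf_positions[OF wl] by simp
  show ?case
  proof (cases "i < fleaves es'")
    case True
    have P: "P = (?A @ True # []) @ bp_forest es' @ ([False] @ bp_forest es @ post)"
      using "3.prems"(4) by simp
    have lp: "leaf_positions (?A @ True # []) = leaf_positions ?A"
      using leaf_positions_append[of ?A "[True]"] by simp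
    from "3.IH"(1)[OF True _ True balanced_Nil P] obtain ps where ps:
      "enclose_chain P (length ?A) ps (leaf_positions P ! (length (leaf_positions ?A) + i))"
      "map (leaf_rank P) ps = map (\<lambda>(Y, n, f). length (leaf_positions ?A) + n) (ancestors es' i)"
      "\<forall>p\<in>set ps. length ?A < p \<and> p < length P"
      using wl unfolding lp by auto
    have "enclose P (length ?A) = length pre"
      using enclose_eq[OF "3.prems"(3), of pre "bp_of ?t @ bp_forest es @ post"] "3.prems"(4) by simp
    moreover have "leaf_rank P (length ?A) = length (leaf_positions ?A)"
      using leaf_rank_length[of ?A "bp_of ?t @ bp_forest es @ post"] "3.prems"(4) by simp
    ultimately show ?thesis using ps True P
      by (intro exI[of _ "length ?A # ps"]) (auto simp: case_prod_beta)
  next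
    case False
    have "balanced (mid @ bp_of ?t)"
      using "3.prems"(3) balanced_bp_of by (rule balanced_append)
    moreover have "well_labelled_forest es" "i - fleaves es' < fleaves es"
      "P = (pre @ True # (mid @ bp_of ?t)) @ bp_forest es @ post"
      using "3.prems"(1,2,4) False by auto
    ultimately obtain ps where ps: "enclose_chain P (length pre) ps
        (leaf_positions P ! (length (leaf_positions (pre @ True # (mid @ bp_of ?t))) + (i - fleaves es')))
      \<and> map (leaf_rank P) ps = map (\<lambda>(Y, n, f). length (leaf_positions (pre @ True # (mid @ bp_of ?t))) + n)
          (ancestors es (i - fleaves es'))
      \<and> (\<forall>p\<in>set ps. length pre < p \<and> p < length P)"
      using "3.IH"(2)[OF False] by blast
    then show ?thesis using False unfolding A'
      by (intro exI[of _ ps]) (simp add: case_prod_beta add.assoc)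
  qed
qed

section \<open>Compact tries\<close>

definition diverge_at :: "sym list \<Rightarrow> sym list \<Rightarrow> sym list \<Rightarrow> bool" where
  "diverge_at Y x y \<longleftrightarrow> prefix Y x \<and> prefix Y y \<and> length Y < length x \<and> length Y < length y \<and>
    x ! length Y \<noteq> y ! length Y"

lemma diverge_at_append: "diverge_at (L @ Y) (L @ x) (L @ y) \<longleftrightarrow> diverge_at Y x y"
  by (simp add: diverge_at_def nth_append)

definition first_with :: "sym list \<Rightarrow> sym list list \<Rightarrow> nat" where
  "first_with Y xs = length (takeWhile (\<lambda>x. \<not> prefix Y x) xs)"

lemma first_with_less: "x \<in> set xs \<Longrightarrow> prefix Y x \<Longrightarrow> first_with Y xs < length xs"
  unfolding first_with_def
  by (metis (mono_tags, lifting) length_takeWhile_le nat_less_le set_takeWhileD takeWhile_eq_all_conv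
      takeWhile_eq_take take_all_iff)

lemma prefix_first_with: "x \<in> set xs \<Longrightarrow> prefix Y x \<Longrightarrow> prefix Y (xs ! first_with Y xs)"
  using first_with_less[of x xs Y] nth_length_takeWhile[of "\<lambda>x. \<not> prefix Y x" xs]
  unfolding first_with_def by auto

lemma first_with_le: "j < length xs \<Longrightarrow> prefix Y (xs ! j) \<Longrightarrow> first_with Y xs \<le> j"
  unfolding first_with_def
  by (metis nth_mem not_less set_takeWhileD takeWhile_nth)

lemma first_with_append:
  "\<forall>x\<in>set xs. \<not> prefix Y x \<Longrightarrow> \<exists>x\<in>set ys. prefix Y x \<Longrightarrow>
    first_with Y (xs @ ys @ zs) = length xs + first_with Y ys"
  by (auto simp: first_with_def takeWhile_append)

definition dollar_tailed :: "sym list \<Rightarrow> bool" where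
  "dollar_tailed x \<longleftrightarrow> (\<forall>a b. x = a @ Dollar # b \<longrightarrow> set b \<subseteq> {Dollar})"

lemma dollar_tailed_append: "dollar_tailed (a @ x) \<Longrightarrow> dollar_tailed x"
  unfolding dollar_tailed_def by (metis append.assoc)

definition trie_input :: "nat \<Rightarrow> sym list list \<Rightarrow> bool" where
  "trie_input n xs \<longleftrightarrow> sorted_wrt (<) xs \<and> (\<forall>x\<in>set xs. length x = n \<and> dollar_tailed x)"

lemma filter_split_min:
  fixes f :: "'a \<Rightarrow> 'b :: linorder"
  assumes "sorted (map f xs)" "\<forall>x\<in>set xs. b \<le> f x"
  shows "filter (\<lambda>x. f x = b) xs @ filter (\<lambda>x. f x \<noteq> b) xs = xs"
  using assms
proof (induction xs)
  case (Cons x xs)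
  show ?case
  proof (cases "f x = b")
    case True
    then show ?thesis using Cons by simp
  next
    case False
    then have "\<forall>y\<in>set xs. f y \<noteq> b" using Cons.prems by fastforce
    then show ?thesis using False by (simp add: filter_empty_conv filter_id_conv)
  qed
qed simp

lemma concat_groups:
  fixes f :: "'a \<Rightarrow> 'b :: linorder"
  assumes "sorted (map f xs)" "f ` set xs \<subseteq> set bs" "sorted_wrt (<) bs"
  shows "concat (map (\<lambda>b. filter (\<lambda>x. f x = b) xs) bs) = xs"
  using assms
proof (induction bs arbitrary: xs)
  case (Cons b bs)
  let ?xs = "filter (\<lambda>x. f x \<noteq> b) xs"
  have "concat (map (\<lambda>b. filter (\<lambda>x. f x = b) ?xs) bs) = ?xs"
    using Cons.prems by (intro Cons.IH) (auto intro: sorted_filter)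
  moreover have "map (\<lambda>b. filter (\<lambda>x. f x = b) ?xs) bs = map (\<lambda>b. filter (\<lambda>x. f x = b) xs) bs"
    using Cons.prems(3) by (auto intro!: filter_cong)
  moreover have "\<forall>x\<in>set xs. b \<le> f x" using Cons.prems by fastforce
  ultimately show ?case
    using filter_split_min[OF Cons.prems(1), of b] by (simp only: list.map concat.simps)
qed simp

lemma sorted_syms: "sorted_wrt (<) syms"
  by (simp add: syms_def less_sym_def)

definition groups :: "sym list list \<Rightarrow> sym list list list" where
  "groups xs = filter (\<lambda>ys. ys \<noteq> []) (map (\<lambda>b. filter (\<lambda>x. x \<noteq> [] \<and> hd x = b) xs) syms)"

abbreviation lcp :: "sym list list \<Rightarrow> sym list" where
  "lcp ys \<equiv> Longest_common_prefix (set ys)"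

lemma ctrie_Node:
  "\<not> length xs \<le> 1 \<Longrightarrow> ctrie xs = Node (map (\<lambda>ys. (lcp ys, ctrie (map (drop (length (lcp ys))) ys))) (groups xs))"
  by (subst ctrie.simps) (simp add: groups_def)

lemma ctrie_Leaf: "length xs \<le> 1 \<Longrightarrow> ctrie xs = Leaf"
  by (subst ctrie.simps) simp

lemma trie_input_two:
  assumes "trie_input n xs" "\<not> length xs \<le> 1"
  shows "xs ! 0 \<in> set xs" "xs ! 1 \<in> set xs" "xs ! 0 \<noteq> xs ! 1"
proof -
  obtain x y zs where "xs = x # y # zs"
    using assms(2) by (metis One_nat_def Suc_le_mono length_Cons list.exhaust list.size(3) zero_le)
  then show "xs ! 0 \<in> set xs" "xs ! 1 \<in> set xs" "xs ! 0 \<noteq> xs ! 1"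
    using assms(1) by (auto simp: trie_input_def)
qed

lemma trie_input_nonempty:
  assumes "trie_input n xs" "\<not> length xs \<le> 1" shows "0 < n"
proof (rule ccontr)
  assume "\<not> 0 < n"
  moreover have "length (xs ! 0) = n" "length (xs ! 1) = n"
    using trie_input_two[OF assms] assms(1) by (auto simp: trie_input_def)
  ultimately show False using trie_input_two(3)[OF assms] by simp
qed

lemma concat_groups_trie:
  assumes "trie_input n xs" "0 < n"
  shows "concat (groups xs) = xs"
proof -
  have ne: "x \<noteq> []" if "x \<in> set xs" for x using assms that by (auto simp: trie_input_def)
  have "sorted (map hd xs)"
    unfolding sorted_wrt_map
  proof (rule sorted_wrt_mono_rel)
    show "sorted_wrt (<) xs" using assms by (simp add: trie_input_def)
    fix x y assume xy: "x \<in> set xs" "y \<in> set xs" "x < y"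
    show "hd x \<le> hd y" using ne[OF xy(1)] ne[OF xy(2)] xy(3) by (cases x; cases y) auto
  qed
  then have "concat (map (\<lambda>b. filter (\<lambda>x. hd x = b) xs) syms) = xs"
    using sorted_syms by (intro concat_groups) (auto simp: syms_def, metis sym.exhaust)
  moreover have "filter (\<lambda>x. x \<noteq> [] \<and> hd x = b) xs = filter (\<lambda>x. hd x = b) xs" for b
    using ne by (intro filter_cong) auto
  moreover have "concat (filter (\<lambda>ys. ys \<noteq> []) gs) = concat gs" for gs :: "sym list list list"
    by (induction gs) auto
  ultimately show ?thesis by (simp add: groups_def)
qed

lemma group_props:
  assumes "trie_input n xs" "0 < n" "ys \<in> set (groups xs)"
  shows "ys \<noteq> []" and "\<exists>b. ys = filter (\<lambda>x. hd x = b) xs \<and> prefix [b] (lcp ys)"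
    and "\<forall>y\<in>set ys. prefix (lcp ys) y"
    and "trie_input (n - length (lcp ys)) (map (drop (length (lcp ys))) ys)"
    and "map ((@) (lcp ys)) (map (drop (length (lcp ys))) ys) = ys"
proof -
  have ne: "x \<noteq> []" if "x \<in> set xs" for x using assms(1,2) that by (auto simp: trie_input_def)
  show ys: "ys \<noteq> []" using assms(3) by (auto simp: groups_def)
  show pre: "\<forall>y\<in>set ys. prefix (lcp ys) y" by (auto intro: Longest_common_prefix_prefix)
  obtain b where "ys = filter (\<lambda>x. x \<noteq> [] \<and> hd x = b) xs" using assms(3) by (auto simp: groups_def)
  then have b: "ys = filter (\<lambda>x. hd x = b) xs" using ne by (auto intro!: filter_cong)
  have "\<forall>y\<in>set ys. prefix [b] y"
  proof
    fix y assume "y \<in> set ys"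
    then have "y \<noteq> []" "hd y = b" using b ne by auto
    then show "prefix [b] y" by (cases y) auto
  qed
  then have "prefix [b] (lcp ys)" using ys by (intro Longest_common_prefix_max_prefix) auto
  then show "\<exists>b. ys = filter (\<lambda>x. hd x = b) xs \<and> prefix [b] (lcp ys)" using b by blast
  have split: "lcp ys @ drop (length (lcp ys)) y = y" if "y \<in> set ys" for y
    using pre that by (auto simp: prefix_def)
  then show "map ((@) (lcp ys)) (map (drop (length (lcp ys))) ys) = ys"
    by (auto intro: map_idI)
  have "sorted_wrt (<) ys" using assms(1) b by (simp add: trie_input_def sorted_wrt_filter)
  then have "sorted_wrt (<) (map (drop (length (lcp ys))) ys)"
    unfolding sorted_wrt_map
  proof (rule sorted_wrt_mono_rel[rotated])
    fix x y assume "x \<in> set ys" "y \<in> set ys" "x < y"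
    then have "lcp ys @ drop (length (lcp ys)) x < lcp ys @ drop (length (lcp ys)) y"
      using split by simp
    moreover have "L @ u < L @ w \<Longrightarrow> u < w" for L u w :: "sym list" by (induction L) auto
    ultimately show "drop (length (lcp ys)) x < drop (length (lcp ys)) y" by blast
  qed
  moreover have "\<forall>y\<in>set ys. length y = n \<and> dollar_tailed y"
    using assms(1) b by (auto simp: trie_input_def)
  ultimately show "trie_input (n - length (lcp ys)) (map (drop (length (lcp ys))) ys)"
    using split dollar_tailed_append by (auto simp: trie_input_def) metis
qed

lemma lcp_diverge:
  assumes "trie_input n ys" "\<not> length ys \<le> 1" "x \<in> set ys"
  shows "\<exists>y\<in>set ys. diverge_at (lcp ys) x y"
proof -
  let ?L = "lcp ys"
  have pre: "\<forall>y\<in>set ys. prefix ?L y" by (auto intro: Longest_common_prefix_prefix)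
  have len: "length y = n" if "y \<in> set ys" for y using assms(1) that by (simp add: trie_input_def)
  have "length ?L < n"
  proof (rule ccontr)
    assume "\<not> length ?L < n"
    then have "y = ?L" if "y \<in> set ys" for y using pre len that
      by (metis append_take_drop_id append_eq_conv_conj drop_all not_less prefix_def append_Nil2)
    then show False using trie_input_two[OF assms(1,2)] by metis
  qed
  moreover have "\<exists>y\<in>set ys. y ! length ?L \<noteq> x ! length ?L"
  proof (rule ccontr)
    assume "\<not> ?thesis"
    then have eq: "y ! length ?L = x ! length ?L" if "y \<in> set ys" for y using that by blast
    have "\<forall>y\<in>set ys. prefix (?L @ [x ! length ?L]) y"
    proof
      fix y assume y: "y \<in> set ys"
      then have "?L = take (length ?L) y" using pre by (metis append_eq_conv_conj prefix_def)
      then have "?L @ [x ! length ?L] = take (Suc (length ?L)) y"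
        using eq[OF y] len[OF y] \<open>length ?L < n\<close> by (metis take_Suc_conv_app_nth)
      then show "prefix (?L @ [x ! length ?L]) y" by (metis take_is_prefix)
    qed
    then have "length (?L @ [x ! length ?L]) \<le> length ?L"
      using assms(3) by (intro Longest_common_prefix_longest) auto
    then show False by simp
  qed
  ultimately show ?thesis using assms(3) pre len unfolding diverge_at_def by metis
qed

lemma ancestors_at:
  assumes "a < nleaves t"
  shows "ancestors (es1 @ (l, t) # es2) (fleaves es1 + a) =
    (case t of Leaf \<Rightarrow> [] | Node es \<Rightarrow>
      (l, fleaves es1, dollar_first es) # map (shift l (fleaves es1)) (ancestors es a))"
  using assms by (cases t) (auto simp: ancestors_append shift_shift)

definition trie_ancestors :: "sym list list \<Rightarrow> nat \<Rightarrow> (sym list \<times> nat \<times> bool) list \<Rightarrow> bool" where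
  "trie_ancestors xs i L \<longleftrightarrow>
    sorted_wrt (\<lambda>a b. length (fst a) < length (fst b)) L \<and>
    set L = {(Y, first_with Y xs, xs ! first_with Y xs ! length Y = Dollar) | Y.
      Y \<noteq> [] \<and> (\<exists>y\<in>set xs. diverge_at Y (xs ! i) y)}"

lemma trie_ancestors_group:
  assumes xs: "xs = xs1 @ ys @ xs2" and ys: "ys = filter (\<lambda>x. hd x = b) xs"
    and ne: "\<forall>x\<in>set xs. x \<noteq> []"
    and pre: "prefix [b] L" "\<forall>y\<in>set ys. prefix L y"
    and div: "\<forall>x\<in>set ys. \<exists>y\<in>set ys. diverge_at L x y"
    and eq: "map ((@) L) zs = ys"
    and a: "a < length zs"
    and zs: "trie_ancestors zs a A"
    and f: "f \<longleftrightarrow> zs ! 0 ! 0 = Dollar"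
  shows "trie_ancestors xs (length xs1 + a) ((L, length xs1, f) # map (shift L (length xs1)) A)"
proof -
  define o1 where "o1 = length xs1"
  have ys_sub: "set ys \<subseteq> set xs" using xs by auto
  have "ys = filter (\<lambda>x. hd x = b) xs1 @ filter (\<lambda>x. hd x = b) ys @ filter (\<lambda>x. hd x = b) xs2"
    using ys xs by simp
  moreover have "filter (\<lambda>x. hd x = b) ys = ys" using ys by (simp add: filter_id_conv)
  ultimately have "length ys = length (filter (\<lambda>x. hd x = b) xs1) + length ys + length (filter (\<lambda>x. hd x = b) xs2)"
    by (metis add.assoc length_append)
  then have "filter (\<lambda>x. hd x = b) xs1 = []" by simp
  then have xs1: "hd x \<noteq> b" if "x \<in> set xs1" for x using that by (auto simp: filter_empty_conv)
  have L: "L \<noteq> []" "hd L = b" using pre(1) by (auto simp: prefix_def)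
  have hd_b: "hd x = b" if "prefix (L @ Y) x" for x Y using that L by (auto simp: prefix_def)
  have len: "length zs = length ys" using eq by (metis length_map)
  have nth: "xs ! (o1 + n) = L @ zs ! n" if "n < length zs" for n
  proof -
    have "xs ! (o1 + n) = ys ! n" using that len xs by (simp add: o1_def nth_append)
    also have "\<dots> = L @ zs ! n" using eq that by (metis nth_map)
    finally show ?thesis .
  qed
  have ys_zs: "y \<in> set ys \<longleftrightarrow> (\<exists>z\<in>set zs. y = L @ z)" for y using eq by auto
  have first: "first_with (L @ Y) xs = o1 + first_with Y zs" if "\<exists>z\<in>set zs. prefix Y z" for Y
  proof -
    have "first_with (L @ Y) xs = o1 + first_with (L @ Y) ys"
      unfolding xs o1_def
    proof (rule first_with_append)
      show "\<forall>x\<in>set xs1. \<not> prefix (L @ Y) x" using xs1 hd_b by blast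
      show "\<exists>x\<in>set ys. prefix (L @ Y) x" using that ys_zs by (metis same_prefix_prefix)
    qed
    also have "first_with (L @ Y) ys = first_with Y zs"
      unfolding first_with_def eq[symmetric] by (simp add: takeWhile_map o_def)
    finally show ?thesis .
  qed
  have char: "xs ! first_with (L @ Y) xs ! length (L @ Y) = zs ! first_with Y zs ! length Y"
    if "\<exists>z\<in>set zs. prefix Y z" for Y
  proof -
    have "first_with Y zs < length zs" using that first_with_less by blast
    then show ?thesis unfolding first[OF that] by (simp add: nth nth_append)
  qed
  have x: "xs ! (o1 + a) = L @ zs ! a" using nth[OF a] .
  have x_ys: "xs ! (o1 + a) \<in> set ys" unfolding x ys_zs using a by auto
  have iff: "Y \<noteq> [] \<and> (\<exists>y\<in>set xs. diverge_at Y (xs ! (o1 + a)) y) \<longleftrightarrow>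
      Y = L \<or> (\<exists>Y'. Y = L @ Y' \<and> Y' \<noteq> [] \<and> (\<exists>z\<in>set zs. diverge_at Y' (zs ! a) z))" (is "?l \<longleftrightarrow> ?r") for Y
  proof
    assume ?l
    then obtain y where y: "y \<in> set xs" "diverge_at Y (xs ! (o1 + a)) y" and "Y \<noteq> []" by blast
    have "hd y = hd Y" "hd (xs ! (o1 + a)) = hd Y"
      using y(2) \<open>Y \<noteq> []\<close> by (auto simp: diverge_at_def prefix_def)
    moreover have "hd (xs ! (o1 + a)) = b" using x_ys ys by auto
    ultimately have "y \<in> set ys" using y(1) ys by auto
    then obtain z where z: "z \<in> set zs" "y = L @ z" using ys_zs by auto
    have "prefix L Y"
    proof (rule ccontr)
      assume "\<not> prefix L Y"
      moreover have "prefix L (xs ! (o1 + a))" "prefix Y (xs ! (o1 + a))"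
        using x y(2) by (auto simp: diverge_at_def)
      ultimately have "prefix Y L" "Y \<noteq> L" using prefix_same_cases by blast+
      then have "length Y < length L" by (simp add: prefix_length_less strict_prefix_def)
      then show False using y(2) x z by (simp add: diverge_at_def nth_append)
    qed
    then obtain Y' where "Y = L @ Y'" by (auto simp: prefix_def)
    then show ?r using y(2) z x diverge_at_append by (cases "Y' = []") auto
  next
    assume ?r
    then show ?l
    proof
      assume "Y = L"
      then show ?l using div x_ys ys_sub L by blast
    next
      assume "\<exists>Y'. Y = L @ Y' \<and> Y' \<noteq> [] \<and> (\<exists>z\<in>set zs. diverge_at Y' (zs ! a) z)"
      then obtain Y' z where Y': "Y = L @ Y'" "z \<in> set zs" "diverge_at Y' (zs ! a) z" by blast
      then have "diverge_at Y (xs ! (o1 + a)) (L @ z)" "L @ z \<in> set ys"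
        using x diverge_at_append ys_zs by auto
      then show ?l using L Y'(1) ys_sub by blast
    qed
  qed
  have zs_ne: "\<exists>z\<in>set zs. prefix [] z" using a by (metis nth_mem Nil_prefix)
  have "set ((L, o1, f) # map (shift L o1) A) =
    {(Y, first_with Y xs, xs ! first_with Y xs ! length Y = Dollar) | Y.
      Y \<noteq> [] \<and> (\<exists>y\<in>set xs. diverge_at Y (xs ! (o1 + a)) y)}"
  proof -
    have "first_with [] zs = 0" using a by (cases zs) (auto simp: first_with_def)
    then have head: "(L, o1, f) = (L, first_with L xs, xs ! first_with L xs ! length L = Dollar)"
      using first[OF zs_ne] char[OF zs_ne] f by simp
    have "set (map (shift L o1) A) = shift L o1 ` {(Y, first_with Y zs, zs ! first_with Y zs ! length Y = Dollar) | Y.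
      Y \<noteq> [] \<and> (\<exists>y\<in>set zs. diverge_at Y (zs ! a) y)}"
      using zs by (simp add: trie_ancestors_def)
    also have "\<dots> = {(L @ Y, o1 + first_with Y zs, zs ! first_with Y zs ! length Y = Dollar) | Y.
      Y \<noteq> [] \<and> (\<exists>y\<in>set zs. diverge_at Y (zs ! a) y)}"
      by (auto simp: image_iff)
    also have "\<dots> = {(L @ Y, first_with (L @ Y) xs, xs ! first_with (L @ Y) xs ! length (L @ Y) = Dollar) | Y.
      Y \<noteq> [] \<and> (\<exists>y\<in>set zs. diverge_at Y (zs ! a) y)}"
    proof (intro Collect_cong ex_cong1)
      fix x Y
      have "\<exists>z\<in>set zs. diverge_at Y (zs ! a) z \<Longrightarrow> \<exists>z\<in>set zs. prefix Y z"
        by (auto simp: diverge_at_def)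
      then show "(x = (L @ Y, o1 + first_with Y zs, zs ! first_with Y zs ! length Y = Dollar) \<and>
          Y \<noteq> [] \<and> (\<exists>y\<in>set zs. diverge_at Y (zs ! a) y)) \<longleftrightarrow>
        (x = (L @ Y, first_with (L @ Y) xs, xs ! first_with (L @ Y) xs ! length (L @ Y) = Dollar) \<and>
          Y \<noteq> [] \<and> (\<exists>y\<in>set zs. diverge_at Y (zs ! a) y))"
        using first[of Y] char[of Y] by (cases "\<exists>y\<in>set zs. diverge_at Y (zs ! a) y") (simp_all only: simp_thms)
    qed
    finally show ?thesis unfolding iff head by auto
  qed
  moreover have "sorted_wrt (\<lambda>a b. length (fst a) < length (fst b)) ((L, o1, f) # map (shift L o1) A)"
  proof -
    have "\<forall>(Y, n, f)\<in>set A. Y \<noteq> []" using zs by (auto simp: trie_ancestors_def)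
    then show ?thesis using zs by (auto simp: trie_ancestors_def sorted_wrt_map case_prod_unfold)
  qed
  ultimately show ?thesis unfolding trie_ancestors_def o1_def by blast
qed

lemma all_Dollar: "dollar_tailed x \<Longrightarrow> x \<noteq> [] \<Longrightarrow> hd x = Dollar \<Longrightarrow> set x \<subseteq> {Dollar}"
proof -
  assume x: "dollar_tailed x" "x \<noteq> []" "hd x = Dollar"
  then have eq: "x = [] @ Dollar # tl x" by (cases x) auto
  then have "set (tl x) \<subseteq> {Dollar}" using x(1) unfolding dollar_tailed_def by blast
  then show ?thesis by (subst eq) simp
qed

lemma nth_concat_split:
  "i < length (concat gs) \<Longrightarrow> \<exists>g1 g g2 a. gs = g1 @ g # g2 \<and> i = length (concat g1) + a \<and> a < length g"
proof (induction gs arbitrary: i)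
  case (Cons h gs)
  show ?case
  proof (cases "i < length h")
    case True
    then show ?thesis by (intro exI[of _ "[]"] exI[of _ h] exI[of _ gs] exI[of _ i]) simp
  next
    case False
    then obtain g1 g g2 a where "gs = g1 @ g # g2 \<and> i - length h = length (concat g1) + a \<and> a < length g"
      using Cons.IH[of "i - length h"] Cons.prems
      by (metis add_diff_inverse_nat concat.simps(2) length_append nat_add_left_cancel_less)
    then show ?thesis using False by (intro exI[of _ "h # g1"] exI[of _ g] exI[of _ g2] exI[of _ a]) auto
  qed
qed simp

lemma dollar_first_ctrie:
  assumes "trie_input n xs" "ctrie xs = Node es"
  shows "dollar_first es \<longleftrightarrow> xs ! 0 ! 0 = Dollar"
proof -
  have len: "\<not> length xs \<le> 1" using assms(2) ctrie_Leaf by fastforce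
  have n: "0 < n" using trie_input_nonempty[OF assms(1) len] .
  have es: "es = map (\<lambda>ys. (lcp ys, ctrie (map (drop (length (lcp ys))) ys))) (groups xs)"
    using ctrie_Node[OF len] assms(2) by simp
  have cc: "concat (groups xs) = xs" using concat_groups_trie[OF assms(1) n] .
  then obtain h gs where gs: "groups xs = h # gs" using len by (cases "groups xs") auto
  then have h: "h \<in> set (groups xs)" by simp
  note hp = group_props[OF assms(1) n h]
  obtain b where b: "h = filter (\<lambda>x. hd x = b) xs" "prefix [b] (lcp h)" using hp(2) by blast
  have x0: "xs ! 0 \<in> set h" using cc gs hp(1) by (cases h) auto
  then have p0: "prefix (lcp h) (xs ! 0)" using hp(3) by blast
  then have hd0: "xs ! 0 \<noteq> []" "hd (xs ! 0) = b" "xs ! 0 ! 0 = b" using b(2) by (auto simp: prefix_def)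
  have df: "dollar_first es \<longleftrightarrow> set (lcp h) \<subseteq> {Dollar}" by (simp add: es gs dollar_first_def)
  show ?thesis
  proof (cases "b = Dollar")
    case True
    have "dollar_tailed (xs ! 0)"
      using assms(1) trie_input_two(1)[OF assms(1) len] by (auto simp: trie_input_def)
    then have "set (xs ! 0) \<subseteq> {Dollar}" using all_Dollar hd0 True by blast
    then show ?thesis using df set_mono_prefix[OF p0] hd0(3) True by simp
  next
    case False
    then show ?thesis using df b(2) hd0 by (auto simp: prefix_def)
  qed
qed

lemma ctrie_ancestors:
  assumes "trie_input n xs" "xs \<noteq> []"
  shows "well_labelled (ctrie xs) \<and> nleaves (ctrie xs) = length xs \<and>
    (\<forall>es i. ctrie xs = Node es \<longrightarrow> i < length xs \<longrightarrow> trie_ancestors xs i (ancestors es i))"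
  using assms
proof (induction xs arbitrary: n rule: ctrie.induct)
  case (1 xs)
  show ?case
  proof (cases "length xs \<le> 1")
    case True
    then show ?thesis using "1.prems" by (cases xs) (auto simp: ctrie_Leaf)
  next
    case False
    have n: "0 < n" using trie_input_nonempty[OF "1.prems"(1) False] .
    define T where "T = (\<lambda>ys. ctrie (map (drop (length (lcp ys))) ys))"
    have ct: "ctrie xs = Node (map (\<lambda>ys. (lcp ys, T ys)) (groups xs))"
      using ctrie_Node[OF False] by (simp add: T_def)
    have cc: "concat (groups xs) = xs" using concat_groups_trie[OF "1.prems"(1) n] .
    have ne: "\<forall>x\<in>set xs. x \<noteq> []" using "1.prems"(1) n by (auto simp: trie_input_def)
    note gp = group_props[OF "1.prems"(1) n]
    have IH: "well_labelled (T ys)" "nleaves (T ys) = length ys"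
      "\<And>es i. T ys = Node es \<Longrightarrow> i < length ys \<Longrightarrow>
        trie_ancestors (map (drop (length (lcp ys))) ys) i (ancestors es i)"
      if "ys \<in> set (groups xs)" for ys
      using "1.IH"[OF False, of ys "n - length (lcp ys)"] that gp(1,4)[OF that]
      by (auto simp: groups_def T_def)
    have sub: "set ys \<subseteq> set xs" if "ys \<in> set (groups xs)" for ys
      using that by (auto simp: groups_def)
    have ti: "trie_input n ys" if "ys \<in> set (groups xs)" for ys
      using gp(2)[OF that] "1.prems"(1) by (auto simp: trie_input_def sorted_wrt_filter)
    have "T ys = Leaf" if ys: "ys \<in> set (groups xs)" "set (lcp ys) \<subseteq> {Dollar}" for ys
    proof -
      obtain b where b: "ys = filter (\<lambda>x. hd x = b) xs" "prefix [b] (lcp ys)" using gp(2)[OF ys(1)] by blast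
      then have "b = Dollar" using ys(2) by (auto simp: prefix_def)
      have eq: "y = replicate n Dollar" if "y \<in> set ys" for y
      proof -
        have "set y \<subseteq> {Dollar}" "length y = n"
          using all_Dollar that b \<open>b = Dollar\<close> "1.prems"(1) ne by (auto simp: trie_input_def)
        then show ?thesis by (metis replicate_eqI singletonD subsetD)
      qed
      have "length ys \<le> 1"
      proof (rule ccontr)
        assume l: "\<not> length ys \<le> 1"
        show False using trie_input_two[OF ti[OF ys(1)] l] eq by metis
      qed
      then show ?thesis by (simp add: T_def ctrie_Leaf)
    qed
    moreover have "groups xs \<noteq> []" using cc "1.prems"(2) by auto
    ultimately have wl: "well_labelled (ctrie xs)" using IH(1) by (auto simp: ct)
    have fl: "fleaves (map (\<lambda>ys. (lcp ys, T ys)) gs) = length (concat gs)" if "set gs \<subseteq> set (groups xs)" for gs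
      using that IH(2) by (induction gs) auto
    then have nl: "nleaves (ctrie xs) = length xs" using cc by (simp add: ct)
    have "trie_ancestors xs i (ancestors (map (\<lambda>ys. (lcp ys, T ys)) (groups xs)) i)" if i: "i < length xs" for i
    proof -
      obtain g1 g g2 a where g: "groups xs = g1 @ g # g2" "i = length (concat g1) + a" "a < length g"
        using nth_concat_split[of i "groups xs"] i cc by auto
      have gm: "g \<in> set (groups xs)" using g(1) by simp
      have xs: "xs = concat g1 @ g @ concat g2" using cc g(1) by simp
      have fl1: "fleaves (map (\<lambda>ys. (lcp ys, T ys)) g1) = length (concat g1)"
        using g(1) by (intro fl) auto
      obtain b where b: "g = filter (\<lambda>x. hd x = b) xs" "prefix [b] (lcp g)" using gp(2)[OF gm] by blast
      have anc: "ancestors (map (\<lambda>ys. (lcp ys, T ys)) (groups xs)) i =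
        (case T g of Leaf \<Rightarrow> [] | Node es \<Rightarrow> (lcp g, length (concat g1), dollar_first es) #
            map (shift (lcp g) (length (concat g1))) (ancestors es a))"
        using ancestors_at[of a "T g" "map (\<lambda>ys. (lcp ys, T ys)) g1" "lcp g" "map (\<lambda>ys. (lcp ys, T ys)) g2"]
          IH(2)[OF gm] g unfolding fl1 by simp
      show ?thesis
      proof (cases "T g")
        case Leaf
        have "length g \<le> 1"
        proof (rule ccontr)
          assume "\<not> length g \<le> 1"
          then show False using Leaf ctrie_Node[of "map (drop (length (lcp g))) g"] by (simp add: T_def)
        qed
        then have g1: "g = [xs ! i]" using g(2,3) xs by (cases g) (auto simp: nth_append)
        have "\<not> diverge_at Y (xs ! i) y" if "Y \<noteq> []" "y \<in> set xs" for Y y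
        proof
          assume d: "diverge_at Y (xs ! i) y"
          have "hd (xs ! i) = b" using arg_cong[OF b(1), of set] g1 by auto
          moreover have "hd (xs ! i) = hd Y" "hd y = hd Y"
            using d \<open>Y \<noteq> []\<close> by (auto simp: diverge_at_def prefix_def)
          ultimately have "y \<in> set g" using b(1) that(2) by simp
          then show False using d g1 by (simp add: diverge_at_def)
        qed
        then show ?thesis using Leaf anc by (auto simp: trie_ancestors_def)
      next
        case (Node es)
        let ?zs = "map (drop (length (lcp g))) g"
        have "\<not> length g \<le> 1" using Node ctrie_Leaf[of ?zs] by (auto simp: T_def)
        then have "\<forall>x\<in>set g. \<exists>y\<in>set g. diverge_at (lcp g) x y" using lcp_diverge[OF ti[OF gm]] by blast
        moreover have "trie_ancestors ?zs a (ancestors es a)" using IH(3)[OF gm Node g(3)] .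
        moreover have "dollar_first es \<longleftrightarrow> ?zs ! 0 ! 0 = Dollar"
          using dollar_first_ctrie[OF gp(4)[OF gm]] Node by (simp add: T_def)
        ultimately show ?thesis
          using trie_ancestors_group[OF xs b(1) ne b(2) gp(3)[OF gm] _ gp(5)[OF gm]] g(2,3) Node anc by simp
      qed
    qed
    then show ?thesis using wl nl by (auto simp: ct)
  qed
qed

section \<open>The overlap tree\<close>

context rboss_context
begin

definition sources :: "sym list \<Rightarrow> sym list set" where
  "sources v = {X. read_prefix X \<and> suffix X v \<and> m \<le> length X \<and> length X < k - 1}"

abbreviation "BP \<equiv> boss_BP I"

lemma rev_pad: "rev (pad X) = rev X @ replicate (k - 1 - length X) Dollar"
  by (simp add: pad_def)

lemma trie_input_rows: "trie_input (k - 1) (map rev M)"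
proof -
  have "sorted_wrt (<) (map rev M)"
    unfolding map_rev_rows by (rule strict_sorted_list_of_set)
  moreover have "dollar_tailed (rev u)" if u: "u \<in> nodes" for u
  proof (cases "u \<in> solid_nodes R k")
    case True
    then have "Dollar \<notin> set (rev u)" using Dollar_notin_solid by simp
    then show ?thesis unfolding dollar_tailed_def by (metis in_set_conv_decomp)
  next
    case False
    then obtain X where X: "u = pad X" "read_prefix X" using u linker_nodes_pad by auto
    have "set b \<subseteq> {Dollar}" if ab: "rev u = a @ Dollar # b" for a b
    proof -
      have "a @ Dollar # b = rev X @ replicate (k - 1 - length X) Dollar"
        using ab X rev_pad by simp
      then consider us where "a = rev X @ us" "replicate (k - 1 - length X) Dollar = us @ Dollar # b"
        | us where "rev X = a @ us" "Dollar # b = us @ replicate (k - 1 - length X) Dollar"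
        unfolding append_eq_append_conv2 by (metis)
      then show ?thesis
      proof cases
        case 1
        then have "set b \<subseteq> set (replicate (k - 1 - length X) Dollar)" by auto
        then show ?thesis by (auto simp: set_replicate_conv_if split: if_splits)
      next
        case 2
        have "Dollar \<notin> set us"
          using 2(1) Dollar_notin_read_prefix[OF X(2)] by (metis Un_iff set_append set_rev)
        then have "us = []" using 2(2) by (cases us) auto
        then have "set (Dollar # b) = set (replicate (k - 1 - length X) Dollar)" using 2(2) by simp
        then show ?thesis by (auto simp: set_replicate_conv_if split: if_splits)
      qed
    qed
    then show ?thesis unfolding dollar_tailed_def by blast
  qed
  ultimately show ?thesis unfolding trie_input_def using set_rows length_node by auto
qed

lemma solid_row_pos:
  assumes "i < N" "M ! i \<in> solid_nodes R k" shows "0 < i"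
proof (rule ccontr)
  assume "\<not> 0 < i"
  then have "M ! i = pad []" using nth_row_of[OF read_prefix_Nil] row_of_Nil by simp
  then have "Dollar \<in> set (M ! i)" using k2 by (simp add: pad_def)
  then show False using Dollar_notin_solid assms by blast
qed

lemma dollar_ancestor:
  assumes v: "v \<in> solid_nodes R k" and n: "n < N" and Y: "prefix Y (rev v)" "prefix Y (rev (M ! n))"
    and len: "length Y < k - 1" and D: "rev (M ! n) ! length Y = Dollar"
  shows "read_prefix (rev Y)" "n = row_of (rev Y)"
proof -
  have DY: "Dollar \<notin> set Y"
    using Dollar_notin_solid[OF v] set_mono_prefix[OF Y(1)] by auto
  have "Dollar \<in> set (rev (M ! n))" using D len n length_row[OF n] by (metis length_rev nth_mem)
  then have "M ! n \<notin> solid_nodes R k" using Dollar_notin_solid[of "M ! n"] by auto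
  then obtain X where X: "M ! n = pad X" "read_prefix X" "length X < k - 1"
    using nth_rows_nodes[OF n] linker_nodes_pad by auto
  have "length X \<le> length Y"
  proof (rule ccontr)
    assume "\<not> ?thesis"
    then have "rev (M ! n) ! length Y \<in> set X" by (simp add: X(1) rev_pad nth_append) (metis length_rev not_le nth_mem set_rev)
    then show False using D Dollar_notin_read_prefix[OF X(2)] by simp
  qed
  moreover have "length Y \<le> length X"
  proof (rule ccontr)
    assume *: "\<not> ?thesis"
    then have "Y ! length X = rev (M ! n) ! length X" using Y(2) by (auto simp: prefix_def nth_append)
    also have "\<dots> = Dollar" using X(3) by (simp add: X(1) rev_pad nth_append)
    finally show False using DY * by (metis not_le nth_mem)
  qed
  ultimately have "Y = rev X" using Y(2) by (simp add: X(1) rev_pad prefix_def append_eq_append_conv)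
  then show "read_prefix (rev Y)" "n = row_of (rev Y)" using X n idx_nth[of n] by auto
qed

lemma source_ancestor:
  assumes v: "v \<in> solid_nodes R k" and X: "read_prefix X" "suffix X v" "length X < k - 1"
  shows "diverge_at (rev X) (rev v) (rev (pad X))" "first_with (rev X) (map rev M) = row_of X"
    "rev (M ! row_of X) ! length X = Dollar"
proof -
  have pX: "row_of X < N" "M ! row_of X = pad X" using row_of_less nth_row_of X by auto
  have len: "length v = k - 1" using v by (simp add: solid_nodes_def)
  show D: "rev (M ! row_of X) ! length X = Dollar" using X(3) by (simp add: pX rev_pad nth_append)
  have "rev v ! length X \<in> set (rev v)" using len X(3) by (intro nth_mem) simp
  then have "rev v ! length X \<noteq> Dollar" using Dollar_notin_solid[OF v] by auto
  moreover have "prefix (rev X) (rev v)" using X(2) by (simp add: suffix_to_prefix)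
  ultimately show "diverge_at (rev X) (rev v) (rev (pad X))"
    using X(3) len D pX by (simp add: diverge_at_def rev_pad)
  let ?n = "first_with (rev X) (map rev M)"
  have pre: "prefix (rev X) (rev (M ! row_of X))" by (simp add: pX rev_pad)
  have mem: "rev (M ! row_of X) \<in> set (map rev M)" using pX(1) by simp
  have n: "?n \<le> row_of X" using first_with_le[of "row_of X" "map rev M"] pX(1) pre by simp
  then have "?n < N" using pX by simp
  then have "prefix (rev X) (rev (M ! ?n))" using prefix_first_with[OF mem pre] by simp
  then obtain w where w: "rev (M ! ?n) = rev X @ w" by (auto simp: prefix_def)
  have "length w = k - 1 - length X" using arg_cong[OF w, of length] length_row[OF \<open>?n < N\<close>] by simp
  then have "replicate (k - 1 - length X) Dollar \<le> w" by (rule replicate_Dollar_le)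
  moreover have "L @ y \<le> L @ z" if "y \<le> z" for L y z :: "sym list"
    using that by (induction L) auto
  ultimately have "rev X @ replicate (k - 1 - length X) Dollar \<le> rev X @ w" by blast
  then have "rev (M ! row_of X) \<le> rev (M ! ?n)" using w pX rev_pad by simp
  then have "\<not> ?n < row_of X" using rows_colex[OF _ pX(1)] by (meson leD)
  then show "?n = row_of X" using n by simp
qed

lemma overlap_chain:
  assumes v: "v \<in> solid_nodes R k" and i: "i < N" "M ! i = v" and m: "1 \<le> m"
  shows "\<exists>ps. enclose_chain BP 0 ps (answer I BP_Leaf_Select i c) \<and> (\<forall>p\<in>set ps. 0 < p \<and> p < length BP) \<and>
    distinct (map (leaf_rank BP) ps) \<and> set (map (leaf_rank BP) ps) = row_of ` sources v \<and>
    answer I BP_Leaf_Select i c < length BP"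
proof -
  let ?xs = "map rev M"
  have len: "length v = k - 1" using v by (simp add: solid_nodes_def)
  have "\<not> length ?xs \<le> 1" using solid_row_pos[OF i(1)] i v by auto
  then obtain es where es: "ctrie ?xs = Node es" using ctrie_Node by blast
  have ne: "?xs \<noteq> []" using i(1) by auto
  have ct: "well_labelled (Node es)" "fleaves es = N" "trie_ancestors ?xs i (ancestors es i)"
    using ctrie_ancestors[OF trie_input_rows ne] es i(1) by (auto simp: es)
  define es1 where "es1 = delete_forest (\<lambda>d es. d < m) 0 es"
  define es2 where "es2 = delete_forest (\<lambda>d es. \<not> dollar_first es) 0 es1"
  have wl: "well_labelled_forest es" "es \<noteq> []" using ct(1) by auto
  have wl1: "well_labelled_forest es1" "es1 \<noteq> []"
    unfolding es1_def using well_labelled_delete_forest[OF wl(1)] dollar_first_delete_forest(2)[OF wl] by auto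
  have wl2: "well_labelled_forest es2" "es2 \<noteq> []"
    unfolding es2_def using well_labelled_delete_forest[OF wl1(1)] dollar_first_delete_forest(2)[OF wl1] by auto
  have T: "overlap_tree R k m = Node es2"
    by (simp add: overlap_tree_def es es1_def es2_def dollar_first_def)
  have fl: "fleaves es2 = N" unfolding es2_def es1_def fleaves_delete_forest ct(2) ..
  define A where "A = filter (\<lambda>(Y, n, f). m \<le> length Y \<and> f) (ancestors es i)"
  have A: "ancestors es2 i = A"
    unfolding es2_def ancestors_delete[OF wl1(1), of "\<lambda>d f. \<not> f"]
    unfolding es1_def ancestors_delete[OF wl(1), of "\<lambda>d f. d < m"] A_def filter_filter
    by (rule filter_cong) (auto simp: not_less)
  have BP: "BP = ([] @ True # []) @ bp_forest es2 @ [False]"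
    by (simp add: rboss_index_def T)
  have "length (leaf_positions BP) = N"
    using length_leaf_positions[of "Node es2"] wl2 fl by (simp add: rboss_index_def T)
  then have sel: "answer I BP_Leaf_Select i c = leaf_positions BP ! i" "leaf_positions BP ! i \<in> set (leaf_positions BP)"
    using i(1) by (auto simp: nth_or_0_def)
  then have sel_less: "answer I BP_Leaf_Select i c < length BP" by (auto simp: leaf_positions_def)
  obtain ps where ps: "enclose_chain BP 0 ps (leaf_positions BP ! i)"
      "map (leaf_rank BP) ps = map (\<lambda>(Y, n, f). n) A" "\<forall>p\<in>set ps. 0 < p \<and> p < length BP"
    using bp_ancestors[OF wl2(1) _ balanced_Nil BP, of i] i(1) fl A by auto
  have setA: "set A = {(Y, first_with Y ?xs, True) | Y. m \<le> length Y \<and>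
      ?xs ! first_with Y ?xs ! length Y = Dollar \<and> (\<exists>y\<in>set ?xs. diverge_at Y (rev v) y)}"
    using ct(3) i m unfolding A_def trie_ancestors_def by auto
  have setA': "set A = (\<lambda>X. (rev X, row_of X, True)) ` sources v"
  proof (intro set_eqI iffI)
    fix x assume "x \<in> set A"
    then obtain Y y where Y: "x = (Y, first_with Y ?xs, True)" "m \<le> length Y"
      "?xs ! first_with Y ?xs ! length Y = Dollar" "y \<in> set ?xs" "diverge_at Y (rev v) y"
      using setA by auto
    let ?n = "first_with Y ?xs"
    have n: "?n < N" using first_with_less[OF Y(4)] Y(5) by (auto simp: diverge_at_def)
    have "prefix Y (rev (M ! ?n))" using prefix_first_with[OF Y(4), of Y] Y(5) n by (simp add: diverge_at_def)
    moreover have pv: "prefix Y (rev v)" "length Y < k - 1" using Y(5) len by (auto simp: diverge_at_def)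
    ultimately have "read_prefix (rev Y)" "?n = row_of (rev Y)"
      using dollar_ancestor[OF v n] Y(3) n by auto
    moreover have "suffix (rev Y) v" using pv(1) by (simp add: suffix_to_prefix)
    ultimately show "x \<in> (\<lambda>X. (rev X, row_of X, True)) ` sources v"
      using Y(1,2) pv(2) by (intro image_eqI[of _ _ "rev Y"]) (auto simp: sources_def)
  next
    fix x assume "x \<in> (\<lambda>X. (rev X, row_of X, True)) ` sources v"
    then obtain X where X: "x = (rev X, row_of X, True)" "read_prefix X" "suffix X v" "m \<le> length X" "length X < k - 1"
      by (auto simp: sources_def)
    note s = source_ancestor[OF v X(2,3,5)]
    have "row_of X < N" "pad X \<in> set M"
      using row_of_less X pad_node[of X] set_rows by auto
    then show "x \<in> set A" using X s unfolding setA by (auto intro!: exI[of _ "rev X"])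
  qed
  have "distinct A"
  proof -
    have "sorted_wrt (\<lambda>a b. length (fst a) < length (fst b)) A"
      unfolding A_def using ct(3) by (intro sorted_wrt_filter) (simp add: trie_ancestors_def)
    then show ?thesis by (induction A) auto
  qed
  moreover have "inj_on (\<lambda>(Y, n, f). n) (set A)"
  proof -
    have "\<forall>X\<in>sources v. read_prefix X \<and> length X \<le> k - 1" by (auto simp: sources_def)
    then show ?thesis unfolding setA' using row_of_inject by (auto simp: inj_on_def)
  qed
  ultimately have "distinct (map (leaf_rank BP) ps)" unfolding ps(2) by (simp add: distinct_map)
  moreover have "set (map (leaf_rank BP) ps) = row_of ` sources v"
    unfolding ps(2) set_map setA' by (auto simp: image_image)
  ultimately show ?thesis using ps sel sel_less by metis
qed

end

section \<open>Reasoning about the word RAM\<close>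

fun loop_free :: "com \<Rightarrow> bool" where
  "loop_free (Seq p q) \<longleftrightarrow> loop_free p \<and> loop_free q"
| "loop_free (If e p q) \<longleftrightarrow> loop_free p \<and> loop_free q"
| "loop_free (While e p) \<longleftrightarrow> False"
| "loop_free p \<longleftrightarrow> True"

text \<open>The values of \<open>effect\<close> and \<open>max_cost\<close> on programs with loops are junk.\<close>

fun effect :: "rboss \<Rightarrow> nat \<Rightarrow> com \<Rightarrow> mstate \<Rightarrow> mstate" where
  "effect I w (Assign x e) s = s\<lparr>regs := (regs s)(x := eval w s e)\<rparr>"
| "effect I w (Load x a e) s = s\<lparr>regs := (regs s)(x := arrs s a (eval w s e))\<rparr>"
| "effect I w (Store a e1 e2) s =
    s\<lparr>arrs := (arrs s)(a := (arrs s a)(eval w s e1 := eval w s e2))\<rparr>"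
| "effect I w (Ask x q e1 e2) s =
    s\<lparr>regs := (regs s)(x := word w (answer I q (eval w s e1) (eval w s e2)))\<rparr>"
| "effect I w (Emit e) s = s\<lparr>outp := outp s @ [eval w s e]\<rparr>"
| "effect I w (Seq p q) s = effect I w q (effect I w p s)"
| "effect I w (If e p q) s = (if eval w s e \<noteq> 0 then effect I w p s else effect I w q s)"
| "effect I w (While e p) s = s"

fun max_cost :: "com \<Rightarrow> nat" where
  "max_cost (Assign x e) = 1 + ecost e"
| "max_cost (Load x a e) = 1 + ecost e"
| "max_cost (Store a e1 e2) = 1 + ecost e1 + ecost e2"
| "max_cost (Ask x q e1 e2) = op_cost q + ecost e1 + ecost e2"
| "max_cost (Emit e) = 1 + ecost e"
| "max_cost (Seq p q) = max_cost p + max_cost q"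
| "max_cost (If e p q) = 1 + ecost e + max (max_cost p) (max_cost q)"
| "max_cost (While e p) = 0"

lemma exec_loop_free: "loop_free p \<Longrightarrow> \<exists>t\<le>max_cost p. exec I w p s t (effect I w p s)"
proof (induction p arbitrary: s)
  case (Seq p q)
  then obtain t t' where "t \<le> max_cost p" "exec I w p s t (effect I w p s)"
    "t' \<le> max_cost q" "exec I w q (effect I w p s) t' (effect I w q (effect I w p s))"
    by (meson loop_free.simps(1))
  then show ?case by (intro exI[of _ "t + t'"]) (auto intro: exec_Seq)
next
  case (If e p q)
  then obtain t t' where t: "t \<le> max_cost p" "exec I w p s t (effect I w p s)"
    "t' \<le> max_cost q" "exec I w q s t' (effect I w q s)"
    by (meson loop_free.simps(2))
  show ?case
  proof (cases "eval w s e = 0")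
    case True
    then show ?thesis using t exec_If_False[OF True t(4)] by (intro exI[of _ "1 + ecost e + t'"]) auto
  next
    case False
    then show ?thesis using t exec_If_True[OF False t(2)] by (intro exI[of _ "1 + ecost e + t"]) auto
  qed
next
  case (Assign x e)
  show ?case using exec_Assign[of I w x e s] by auto
next
  case (Load x a e)
  show ?case using exec_Load[of I w x a e s] by auto
next
  case (Store a e1 e2)
  show ?case using exec_Store[of I w a e1 e2 s] by auto
next
  case (Ask x q e1 e2)
  show ?case using exec_Ask[of I w x q e1 e2 s] by auto
next
  case (Emit e)
  show ?case using exec_Emit[of I w e s] by auto
qed simp

definition ends :: "rboss \<Rightarrow> nat \<Rightarrow> com \<Rightarrow> mstate \<Rightarrow> (nat \<Rightarrow> mstate \<Rightarrow> bool) \<Rightarrow> bool" where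
  "ends I w p s Q \<longleftrightarrow> (\<exists>t s'. exec I w p s t s' \<and> Q t s')"

lemma ends_mono: "ends I w p s Q \<Longrightarrow> (\<And>t s'. Q t s' \<Longrightarrow> Q' t s') \<Longrightarrow> ends I w p s Q'"
  unfolding ends_def by blast

lemma ends_loop_free:
  "loop_free p \<Longrightarrow> (\<And>t. t \<le> max_cost p \<Longrightarrow> Q t (effect I w p s)) \<Longrightarrow> ends I w p s Q"
  unfolding ends_def using exec_loop_free by blast

lemma ends_Seq:
  "ends I w p s (\<lambda>t s'. ends I w q s' (\<lambda>t' s''. Q (t + t') s'')) \<Longrightarrow> ends I w (Seq p q) s Q"
  unfolding ends_def using exec_Seq by blast

text \<open>\<open>g\<close> is a ghost state, and the potential \<open>\<Phi>\<close> pays for the time of the iterations.\<close>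

lemma ends_While:
  assumes body: "\<And>g s. Inv g s \<Longrightarrow> eval w s e \<noteq> 0 \<Longrightarrow>
      ends I w p s (\<lambda>t s'. \<exists>g'. Inv g' s' \<and> t + (1 + ecost e) + \<Phi> g' \<le> (\<Phi> g :: nat))"
    and "Inv g s"
  shows "ends I w (While e p) s
    (\<lambda>t s'. \<exists>g'. Inv g' s' \<and> eval w s' e = 0 \<and> t + \<Phi> g' \<le> \<Phi> g + (1 + ecost e))"
  using \<open>Inv g s\<close>
proof (induction "\<Phi> g" arbitrary: g s rule: less_induct)
  case less
  show ?case
  proof (cases "eval w s e = 0")
    case True
    show ?thesis unfolding ends_def using exec_While_False[OF True, of I p] less.prems True by fastforce
  next
    case False
    from body[OF less.prems False] obtain t s' g' where b: "exec I w p s t s'" "Inv g' s'"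
      "t + (1 + ecost e) + \<Phi> g' \<le> \<Phi> g" unfolding ends_def by blast
    then have "\<Phi> g' < \<Phi> g" by simp
    from less.hyps[OF this b(2)] obtain t' s'' g'' where c: "exec I w (While e p) s' t' s''" "Inv g'' s''"
      "eval w s'' e = 0" "t' + \<Phi> g'' \<le> \<Phi> g' + (1 + ecost e)" unfolding ends_def by blast
    have "exec I w (While e p) s (1 + ecost e + t + t') s''"
      using exec_While_True[OF False b(1) c(1)] .
    then show ?thesis unfolding ends_def using b c by (intro exI conjI) auto
  qed
qed

declare answer.simps [simp del]

section \<open>The programs\<close>

fun seqs :: "com list \<Rightarrow> com" where
  "seqs [] = Assign 30 (Num 0)"
| "seqs (p # ps) = Seq p (seqs ps)"

definition overlap_prog :: com where
  "overlap_prog = Seq (seqs [Emit (Reg 0), Ask 3 BP_Leaf_Select (Reg 0) (Num 0),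
      Ask 3 BP_Enclose (Reg 3) (Num 0)])
    (While (Reg 3) (seqs [Ask 4 BP_Leaf_Rank (Reg 3) (Num 0), Emit (Reg 4),
      Ask 3 BP_Enclose (Reg 3) (Num 0)]))"

text \<open>Register 3 holds a row. Its last symbol is found by comparing it with the entries of \<open>C\<close>.\<close>

definition back_prog :: com where
  "back_prog = seqs [Ask 10 C_Access (Num 1) (Num 0), Ask 11 C_Access (Num 2) (Num 0),
    Ask 12 C_Access (Num 3) (Num 0), Ask 13 C_Access (Num 4) (Num 0),
    Assign 14 (Bin Add (Bin Add (Bin Less (Reg 10) (Bin Add (Reg 3) (Num 1)))
        (Bin Less (Reg 11) (Bin Add (Reg 3) (Num 1))))
      (Bin Add (Bin Less (Reg 12) (Bin Add (Reg 3) (Num 1)))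
        (Bin Less (Reg 13) (Bin Add (Reg 3) (Num 1))))),
    Ask 15 C_Access (Reg 14) (Num 0),
    Ask 16 E_Select (Bin Sub (Reg 3) (Reg 15)) (Reg 14),
    Ask 3 B_Rank (Reg 16) (Num 0)]"

definition edge_prog :: "nat \<Rightarrow> com" where
  "edge_prog b = seqs [Ask 10 B_Select (Bin Sub (Reg 20) (Num 1)) (Num 0),
    Ask 11 B_Select (Reg 20) (Num 0),
    Assign 10 (Bin Mul (Bin Less (Num 0) (Reg 20)) (Bin Add (Reg 10) (Num 1))),
    Ask 12 E_Rank (Reg 10) (Num b),
    Ask 13 E_Rank (Bin Add (Reg 11) (Num 1)) (Num b)]"

text \<open>Registers 20, 21 and 22 hold the row of a node, the length of its label, and whether a source
  is a prefix of that label; register 24 is the length of the queue, which is kept in arrays 2, 3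
  and 4. Arrays 0 and 1 mark the prefixes of the sources and the sources.\<close>

definition push_prog :: "nat \<Rightarrow> com" where
  "push_prog b = seqs [Ask 14 C_Access (Num b) (Num 0),
    Assign 14 (Bin Add (Reg 14) (Reg 12)),
    Load 15 1 (Reg 14), Load 16 0 (Reg 14),
    Assign 15 (Bin Less (Num 0) (Bin Add (Reg 15) (Reg 22))),
    If (Bin Less (Num 0) (Bin Add (Reg 15) (Reg 16)))
      (seqs [Store 2 (Reg 24) (Reg 14), Store 3 (Reg 24) (Bin Add (Reg 21) (Num 1)),
        Store 4 (Reg 24) (Reg 15), Assign 24 (Bin Add (Reg 24) (Num 1))])
      (seqs [])]"

definition child_prog :: "nat \<Rightarrow> com" where
  "child_prog b = Seq (edge_prog b) (If (Bin Less (Reg 12) (Reg 13)) (push_prog b) (seqs []))"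

definition walk_body :: com where
  "walk_body = Seq back_prog (Assign 5 (Bin Sub (Reg 5) (Num 1)))"

definition mark_body :: com where
  "mark_body = Seq (Store 0 (Reg 3) (Num 1)) (Seq back_prog (Load 9 0 (Reg 3)))"

definition source_head :: com where
  "source_head = seqs [Ask 3 BP_Leaf_Rank (Reg 6) (Num 0), Store 1 (Reg 3) (Num 1), Load 9 0 (Reg 3)]"

definition source_body :: com where
  "source_body = Seq source_head (Seq (While (Bin Equal (Reg 9) (Num 0)) mark_body)
    (Ask 6 BP_Enclose (Reg 6) (Num 0)))"

definition visit_body :: com where
  "visit_body = Seq (seqs [Load 20 2 (Reg 23), Load 21 3 (Reg 23), Load 22 4 (Reg 23)])
    (Seq (If (Bin Equal (Bin Add (Reg 21) (Num 1)) (Reg 1))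
        (If (Bin Equal (Reg 20) (Reg 0)) (seqs []) (Emit (Reg 20)))
        (seqs (map (\<lambda>b. child_prog (sym_code b)) [Ade, Cyt, Gua, Thy])))
      (Assign 23 (Bin Add (Reg 23) (Num 1))))"

definition walk_init :: com where
  "walk_init = seqs [Assign 3 (Reg 0), Assign 5 (Bin Sub (Reg 1) (Num 1))]"

definition source_init :: com where
  "source_init = seqs [If (Bin Equal (Reg 3) (Num 0)) (Emit (Reg 0)) (seqs []),
    Store 0 (Num 0) (Num 1), Ask 6 BP_Leaf_Select (Reg 0) (Num 0), Ask 6 BP_Enclose (Reg 6) (Num 0)]"

definition visit_init :: com where
  "visit_init = seqs [Assign 23 (Num 0), Assign 24 (Num 1)]"

definition enum_prog :: com where
  "enum_prog = Seq walk_init (Seq (While (Reg 5) walk_body) (Seq source_init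
    (Seq (While (Reg 6) source_body) (Seq visit_init (While (Bin Less (Reg 23) (Reg 24)) visit_body)))))"

lemmas prog_defs = back_prog_def edge_prog_def push_prog_def child_prog_def walk_body_def mark_body_def source_head_def
  visit_body_def walk_init_def source_init_def visit_init_def

lemma loop_free_progs [simp]:
  "loop_free back_prog" "loop_free (child_prog b)" "loop_free walk_body" "loop_free mark_body"
  "loop_free source_head" "loop_free visit_body" "loop_free walk_init" "loop_free source_init"
  "loop_free visit_init"
  by (simp_all add: prog_defs)

definition overlap_cost :: nat where
  "overlap_cost = max_cost (seqs [Ask 4 BP_Leaf_Rank (Reg 3) (Num 0), Emit (Reg 4),
      Ask 3 BP_Enclose (Reg 3) (Num 0)]) + 2"

definition overlap_init_cost :: nat where
  "overlap_init_cost = max_cost (seqs [Emit (Reg 0), Ask 3 BP_Leaf_Select (Reg 0) (Num 0),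
      Ask 3 BP_Enclose (Reg 3) (Num 0)]) + 2"

definition walk_cost :: nat where
  "walk_cost = max_cost walk_body + 2"

definition mark_cost :: nat where
  "mark_cost = max_cost mark_body + 4"

definition source_cost :: nat where
  "source_cost = max_cost source_head + max_cost (Ask 6 BP_Enclose (Reg 6) (Num 0)) + 6"

definition visit_cost :: nat where
  "visit_cost = max_cost visit_body + 4"

definition enum_cost :: nat where
  "enum_cost = max_cost walk_init + max_cost source_init + max_cost visit_init + 8 +
    walk_cost + source_cost + 2 * mark_cost + 2 * visit_cost"

lemma word_id: "n < 2 ^ w \<Longrightarrow> word w n = n"
  by (simp add: word_def)

section \<open>Correctness and running time\<close>

locale rboss_machine = rboss_context +
  fixes w :: nat and v :: "sym list" and i :: nat
  assumes fits: "word_fits I k w" and m: "1 \<le> m" "m < k"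
    and v: "v \<in> solid_nodes R k" and i: "i < N" "M ! i = v"
begin

lemma fits': "length (boss_E I) < 2 ^ w" "length BP < 2 ^ w" "k < 2 ^ w" "10 < (2 :: nat) ^ w" "N < 2 ^ w"
  using fits rows_le_E by (auto simp: word_fits_def sigma_eq)

lemma word_row: "r < N \<Longrightarrow> word w r = r" "r \<le> N \<Longrightarrow> word w r = r"
  using fits' by (auto intro: word_id)

lemma word_small: "n \<le> 10 \<Longrightarrow> word w n = n"
  using fits' by (intro word_id) simp

lemma word_of_bool [simp]: "word w (of_bool b) = of_bool b"
  using word_small[of "of_bool b"] by (cases b) auto

lemma word_numerals [simp]: "word w 0 = 0" "word w 1 = 1" "word w (Suc 0) = 1" "word w 2 = 2" "word w 3 = 3" "word w 4 = 4"
  using word_small by auto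

lemma back_effect:
  assumes r: "regs s 3 < N" "last (M ! regs s 3) \<noteq> Dollar"
  shows "regs (effect I w back_prog s) 3 = pred_row (regs s 3)"
    and "x \<notin> {3, 10, 11, 12, 13, 14, 15, 16, 30} \<Longrightarrow> regs (effect I w back_prog s) x = regs s x"
    and "arrs (effect I w back_prog s) = arrs s" "outp (effect I w back_prog s) = outp s"
proof -
  let ?r = "regs s 3" and ?b = "last (M ! regs s 3)"
  have C: "answer I C_Access 1 0 = first_row Ade" "answer I C_Access 2 0 = first_row Cyt"
    "answer I C_Access 3 0 = first_row Gua" "answer I C_Access 4 0 = first_row Thy"
    "answer I C_Access (sym_code ?b) 0 = first_row ?b"
    using C_access[of Ade] C_access[of Cyt] C_access[of Gua] C_access[of Thy] C_access[of ?b] by simp_all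
  have F: "word w (first_row c) = first_row c" for c
    using word_row(2)[of "first_row c"] by (simp add: first_row_def)
  have r1: "word w (Suc ?r) = Suc ?r" using r(1) by (intro word_row(2)) simp
  have le: "first_row c < Suc ?r \<longleftrightarrow> sym_code c \<le> sym_code ?b" for c
    using first_row_le_iff[OF r(1), of c] by (simp add: less_eq_sym_def less_Suc_eq_le)
  have code: "word w (word w (of_bool (first_row Ade < Suc ?r) + of_bool (first_row Cyt < Suc ?r)) +
      word w (of_bool (first_row Gua < Suc ?r) + of_bool (first_row Thy < Suc ?r))) = sym_code ?b"
    unfolding le using r(2) word_small by (cases ?b) auto
  note q = pred_row_query[OF r(1) refl r(2)]
  have sub: "word w (?r - first_row ?b) = ?r - first_row ?b" using r(1) by (intro word_row(1)) simp
  have sel: "word w (answer I E_Select (?r - first_row ?b) (sym_code ?b))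
      = answer I E_Select (?r - first_row ?b) (sym_code ?b)"
    using q(2) fits'(1) by (intro word_id) simp
  have p: "word w (pred_row ?r) = pred_row ?r" using pred_row_less[OF r] by (rule word_row)
  show "regs (effect I w back_prog s) 3 = pred_row (regs s 3)"
    by (simp add: back_prog_def C[simplified] F r1 code sub sel q(3) p split del: split_of_bool)
  show "x \<notin> {3, 10, 11, 12, 13, 14, 15, 16, 30} \<Longrightarrow> regs (effect I w back_prog s) x = regs s x"
    "arrs (effect I w back_prog s) = arrs s" "outp (effect I w back_prog s) = outp s"
    by (simp_all add: back_prog_def)
qed

lemma length_v: "length v = k - 1"
  using v by (simp add: solid_nodes_def)

lemma idx_v: "idx v = i"
  using i by auto

lemma label_source: "X \<in> sources v \<Longrightarrow> read_prefix X \<and> length X \<le> k - 1 \<and> length X < k - 1"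
  by (auto simp: sources_def)

lemma row_of_source: "X \<in> sources v \<Longrightarrow> row_of X < N" "X \<in> sources v \<Longrightarrow> row_of X \<noteq> i"
proof -
  assume X: "X \<in> sources v"
  then show "row_of X < N" using label_source row_of_less by blast
  have "M ! row_of X = pad X" using X label_source nth_row_of by blast
  moreover have "Dollar \<in> set (pad X)" using label_source[OF X] by (auto simp: pad_def)
  ultimately show "row_of X \<noteq> i" using i Dollar_notin_solid[OF v] by auto
qed

lemma row_of_inj_sources: "inj_on row_of (sources v)"
  using label_source row_of_inject by (auto simp: inj_on_def)

lemma sources_sub: "sources v \<subseteq> (\<lambda>d. drop d v) ` {..<k}"
proof
  fix X assume X: "X \<in> sources v"
  then have "X = drop (length v - length X) v" by (auto simp: sources_def suffix_def)
  moreover have "length v - length X < k" using length_v m by simp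
  ultimately show "X \<in> (\<lambda>d. drop d v) ` {..<k}" by blast
qed

lemma finite_sources: "finite (sources v)"
  using sources_sub finite_surj by blast

lemma card_sources: "card (sources v) \<le> k"
  using surj_card_le[OF _ sources_sub] by simp

lemma p_extensions_v: "p_extensions R k v = {v} \<inter> p_nodes R k"
proof -
  have "llabel v = v" using llabel_pad[of v] pad_full[OF length_v] Dollar_notin_solid[OF v] by simp
  moreover have "prefix v v' \<longleftrightarrow> v' = v" if "v' \<in> p_nodes R k" for v'
    using that length_v by (auto simp: p_node_iff prefix_def)
  ultimately show ?thesis by (auto simp: p_extensions_def)
qed

lemma p_extensions_source:
  "X \<in> sources v \<Longrightarrow> p_extensions R k (M ! row_of X) = {v' \<in> p_nodes R k. prefix X v'}"
  using label_source[of X] nth_row_of llabel_pad Dollar_notin_read_prefix by (simp add: p_extensions_def)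

lemma foverlaps_eq:
  "foverlaps R k m v = ({v} \<inter> p_nodes R k) \<union> (\<Union>X\<in>sources v. {v' \<in> p_nodes R k. prefix X v'})"
proof (intro set_eqI iffI)
  fix v' assume "v' \<in> foverlaps R k m v"
  then obtain X where v': "v' \<in> p_nodes R k" "prefix X v'" "m \<le> length X" "suffix X v"
    by (auto simp: foverlaps_def)
  then have rp: "read_prefix X" "length v' = k - 1" using read_prefix_mono by (auto simp: p_node_iff)
  show "v' \<in> ({v} \<inter> p_nodes R k) \<union> (\<Union>X\<in>sources v. {v' \<in> p_nodes R k. prefix X v'})"
  proof (cases "length X < k - 1")
    case True
    then show ?thesis using v' rp by (auto simp: sources_def)
  next
    case False
    then have "length X = k - 1" using prefix_length_le[OF v'(2)] rp(2) by simp
    then have "X = v'" "X = v" using v' rp length_v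
      by (auto simp: prefix_def suffix_def)
    then show ?thesis using v' by auto
  qed
next
  fix v' assume "v' \<in> ({v} \<inter> p_nodes R k) \<union> (\<Union>X\<in>sources v. {v' \<in> p_nodes R k. prefix X v'})"
  then show "v' \<in> foverlaps R k m v"
  proof
    assume "v' \<in> {v} \<inter> p_nodes R k"
    then show ?thesis using m length_v unfolding foverlaps_def by (auto intro!: exI[of _ v])
  qed (auto simp: foverlaps_def sources_def)
qed

lemma answer_BP [simp]: "answer I BP_Enclose p c = enclose BP p" "answer I BP_Leaf_Rank p c = leaf_rank BP p"
  by (simp_all add: answer.simps leaf_rank_def)

lemma init_regs [simp]: "regs (init_state [i, k, m]) 0 = i" "regs (init_state [i, k, m]) (Suc 0) = k"
  "regs (init_state [i, k, m]) 1 = k" "outp (init_state [i, k, m]) = []" "arrs (init_state [i, k, m]) a j = 0"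
  by (simp_all add: init_state_def nth_or_0_def)

lemma enclose_word:
  assumes "enclose_chain BP 0 ps x" "\<forall>p\<in>set ps. 0 < p \<and> p < length BP"
  shows "word w (enclose BP x) = last (0 # ps)"
proof -
  have "last (0 # ps) < 2 ^ w" using assms(2) fits'(2,4) by (cases ps rule: rev_cases) auto
  then show ?thesis using enclose_chain_last[OF assms(1)] word_id by simp
qed

lemma overlap_prog_correct:
  "\<exists>t ys. runs I w overlap_prog [i, k, m] t ys \<and> represents R k ys (foverlaps R k m v) \<and>
    t \<le> overlap_init_cost + overlap_cost * k"
proof -
  obtain ps where ps: "enclose_chain BP 0 ps (answer I BP_Leaf_Select i 0)" "\<forall>p\<in>set ps. 0 < p \<and> p < length BP"
    "distinct (map (leaf_rank BP) ps)" "set (map (leaf_rank BP) ps) = row_of ` sources v"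
    "answer I BP_Leaf_Select i 0 < length BP"
    using overlap_chain[OF v i m(1)] by blast
  have lr: "word w (leaf_rank BP p) = leaf_rank BP p" if "p \<in> set ps" for p
  proof -
    have "leaf_rank BP p \<in> row_of ` sources v" using that ps(4) by (metis imageI set_map)
    then show ?thesis using row_of_source(1) by (auto intro: word_row)
  qed
  define Inv where "Inv = (\<lambda>qs (s :: mstate). \<exists>rs. ps = qs @ rs \<and> regs s 3 = last (0 # qs) \<and>
    outp s = i # map (leaf_rank BP) (rev rs) \<and> enclose_chain BP 0 ps (answer I BP_Leaf_Select i 0))"
  let ?body = "seqs [Ask 4 BP_Leaf_Rank (Reg 3) (Num 0), Emit (Reg 4), Ask 3 BP_Enclose (Reg 3) (Num 0)]"
  let ?init = "seqs [Emit (Reg 0), Ask 3 BP_Leaf_Select (Reg 0) (Num 0), Ask 3 BP_Enclose (Reg 3) (Num 0)]"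
  have chain: "enclose_chain BP 0 qs p" if "ps = qs @ p # rs" for qs p rs
    using ps(1) that enclose_chain_prefix by metis
  have "ends I w overlap_prog (init_state [i, k, m]) (\<lambda>t s. Inv [] s \<and> t \<le> overlap_init_cost + overlap_cost * k)"
    unfolding overlap_prog_def
  proof (rule ends_Seq, rule ends_loop_free)
    fix t assume t: "t \<le> max_cost ?init"
    let ?s = "effect I w ?init (init_state [i, k, m])"
    have "Inv ps ?s"
      using ps enclose_word[OF ps(1,2)] fits'(2) by (simp add: Inv_def word_id)
    from ends_While[of Inv w "Reg 3" I ?body "\<lambda>qs. overlap_cost * length qs", OF _ this]
    show "ends I w (While (Reg 3) ?body) ?s (\<lambda>t' s''. Inv [] s'' \<and> t + t' \<le> overlap_init_cost + overlap_cost * k)"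
    proof (rule ends_mono)
      fix qs s assume inv: "Inv qs s" "eval w s (Reg 3) \<noteq> 0"
      then obtain qs' p where qs: "qs = qs' @ [p]" by (cases qs rule: rev_cases) (auto simp: Inv_def)
      obtain rs where rs: "ps = qs' @ p # rs" "regs s 3 = p" "outp s = i # map (leaf_rank BP) (rev rs)"
        using inv qs by (auto simp: Inv_def)
      show "ends I w ?body s (\<lambda>t s'. \<exists>g'. Inv g' s' \<and> t + (1 + ecost (Reg 3)) + overlap_cost * length g' \<le> overlap_cost * length qs)"
      proof (rule ends_loop_free)
        fix t' assume t': "t' \<le> max_cost ?body"
        have "word w (enclose BP p) = last (0 # qs')"
          using enclose_word[OF chain[OF rs(1)]] ps(2) rs(1) by simp
        then have "Inv qs' (effect I w ?body s)"
          using rs lr[of p] ps(1) by (simp add: Inv_def)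
        then show "\<exists>g'. Inv g' (effect I w ?body s) \<and> t' + (1 + ecost (Reg 3)) + overlap_cost * length g' \<le> overlap_cost * length qs"
          using t' qs by (intro exI[of _ qs']) (simp add: overlap_cost_def)
      qed simp
    next
      fix t' s'' assume "\<exists>g'. Inv g' s'' \<and> eval w s'' (Reg 3) = 0 \<and> t' + overlap_cost * length g' \<le> overlap_cost * length ps + (1 + ecost (Reg 3))"
      then obtain g' where g': "Inv g' s''" "regs s'' 3 = 0" "t' \<le> overlap_cost * length ps + 2" by auto
      have "g' = []" using g'(1,2) ps(2) by (cases g' rule: rev_cases) (auto simp: Inv_def)
      moreover have "length ps \<le> k"
      proof -
        have "length ps = card (row_of ` sources v)" using distinct_card[OF ps(3)] ps(4) by simp
        then show ?thesis using card_image_le[OF finite_sources, of row_of] card_sources by simp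
      qed
      then have "t + t' \<le> overlap_init_cost + overlap_cost * k"
        using g'(3) t mult_le_mono2[of "length ps" k overlap_cost]
        unfolding overlap_init_cost_def by linarith
      ultimately show "Inv [] s'' \<and> t + t' \<le> overlap_init_cost + overlap_cost * k" using g'(1) by simp
    qed
  qed simp
  then obtain t s where s: "exec I w overlap_prog (init_state [i, k, m]) t s" "Inv [] s"
    "t \<le> overlap_init_cost + overlap_cost * k"
    unfolding ends_def by blast
  define ys where "ys = i # map (leaf_rank BP) (rev ps)"
  have "outp s = ys" using s(2) by (simp add: Inv_def ys_def)
  moreover have set_ys: "set ys = insert i (row_of ` sources v)" using ps(4) by (simp add: ys_def)
  moreover have "distinct ys"
    using ps(3,4) row_of_source(2) by (auto simp: ys_def rev_map[symmetric])
  moreover have "(\<Union>j\<in>set ys. p_extensions R k (M ! j)) = foverlaps R k m v"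
    unfolding set_ys foverlaps_eq using p_extensions_v p_extensions_source i by simp
  moreover have "\<forall>j\<in>set ys. j < N" unfolding set_ys using i row_of_source(1) by auto
  ultimately show ?thesis using s(1,3) unfolding runs_def represents_def by blast
qed

definition label :: "sym list \<Rightarrow> bool" where
  "label Y \<longleftrightarrow> read_prefix Y \<and> length Y \<le> k - 1"

definition good :: "sym list \<Rightarrow> bool" where
  "good Y \<longleftrightarrow> (\<exists>X\<in>sources v. prefix X Y)"

definition touched :: "sym list set \<Rightarrow> sym list set" where
  "touched D = insert [] {Y. \<exists>X\<in>D. prefix Y X}"

definition relevant :: "sym list \<Rightarrow> bool" where
  "relevant Y \<longleftrightarrow> label Y \<and> (Y \<in> touched (sources v) \<or> good Y)"

definition marks :: "nat \<Rightarrow> sym list set \<Rightarrow> mstate \<Rightarrow> bool" where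
  "marks a D s \<longleftrightarrow> (\<forall>Y. label Y \<longrightarrow> arrs s a (row_of Y) = of_bool (Y \<in> D))"

definition queue :: "sym list list \<Rightarrow> mstate \<Rightarrow> bool" where
  "queue W s \<longleftrightarrow> regs s 24 = length W \<and>
    (\<forall>j<length W. arrs s 2 j = row_of (W ! j) \<and> arrs s 3 j = length (W ! j) \<and>
      arrs s 4 j = of_bool (good (W ! j)))"

lemma edge_rank_less: "n \<le> N \<Longrightarrow> edge_rank b n \<le> N"
  unfolding edge_rank_def by (metis diff_zero length_filter_le length_upt order_trans)

lemma offset_le: "n \<le> N \<Longrightarrow> offset row_len n < 2 ^ w"
  using offset_mono[of n N row_len] fits'(1) length_E by simp

lemma offset_pos: "0 < n \<Longrightarrow> 0 < offset row_len n"
  using row_len_pos[of "n - 1"] by (cases n) auto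

lemma edge_effect:
  assumes u: "regs s 20 < N" and b: "b \<noteq> Dollar"
  shows "regs (effect I w (edge_prog (sym_code b)) s) 12 = edge_rank b (regs s 20)"
    and "regs (effect I w (edge_prog (sym_code b)) s) 13 = edge_rank b (Suc (regs s 20))"
    and "x \<notin> {10, 11, 12, 13, 30} \<Longrightarrow> regs (effect I w (edge_prog (sym_code b)) s) x = regs s x"
    and "arrs (effect I w (edge_prog (sym_code b)) s) = arrs s"
    and "outp (effect I w (edge_prog (sym_code b)) s) = outp s"
proof -
  let ?u = "regs s 20"
  have wb: "word w (sym_code b) = sym_code b" using sym_code_less[of b] by (intro word_small) simp
  have sel: "word w (Suc (word w (answer I B_Select n 0))) = offset row_len (Suc n)" if "n < N" for n
  proof -
    have "answer I B_Select n 0 = offset row_len (Suc n) - 1" using B_select[OF that] .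
    moreover have "0 < offset row_len (Suc n)" by (rule offset_pos) simp
    moreover have "offset row_len (Suc n) < 2 ^ w" using that by (intro offset_le) simp
    ultimately show ?thesis by (simp add: word_id del: offset_Suc)
  qed
  have lo: "word w (of_bool (0 < ?u) * word w (Suc (word w (answer I B_Select (word w (?u - 1)) 0)))) = offset row_len ?u"
  proof (cases ?u)
    case (Suc n)
    then have "word w n = n" using u by (intro word_row(1)) simp
    then have "word w (Suc (word w (answer I B_Select (word w (?u - 1)) 0))) = offset row_len ?u"
      using sel[of n] u Suc by simp
    moreover have "word w (offset row_len ?u) = offset row_len ?u" using u by (intro word_id offset_le) simp
    ultimately show ?thesis using Suc by simp
  qed simp
  have r: "word w (edge_rank b n) = edge_rank b n" if "n \<le> N" for n
    using edge_rank_less[OF that] by (rule word_row)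
  show "regs (effect I w (edge_prog (sym_code b)) s) 12 = edge_rank b (regs s 20)"
    using u E_rank_offset[of ?u b] b
    by (simp add: edge_prog_def wb lo[simplified] r split del: split_of_bool)
  show "regs (effect I w (edge_prog (sym_code b)) s) 13 = edge_rank b (Suc (regs s 20))"
    using u E_rank_offset[of "Suc ?u" b] b
    by (simp add: edge_prog_def wb sel r del: offset_Suc)
  show "x \<notin> {10, 11, 12, 13, 30} \<Longrightarrow> regs (effect I w (edge_prog (sym_code b)) s) x = regs s x"
    "arrs (effect I w (edge_prog (sym_code b)) s) = arrs s"
    "outp (effect I w (edge_prog (sym_code b)) s) = outp s"
    by (simp_all add: edge_prog_def)
qed

lemma good_snoc: "good (X @ [b]) \<longleftrightarrow> good X \<or> X @ [b] \<in> sources v"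
  by (auto simp: good_def)

lemma child_effect:
  fixes X W b s
  defines "Y \<equiv> X @ [b]" and "s' \<equiv> effect I w (child_prog (sym_code b)) s"
  assumes X: "label X" "length X < k - 1" and b: "b \<noteq> Dollar"
    and s: "regs s 20 = row_of X" "regs s 21 = length X" "regs s 22 = of_bool (good X)"
    and mk: "marks 0 (touched (sources v)) s" "marks 1 (sources v) s"
    and W: "queue W s" "relevant Y \<Longrightarrow> length W < N"
  shows "queue (W @ (if relevant Y then [Y] else [])) s'"
    and "marks 0 (touched (sources v)) s'" "marks 1 (sources v) s'"
    and "x \<in> {0, 1, 20, 21, 22, 23} \<Longrightarrow> regs s' x = regs s x" and "outp s' = outp s"
proof -
  have rX: "read_prefix X" using X(1) by (simp add: label_def)
  have u: "regs s 20 < N" using s(1) row_of_less[OF rX] X(2) by simp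
  define s1 where "s1 = effect I w (edge_prog (sym_code b)) s"
  note e = edge_effect[OF u b, folded s1_def]
  have wb: "word w (sym_code b) = sym_code b" using sym_code_less[of b] by (intro word_small) simp
  have Yk: "length Y \<le> k - 1" using X(2) by (simp add: Y_def)
  have test: "eval w s1 (Bin Less (Reg 12) (Reg 13)) \<noteq> 0 \<longleftrightarrow> read_prefix Y"
    using e(1,2) s(1) edge_rank_Suc[of b "row_of X"] unflagged_row_of_iff[OF rX X(2), of b]
    by (simp add: Y_def)
  have s': "s' = (if read_prefix Y then effect I w (push_prog (sym_code b)) s1 else effect I w (seqs []) s1)"
    unfolding s'_def child_prog_def using test by (simp add: s1_def)
  have "queue (W @ (if relevant Y then [Y] else [])) s' \<and>
    marks 0 (touched (sources v)) s' \<and> marks 1 (sources v) s' \<and>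
    (x \<in> {0, 1, 20, 21, 22, 23} \<longrightarrow> regs s' x = regs s x) \<and> outp s' = outp s"
  proof (cases "read_prefix Y")
    case False
    then have "\<not> relevant Y" by (simp add: relevant_def label_def)
    then show ?thesis using False s' W(1) mk e by (auto simp: queue_def marks_def)
  next
    case True
    then have lY: "label Y" using Yk by (simp add: label_def)
    let ?r = "row_of Y"
    have r: "?r < N" using row_of_less[OF True Yk] .
    have "unflagged b (row_of X)" using unflagged_row_of_iff[OF rX X(2)] True by (simp add: Y_def)
    then have tgt: "first_row b + edge_rank b (row_of X) = ?r"
      using target_eq[of "row_of X" b] target_row_of[OF rX X(2)] u s(1) by (simp add: Y_def)
    have F: "word w (first_row b) = first_row b" using word_row(2)[of "first_row b"] by (simp add: first_row_def)
    have tr: "word w (first_row b + edge_rank b (row_of X)) = ?r" using tgt word_row(1)[OF r] by simp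
    have a: "arrs s 0 ?r = of_bool (Y \<in> touched (sources v))" "arrs s 1 ?r = of_bool (Y \<in> sources v)"
      using mk lY by (auto simp: marks_def)
    have g: "0 < word w (of_bool (Y \<in> sources v) + of_bool (good X)) \<longleftrightarrow> good Y"
      using good_snoc[of X b] word_small[of 2] word_small[of 1] by (auto simp: Y_def numeral_2_eq_2)
    have rel: "0 < word w (of_bool (good Y) + of_bool (Y \<in> touched (sources v))) \<longleftrightarrow> relevant Y"
      using lY word_small[of 2] word_small[of 1] by (auto simp: relevant_def numeral_2_eq_2)
    have d: "word w (Suc (length X)) = length Y"
      using X(2) fits'(3) word_id[of "Suc (length X)" w] by (simp add: Y_def)
    have t: "word w (Suc (length W)) = Suc (length W)" if "relevant Y"
      using W(2)[OF that] by (intro word_row(2)) simp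
    have t0: "regs s 24 = length W" using W(1) by (simp add: queue_def)
    note simps = s' push_prog_def wb C_access F tr a a(2)[simplified] e s g rel d t t0
    have "arrs s' = (if relevant Y then (arrs s)(2 := (arrs s 2)(length W := ?r),
        3 := (arrs s 3)(length W := length Y), 4 := (arrs s 4)(length W := of_bool (good Y))) else arrs s)"
      using True by (simp add: simps split del: split_of_bool)
    moreover have "regs s' 24 = (if relevant Y then Suc (length W) else length W)"
      using True by (simp add: simps split del: split_of_bool)
    moreover have "x \<in> {0, 1, 20, 21, 22, 23} \<longrightarrow> regs s' x = regs s x" "outp s' = outp s"
      using True by (auto simp: simps split del: split_of_bool)
    ultimately show ?thesis using W(1) mk by (auto simp: queue_def marks_def nth_append less_Suc_eq)
  qed
  then show "queue (W @ (if relevant Y then [Y] else [])) s'"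
    "marks 0 (touched (sources v)) s'" "marks 1 (sources v) s'"
    "x \<in> {0, 1, 20, 21, 22, 23} \<Longrightarrow> regs s' x = regs s x" "outp s' = outp s"
    by auto
qed

lemma walk_loop:
  assumes s: "regs s 3 = i" "regs s 5 = k - 1"
  shows "ends I w (While (Reg 5) walk_body) s (\<lambda>t s'. regs s' 3 = (pred_row ^^ (k - 1)) i \<and>
    regs s' 0 = regs s 0 \<and> regs s' 1 = regs s 1 \<and> arrs s' = arrs s \<and> outp s' = outp s \<and>
    t \<le> walk_cost * k + 2)"
proof -
  define Inv where "Inv = (\<lambda>j (s' :: mstate). j \<le> k - 1 \<and> regs s' 3 = (pred_row ^^ j) i \<and> regs s' 5 = k - 1 - j \<and>
    regs s' 0 = regs s 0 \<and> regs s' 1 = regs s 1 \<and> arrs s' = arrs s \<and> outp s' = outp s)"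
  have "ends I w (While (Reg 5) walk_body) s (\<lambda>t s'. \<exists>j. Inv j s' \<and> eval w s' (Reg 5) = 0 \<and>
    t + walk_cost * (k - 1 - j) \<le> walk_cost * (k - 1 - 0) + (1 + ecost (Reg 5)))"
  proof (rule ends_While)
    show "Inv 0 s" using s by (simp add: Inv_def)
  next
    fix j s' assume inv: "Inv j s'" "eval w s' (Reg 5) \<noteq> 0"
    then have j: "j < k - 1" by (simp add: Inv_def)
    let ?r = "(pred_row ^^ j) i"
    have r: "?r < N" "suffix (take (k - 1 - j) v) (M ! ?r)"
      using pred_walk_suffix[OF v, of j] j idx_v by auto
    have ne: "take (k - 1 - j) v \<noteq> []" using j length_v by auto
    then have "last (M ! ?r) = last (take (k - 1 - j) v)" using r(2) by (auto simp: suffix_def)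
    then have "last (M ! ?r) \<in> set v" using last_in_set[OF ne] by (metis in_set_takeD)
    then have last: "last (M ! ?r) \<noteq> Dollar" using Dollar_notin_solid[OF v] by metis
    have r3: "regs s' 3 = ?r" using inv by (simp add: Inv_def)
    note b = back_effect[of s', unfolded r3, OF r(1) last]
    have "word w (k - 1 - j - 1) = k - 1 - j - 1" using fits'(3) by (intro word_id) simp
    then have "Inv (Suc j) (effect I w walk_body s')"
      using inv b j by (simp add: Inv_def walk_body_def)
    moreover have "walk_cost * (k - 1 - j) = walk_cost + walk_cost * (k - 1 - Suc j)"
      using j by (metis Suc_diff_Suc mult_Suc_right)
    moreover have "t + (1 + ecost (Reg 5)) \<le> walk_cost" if "t \<le> max_cost walk_body" for t
      using that by (simp add: walk_cost_def)
    ultimately have "Inv (Suc j) (effect I w walk_body s') \<and>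
        t + (1 + ecost (Reg 5)) + walk_cost * (k - 1 - Suc j) \<le> walk_cost * (k - 1 - j)"
      if "t \<le> max_cost walk_body" for t using that by simp
    then show "ends I w walk_body s' (\<lambda>t s''. \<exists>g'. Inv g' s'' \<and>
        t + (1 + ecost (Reg 5)) + walk_cost * (k - 1 - g') \<le> walk_cost * (k - 1 - j))"
      by (intro ends_loop_free) (simp, blast)
  qed
  then show ?thesis
  proof (rule ends_mono)
    fix t s'
    assume "\<exists>j. Inv j s' \<and> eval w s' (Reg 5) = 0 \<and>
      t + walk_cost * (k - 1 - j) \<le> walk_cost * (k - 1 - 0) + (1 + ecost (Reg 5))"
    then obtain j where j: "Inv j s'" "regs s' 5 = 0" "t \<le> walk_cost * (k - 1) + 2" by auto
    then have "j = k - 1" unfolding Inv_def by linarith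
    moreover have "walk_cost * (k - 1) \<le> walk_cost * k" by simp
    then have "t \<le> walk_cost * k + 2" using j(3) by linarith
    ultimately show "regs s' 3 = (pred_row ^^ (k - 1)) i \<and>
      regs s' 0 = regs s 0 \<and> regs s' 1 = regs s 1 \<and> arrs s' = arrs s \<and> outp s' = outp s \<and>
      t \<le> walk_cost * k + 2"
      using j(1) unfolding Inv_def by blast
  qed
qed

lemma finite_touched: "finite (touched (sources v))"
proof -
  have "touched (sources v) \<subseteq> insert [] (\<Union>X\<in>sources v. set (prefixes X))"
    by (auto simp: touched_def)
  then show ?thesis using finite_sources by (auto intro: finite_subset)
qed

lemma touched_mono: "D \<subseteq> D' \<Longrightarrow> touched D \<subseteq> touched D'"
  by (auto simp: touched_def)

lemma touched_prefix: "Y \<in> touched D \<Longrightarrow> prefix Z Y \<Longrightarrow> Z \<in> touched D"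
  unfolding touched_def using prefix_order.trans by auto

definition untouched :: "sym list set \<Rightarrow> nat" where
  "untouched D = card (touched (sources v)) - card (touched D)"

lemma mark_loop:
  assumes X: "X \<in> sources v" and D: "D \<subseteq> sources v"
    and s: "regs s 3 = row_of X" "regs s 9 = of_bool (X \<in> touched D)" "marks 0 (touched D) s"
  shows "ends I w (While (Bin Equal (Reg 9) (Num 0)) mark_body) s (\<lambda>t s'.
    marks 0 (touched (insert X D)) s' \<and> (\<forall>x\<in>{0, 1, 6}. regs s' x = regs s x) \<and>
    (\<forall>a>0. arrs s' a = arrs s a) \<and> outp s' = outp s \<and>
    t + mark_cost * untouched (insert X D) \<le> mark_cost * untouched D + 4)"
proof -
  define T where "T = (\<lambda>Y :: sym list. touched D \<union> {Z. prefix Z X \<and> length Y < length Z})"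
  define f where "f = (\<lambda>Y. card (touched (sources v)) - card (T Y))"
  define Inv where "Inv = (\<lambda>Y (s' :: mstate). prefix Y X \<and> regs s' 3 = row_of Y \<and> marks 0 (T Y) s' \<and>
    regs s' 9 = of_bool (Y \<in> touched D) \<and> (\<forall>x\<in>{0, 1, 6}. regs s' x = regs s x) \<and>
    (\<forall>a>0. arrs s' a = arrs s a) \<and> outp s' = outp s)"
  have lX: "read_prefix X" "length X < k - 1" using label_source[OF X] by auto
  have TX: "T X = touched D" unfolding T_def using prefix_length_le by fastforce
  have T_sub: "T Y \<subseteq> touched (sources v)" for Y
    using touched_mono[OF D] X unfolding T_def by (auto simp: touched_def)
  have "ends I w (While (Bin Equal (Reg 9) (Num 0)) mark_body) s (\<lambda>t s'. \<exists>Y. Inv Y s' \<and>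
    eval w s' (Bin Equal (Reg 9) (Num 0)) = 0 \<and>
    t + mark_cost * f Y \<le> mark_cost * f X + (1 + ecost (Bin Equal (Reg 9) (Num 0))))"
  proof (rule ends_While)
    show "Inv X s" using s TX by (simp add: Inv_def)
  next
    fix Y s' assume inv: "Inv Y s'" "eval w s' (Bin Equal (Reg 9) (Num 0)) \<noteq> 0"
    then have Y: "prefix Y X" "Y \<notin> touched D" by (auto simp: Inv_def)
    then have "Y \<noteq> []" by (auto simp: touched_def)
    then obtain Y' c where Yc: "Y = Y' @ [c]" by (metis append_butlast_last_id)
    have lY: "read_prefix Y" "length Y < k - 1"
      using Y(1) lX read_prefix_mono prefix_length_le[OF Y(1)] by auto
    then have labY: "label Y" by (simp add: label_def)
    have rY: "row_of Y < N" using row_of_less lY by simp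
    have pr: "pred_row (row_of Y) = row_of Y'" using pred_row_row_of[of Y' c] lY Yc by simp
    have lastY: "last (M ! row_of Y) \<noteq> Dollar" using last_row_of[OF lY(1) \<open>Y \<noteq> []\<close>] lY(2) by simp
    define s1 where "s1 = effect I w (Store 0 (Reg 3) (Num 1)) s'"
    have s1: "regs s1 = regs s'" "arrs s1 = (arrs s')(0 := (arrs s' 0)(row_of Y := 1))" "outp s1 = outp s'"
      using inv by (simp_all add: s1_def Inv_def)
    have r3: "regs s1 3 = row_of Y" using inv s1 by (simp add: Inv_def)
    note b = back_effect[of s1, unfolded r3, OF rY lastY]
    have eff: "effect I w mark_body s' = effect I w (Load 9 0 (Reg 3)) (effect I w back_prog s1)"
      by (simp add: mark_body_def s1_def)
    have Y': "prefix Y' X" "label Y'"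
      using Y(1) Yc lY read_prefix_mono[OF lY(1), of Y'] prefix_order.trans[of Y' Y X]
      by (auto simp: label_def)
    have TY': "T Y' = insert Y (T Y)"
    proof (intro set_eqI iffI)
      fix Z assume Z: "Z \<in> T Y'"
      show "Z \<in> insert Y (T Y)"
      proof (cases "Z \<in> touched D")
        case False
        then have "prefix Z X" "length Y \<le> length Z" using Z Yc by (auto simp: T_def)
        then show ?thesis using Y(1) unfolding T_def
          by (metis (mono_tags, lifting) CollectI UnI2 insertCI le_neq_implies_less not_equal_is_parallel
              parallelE prefix_same_cases prefix_order.antisym prefix_length_le)
      qed (simp add: T_def)
    qed (use Y(1) Yc in \<open>auto simp: T_def\<close>)
    have mk: "marks 0 (T Y') (effect I w mark_body s')"
      unfolding marks_def
    proof (intro allI impI)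
      fix Z assume "label Z"
      then have "row_of Z = row_of Y \<longleftrightarrow> Z = Y" using row_of_inject labY by (auto simp: label_def)
      then show "arrs (effect I w mark_body s') 0 (row_of Z) = of_bool (Z \<in> T Y')"
        using inv \<open>label Z\<close> unfolding eff TY' by (auto simp: b s1 Inv_def marks_def)
    qed
    have "Y' \<in> T Y' \<longleftrightarrow> Y' \<in> touched D" by (auto simp: T_def)
    then have "regs (effect I w mark_body s') 9 = of_bool (Y' \<in> touched D)"
      using mk Y'(2) b(1) pr unfolding eff marks_def by simp
    then have inv': "Inv Y' (effect I w mark_body s')"
      using inv mk Y' b s1 pr unfolding Inv_def by (simp add: eff)
    have "Y \<notin> T Y" using Y by (simp add: T_def)
    then have "card (T Y') = Suc (card (T Y))"
      unfolding TY' using finite_subset[OF T_sub finite_touched] by simp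
    moreover have "card (T Y') \<le> card (touched (sources v))" using T_sub finite_touched by (rule card_mono[rotated])
    ultimately have "f Y = Suc (f Y')" unfolding f_def by linarith
    then have eq: "mark_cost * f Y = mark_cost + mark_cost * f Y'" by simp
    have "t + (1 + ecost (Bin Equal (Reg 9) (Num 0))) \<le> mark_cost" if "t \<le> max_cost mark_body" for t
      using that by (simp add: mark_cost_def)
    then have "Inv Y' (effect I w mark_body s') \<and>
        t + (1 + ecost (Bin Equal (Reg 9) (Num 0))) + mark_cost * f Y' \<le> mark_cost * f Y"
      if "t \<le> max_cost mark_body" for t using that inv' unfolding eq by (meson add_le_mono1)
    then show "ends I w mark_body s' (\<lambda>t s''. \<exists>Y'. Inv Y' s'' \<and>
        t + (1 + ecost (Bin Equal (Reg 9) (Num 0))) + mark_cost * f Y' \<le> mark_cost * f Y)"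
      by (intro ends_loop_free) (simp, blast)
  qed
  then show ?thesis
  proof (rule ends_mono)
    fix t s'
    assume "\<exists>Y. Inv Y s' \<and> eval w s' (Bin Equal (Reg 9) (Num 0)) = 0 \<and>
      t + mark_cost * f Y \<le> mark_cost * f X + (1 + ecost (Bin Equal (Reg 9) (Num 0)))"
    then obtain Y where Y: "Inv Y s'" "regs s' 9 \<noteq> 0" "t + mark_cost * f Y \<le> mark_cost * f X + 4"
      by (auto split: if_splits)
    then have YD: "Y \<in> touched D" "prefix Y X" by (auto simp: Inv_def split: if_splits)
    have "T Y = touched (insert X D)"
    proof (intro set_eqI iffI)
      fix Z assume Z: "Z \<in> touched (insert X D)"
      show "Z \<in> T Y"
      proof (cases "Z \<in> touched D")
        case False
        then have "prefix Z X" using Z by (auto simp: touched_def)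
        moreover have "\<not> prefix Z Y" using False YD(1) touched_prefix by blast
        ultimately have "length Y < length Z"
          using YD(2) by (metis not_le prefix_length_prefix)
        then show ?thesis using \<open>prefix Z X\<close> by (simp add: T_def)
      qed (simp add: T_def)
    qed (use touched_mono[of D "insert X D"] in \<open>auto simp: T_def touched_def\<close>)
    moreover have "f X = untouched D" by (simp add: f_def untouched_def TX)
    moreover have "f Y = untouched (insert X D)" using calculation(1) by (simp add: f_def untouched_def)
    ultimately show "marks 0 (touched (insert X D)) s' \<and> (\<forall>x\<in>{0, 1, 6}. regs s' x = regs s x) \<and>
      (\<forall>a>0. arrs s' a = arrs s a) \<and> outp s' = outp s \<and>
      t + mark_cost * untouched (insert X D) \<le> mark_cost * untouched D + 4"
      using Y(1,3) unfolding Inv_def by simp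
  qed
qed

lemma source_loop:
  assumes ps: "enclose_chain BP 0 ps x" "\<forall>p\<in>set ps. 0 < p \<and> p < length BP"
    "set (map (leaf_rank BP) ps) = row_of ` sources v"
    and s: "regs s 6 = last (0 # ps)" "marks 0 (touched {}) s" "marks 1 {} s"
  shows "ends I w (While (Reg 6) source_body) s (\<lambda>t s'.
    marks 0 (touched (sources v)) s' \<and> marks 1 (sources v) s' \<and>
    (\<forall>x\<in>{0, 1}. regs s' x = regs s x) \<and> (\<forall>a>1. arrs s' a = arrs s a) \<and> outp s' = outp s \<and>
    t \<le> source_cost * length ps + mark_cost * card (touched (sources v)) + 2)"
proof -
  define Inv where "Inv = (\<lambda>(qs, D) (s' :: mstate). \<exists>rs. ps = qs @ rs \<and> regs s' 6 = last (0 # qs) \<and>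
    D \<subseteq> sources v \<and> row_of ` D = leaf_rank BP ` set rs \<and> marks 0 (touched D) s' \<and> marks 1 D s' \<and>
    (\<forall>x\<in>{0, 1}. regs s' x = regs s x) \<and> (\<forall>a>1. arrs s' a = arrs s a) \<and> outp s' = outp s)"
  define \<Phi> where "\<Phi> = (\<lambda>(qs :: nat list, D). source_cost * length qs + mark_cost * untouched D)"
  have "ends I w (While (Reg 6) source_body) s (\<lambda>t s'. \<exists>g. Inv g s' \<and> eval w s' (Reg 6) = 0 \<and>
    t + \<Phi> g \<le> \<Phi> (ps, {}) + (1 + ecost (Reg 6)))"
  proof (rule ends_While)
    show "Inv (ps, {}) s" using s by (simp add: Inv_def)
  next
    fix g s' assume inv: "Inv g s'" "eval w s' (Reg 6) \<noteq> 0"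
    obtain qs D where g: "g = (qs, D)" by (cases g)
    then obtain qs' p where qs: "qs = qs' @ [p]" using inv by (cases qs rule: rev_cases) (auto simp: Inv_def)
    obtain rs where rs: "ps = qs' @ p # rs" "regs s' 6 = p" "D \<subseteq> sources v" "row_of ` D = leaf_rank BP ` set rs"
      "marks 0 (touched D) s'" "marks 1 D s'" "\<forall>x\<in>{0, 1}. regs s' x = regs s x"
      "\<forall>a>1. arrs s' a = arrs s a" "outp s' = outp s"
      using inv g qs by (auto simp: Inv_def)
    have "leaf_rank BP p \<in> row_of ` sources v" using rs(1) ps(3) by (metis in_set_conv_decomp image_eqI set_map)
    then obtain X where X: "X \<in> sources v" "leaf_rank BP p = row_of X" by auto
    have labX: "label X" using label_source[OF X(1)] by (simp add: label_def)
    have wX: "word w (row_of X) = row_of X" using row_of_source(1)[OF X(1)] by (rule word_row)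
    define s1 where "s1 = effect I w source_head s'"
    have "arrs s' 0 (row_of X) = of_bool (X \<in> touched D)" using rs(5) labX by (simp add: marks_def)
    then have s1: "regs s1 3 = row_of X" "regs s1 9 = of_bool (X \<in> touched D)" "regs s1 6 = p"
        "\<forall>x\<in>{0, 1}. regs s1 x = regs s x" "arrs s1 = (arrs s')(1 := (arrs s' 1)(row_of X := 1))" "outp s1 = outp s"
      using rs(2,7,9) X(2) wX by (auto simp: s1_def source_head_def)
    have mk0: "marks 0 (touched D) s1" using rs(5) s1(5) by (simp add: marks_def)
    have "row_of Z = row_of X \<longleftrightarrow> Z = X" if "label Z" for Z
      using that row_of_inject labX by (auto simp: label_def)
    then have mk1: "marks 1 (insert X D) s1" using rs(6) s1(5) by (auto simp: marks_def)
    have enc: "word w (enclose BP p) = last (0 # qs')"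
    proof (rule enclose_word)
      show "enclose_chain BP 0 qs' p" using ps(1) rs(1) enclose_chain_prefix by metis
    qed (use ps(2) rs(1) in auto)
    let ?D = "insert X D" and ?ask = "Ask 6 BP_Enclose (Reg 6) (Num 0)"
    show "ends I w source_body s' (\<lambda>t s''. \<exists>g'. Inv g' s'' \<and> t + (1 + ecost (Reg 6)) + \<Phi> g' \<le> \<Phi> g)"
      unfolding source_body_def
    proof (rule ends_Seq, rule ends_loop_free, simp, fold s1_def, rule ends_Seq)
      fix t assume t: "t \<le> max_cost source_head"
      show "ends I w (While (Bin Equal (Reg 9) (Num 0)) mark_body) s1 (\<lambda>t' s2. ends I w ?ask s2
        (\<lambda>t'' s''. \<exists>g'. Inv g' s'' \<and> t + (t' + t'') + (1 + ecost (Reg 6)) + \<Phi> g' \<le> \<Phi> g))"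
      proof (rule ends_mono[OF mark_loop[OF X(1) rs(3) s1(1,2) mk0]], rule ends_loop_free, simp)
        fix t' s2 t''
        assume s2: "marks 0 (touched ?D) s2 \<and> (\<forall>x\<in>{0, 1, 6}. regs s2 x = regs s1 x) \<and>
          (\<forall>a>0. arrs s2 a = arrs s1 a) \<and> outp s2 = outp s1 \<and>
          t' + mark_cost * untouched ?D \<le> mark_cost * untouched D + 4"
          and t'': "t'' \<le> max_cost ?ask"
        let ?s = "effect I w ?ask s2"
        have mk1': "marks 1 ?D ?s" using mk1 s2 by (simp add: marks_def)
        have mk0': "marks 0 (touched ?D) ?s" using s2 by (simp add: marks_def)
        have "Inv (qs', ?D) ?s"
          unfolding Inv_def prod.case
        proof (intro exI[of _ "p # rs"] conjI)
          show "row_of ` ?D = leaf_rank BP ` set (p # rs)" using rs(4) X(2) by simp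
          show "regs ?s 6 = last (0 # qs')" using s2 s1(3) enc by simp
          show "\<forall>x\<in>{0, 1}. regs ?s x = regs s x" using s2 s1(4) by simp
          show "\<forall>a>1. arrs ?s a = arrs s a" using s2 s1(5) rs(8) by simp
          show "outp ?s = outp s" using s2 s1(6) by simp
        qed (use rs(1,3) X(1) mk0' mk1' in auto)
        moreover have "\<Phi> g = source_cost + (source_cost * length qs' + mark_cost * untouched D)"
          by (simp add: \<Phi>_def g qs)
        moreover have "\<Phi> (qs', ?D) = source_cost * length qs' + mark_cost * untouched ?D"
          by (simp add: \<Phi>_def)
        moreover have "source_cost = max_cost source_head + max_cost ?ask + 6" by (simp add: source_cost_def)
        moreover have "1 + ecost (Reg 6) = 2" by simp
        ultimately have "Inv (qs', ?D) ?s \<and> t + (t' + t'') + (1 + ecost (Reg 6)) + \<Phi> (qs', ?D) \<le> \<Phi> g"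
          using s2 t t'' by linarith
        then show "\<exists>g'. Inv g' ?s \<and> t + (t' + t'') + (1 + ecost (Reg 6)) + \<Phi> g' \<le> \<Phi> g" by blast
      qed
    qed
  qed
  then show ?thesis
  proof (rule ends_mono)
    fix t s'
    assume "\<exists>g. Inv g s' \<and> eval w s' (Reg 6) = 0 \<and> t + \<Phi> g \<le> \<Phi> (ps, {}) + (1 + ecost (Reg 6))"
    then obtain qs D where g: "Inv (qs, D) s'" "regs s' 6 = 0" "t \<le> \<Phi> (ps, {}) + 2" by auto
    then have "qs = []" using ps(2) by (cases qs rule: rev_cases) (auto simp: Inv_def)
    then have D: "D \<subseteq> sources v" "row_of ` D = row_of ` sources v" using g(1) ps(3) by (auto simp: Inv_def)
    then have "D = sources v" using row_of_inj_sources by (metis inj_on_image_eq_iff order_refl)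
    moreover have "\<Phi> (ps, {}) \<le> source_cost * length ps + mark_cost * card (touched (sources v))"
      by (simp add: \<Phi>_def untouched_def)
    ultimately show "marks 0 (touched (sources v)) s' \<and> marks 1 (sources v) s' \<and>
      (\<forall>x\<in>{0, 1}. regs s' x = regs s x) \<and> (\<forall>a>1. arrs s' a = arrs s a) \<and> outp s' = outp s \<and>
      t \<le> source_cost * length ps + mark_cost * card (touched (sources v)) + 2"
      using g unfolding Inv_def by auto
  qed
qed

lemma label_Nil: "label []"
  by (simp add: label_def read_prefix_Nil)

lemma finite_label: "finite {Y. label Y}"
proof -
  have "{Y. label Y} \<subseteq> (\<Union>x\<in>rc_closure R. set (prefixes x))"
    by (auto simp: label_def read_prefix_def)
  then show ?thesis using finite_reads by (auto intro: finite_subset)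
qed

lemma finite_relevant: "finite {Y. relevant Y}"
  using finite_subset[OF _ finite_label] by (auto simp: relevant_def)

lemma length_labels_le:
  assumes "distinct W" "\<forall>Y\<in>set W. label Y" shows "length W \<le> N"
proof -
  have "inj_on row_of (set W)" using assms(2) row_of_inject by (auto simp: inj_on_def label_def)
  then have "length W = card (row_of ` set W)" using assms(1) by (simp add: card_image distinct_card)
  also have "\<dots> \<le> card {..<N}" using assms(2) row_of_less by (intro card_mono) (auto simp: label_def)
  finally show ?thesis by simp
qed

lemma children_effect:
  assumes X: "label X" "length X < k - 1" and bs: "distinct bs" "Dollar \<notin> set bs"
    and W: "queue W s" "distinct W" "\<forall>Y\<in>set W. label Y" "\<forall>b\<in>set bs. X @ [b] \<notin> set W"
    and s: "regs s 20 = row_of X" "regs s 21 = length X" "regs s 22 = of_bool (good X)"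
    and mk: "marks 0 (touched (sources v)) s" "marks 1 (sources v) s"
  defines "s' \<equiv> effect I w (seqs (map (\<lambda>b. child_prog (sym_code b)) bs)) s"
  shows "queue (W @ filter relevant (map (\<lambda>b. X @ [b]) bs)) s' \<and>
    marks 0 (touched (sources v)) s' \<and> marks 1 (sources v) s' \<and>
    (\<forall>x\<in>{0, 1, 23}. regs s' x = regs s x) \<and> outp s' = outp s"
  using bs W s mk unfolding s'_def
proof (induction bs arbitrary: W s)
  case Nil
  then show ?case by (auto simp: queue_def marks_def)
next
  case (Cons b bs)
  let ?Y = "X @ [b]" and ?s = "effect I w (child_prog (sym_code b)) s"
  let ?W = "W @ (if relevant ?Y then [?Y] else [])"
  have b: "b \<noteq> Dollar" using Cons.prems(2) by auto
  have len: "length W < N" if "relevant ?Y"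
    using length_labels_le[of "?Y # W"] that Cons.prems by (auto simp: relevant_def)
  note c = child_effect[OF X b Cons.prems(7-11) Cons.prems(3) len]
  have "queue (?W @ filter relevant (map (\<lambda>b. X @ [b]) bs)) (effect I w (seqs (map (\<lambda>b. child_prog (sym_code b)) bs)) ?s) \<and>
    marks 0 (touched (sources v)) (effect I w (seqs (map (\<lambda>b. child_prog (sym_code b)) bs)) ?s) \<and>
    marks 1 (sources v) (effect I w (seqs (map (\<lambda>b. child_prog (sym_code b)) bs)) ?s) \<and>
    (\<forall>x\<in>{0, 1, 23}. regs (effect I w (seqs (map (\<lambda>b. child_prog (sym_code b)) bs)) ?s) x = regs ?s x) \<and>
    outp (effect I w (seqs (map (\<lambda>b. child_prog (sym_code b)) bs)) ?s) = outp ?s"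
    using Cons.prems c by (intro Cons.IH) (auto simp: relevant_def)
  then show ?case using c(4,5) by (cases "relevant ?Y") simp_all
qed

lemma relevant_butlast: "relevant (X @ [b]) \<Longrightarrow> relevant X"
proof -
  assume r: "relevant (X @ [b])"
  have "label X" using r read_prefix_mono[of "X @ [b]" X] by (auto simp: relevant_def label_def)
  moreover have "X \<in> touched (sources v) \<or> good X"
  proof (cases "X @ [b] \<in> touched (sources v)")
    case True
    then show ?thesis using touched_prefix by (metis prefixI)
  next
    case False
    then show ?thesis using r good_snoc[of X b] by (auto simp: relevant_def touched_def)
  qed
  ultimately show ?thesis by (simp add: relevant_def)
qed

lemma relevant_Nil: "relevant []"
  by (simp add: relevant_def label_Nil touched_def)

lemma relevant_symbol: "relevant (X @ [b]) \<Longrightarrow> b \<in> set [Ade, Cyt, Gua, Thy]"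
  using Dollar_notin_read_prefix[of "X @ [b]"] by (cases b) (auto simp: relevant_def label_def)

definition full :: "sym list \<Rightarrow> bool" where
  "full Y \<longleftrightarrow> length Y = k - 1 \<and> row_of Y \<noteq> i"

definition visit_inv :: "nat list \<Rightarrow> sym list list \<times> nat \<Rightarrow> mstate \<Rightarrow> bool" where
  "visit_inv out = (\<lambda>(W, h) s. h \<le> length W \<and> queue W s \<and> regs s 23 = h \<and> regs s 0 = i \<and> regs s 1 = k \<and>
    marks 0 (touched (sources v)) s \<and> marks 1 (sources v) s \<and>
    distinct W \<and> (\<forall>Y\<in>set W. relevant Y) \<and> [] \<in> set W \<and>
    (\<forall>Y\<in>set W. Y \<noteq> [] \<longrightarrow> butlast Y \<in> set (take h W)) \<and>
    (\<forall>X\<in>set (take h W). \<forall>b. length X < k - 1 \<longrightarrow> relevant (X @ [b]) \<longrightarrow> X @ [b] \<in> set W) \<and>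
    outp s = out @ map row_of (filter full (take h W)))"

lemma visit_step:
  assumes inv: "visit_inv out (W, h) s" and h: "h < length W"
  shows "\<exists>W'. visit_inv out (W', Suc h) (effect I w visit_body s)"
proof -
  define X where "X = W ! h"
  have take: "take (Suc h) W = take h W @ [X]" using h by (simp add: take_Suc_conv_app_nth X_def)
  have W: "queue W s" "distinct W" "\<forall>Y\<in>set W. relevant Y" "regs s 23 = h" "regs s 0 = i" "regs s 1 = k"
    "marks 0 (touched (sources v)) s" "marks 1 (sources v) s"
    using inv by (auto simp: visit_inv_def)
  have parents: "\<forall>Y\<in>set W. Y \<noteq> [] \<longrightarrow> butlast Y \<in> set (take h W)"
    and closed: "\<forall>X\<in>set (take h W). \<forall>b. length X < k - 1 \<longrightarrow> relevant (X @ [b]) \<longrightarrow> X @ [b] \<in> set W"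
    and Nil: "[] \<in> set W" and out: "outp s = out @ map row_of (filter full (take h W))"
    using inv by (auto simp: visit_inv_def)
  have XW: "X \<in> set W" using h by (simp add: X_def)
  have X_take: "X \<notin> set (take h W)"
    using W(2) h by (metis X_def distinct_take not_distinct_conv_prefix take take_Suc_conv_app_nth
        distinct_append disjoint_insert(1) list.set(2))
  have labX: "label X" using W(3) XW by (auto simp: relevant_def)
  then have lenX: "length X \<le> k - 1" by (simp add: label_def)
  let ?load = "seqs [Load 20 2 (Reg 23), Load 21 3 (Reg 23), Load 22 4 (Reg 23)]"
  define s1 where "s1 = effect I w ?load s"
  have s1: "regs s1 20 = row_of X" "regs s1 21 = length X" "regs s1 22 = of_bool (good X)"
    "regs s1 23 = h" "regs s1 0 = i" "regs s1 1 = k" "regs s1 24 = regs s 24" "arrs s1 = arrs s" "outp s1 = outp s"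
    using W h by (simp_all add: s1_def queue_def X_def)
  have q1: "queue W s1" "marks 0 (touched (sources v)) s1" "marks 1 (sources v) s1"
    using W s1 by (auto simp: queue_def marks_def)
  have d: "word w (Suc (length X)) = Suc (length X)" using lenX fits'(3) k2 by (intro word_id) linarith
  have h': "word w (Suc h) = Suc h"
    using length_labels_le[OF W(2)] W(3) h by (intro word_row(2)) (auto simp: relevant_def)
  let ?inc = "Assign 23 (Bin Add (Reg 23) (Num 1))"
  show ?thesis
  proof (cases "length X = k - 1")
    case True
    define s2 where "s2 = effect I w (If (Bin Equal (Reg 20) (Reg 0)) (seqs []) (Emit (Reg 20))) s1"
    have eff: "effect I w visit_body s = effect I w ?inc s2"
      using True d k2 s1 by (simp add: visit_body_def s2_def s1_def)
    have s2: "regs s2 x = regs s1 x" if "x \<noteq> 30" for x using that by (simp add: s2_def)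
    have s2': "arrs s2 = arrs s1" "outp s2 = outp s1 @ map row_of (filter full [X])"
      using s1 True by (simp_all add: s2_def full_def)
    have "visit_inv out (W, Suc h) (effect I w visit_body s)"
      unfolding visit_inv_def prod.case eff
    proof (intro conjI)
      show "queue W (effect I w ?inc s2)" using q1(1) s2 s2'(1) by (simp add: queue_def)
      show "marks 0 (touched (sources v)) (effect I w ?inc s2)" "marks 1 (sources v) (effect I w ?inc s2)"
        using q1(2,3) s2'(1) by (simp_all add: marks_def)
      show "outp (effect I w ?inc s2) = out @ map row_of (filter full (take (Suc h) W))"
        unfolding take using s2'(2) s1 out by simp
      show "\<forall>Y\<in>set W. Y \<noteq> [] \<longrightarrow> butlast Y \<in> set (take (Suc h) W)"
        unfolding take using parents by auto
      show "\<forall>X\<in>set (take (Suc h) W). \<forall>b. length X < k - 1 \<longrightarrow> relevant (X @ [b]) \<longrightarrow> X @ [b] \<in> set W"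
        unfolding take using closed True by auto
    qed (use h h' s1 s2 W Nil in auto)
    then show ?thesis by blast
  next
    case False
    then have lX: "length X < k - 1" using lenX by simp
    let ?bs = "[Ade, Cyt, Gua, Thy]"
    let ?new = "filter relevant (map (\<lambda>b. X @ [b]) ?bs)"
    define s2 where "s2 = effect I w (seqs (map (\<lambda>b. child_prog (sym_code b)) ?bs)) s1"
    have eff: "effect I w visit_body s = effect I w ?inc s2"
      using False d k2 s1 lX by (simp add: visit_body_def s2_def s1_def)
    have notin: "X @ [b] \<notin> set W" for b
    proof
      assume "X @ [b] \<in> set W"
      then have "butlast (X @ [b]) \<in> set (take h W)" using parents by blast
      then show False using X_take by simp
    qed
    have c: "queue (W @ ?new) s2 \<and> marks 0 (touched (sources v)) s2 \<and> marks 1 (sources v) s2 \<and>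
        (\<forall>x\<in>{0, 1, 23}. regs s2 x = regs s1 x) \<and> outp s2 = outp s1"
      unfolding s2_def
    proof (rule children_effect[OF labX lX])
      show "\<forall>Y\<in>set W. label Y" using W(3) by (auto simp: relevant_def)
    qed (use s1 q1 W(2) notin in auto)
    have take': "take (Suc h) (W @ ?new) = take h W @ [X]" using h take by simp
    have "visit_inv out (W @ ?new, Suc h) (effect I w visit_body s)"
      unfolding visit_inv_def prod.case eff
    proof (intro conjI)
      show "queue (W @ ?new) (effect I w ?inc s2)" using c by (simp add: queue_def del: filter.simps list.map)
      show "marks 0 (touched (sources v)) (effect I w ?inc s2)" "marks 1 (sources v) (effect I w ?inc s2)"
        using c by (simp_all add: marks_def)
      show "outp (effect I w ?inc s2) = out @ map row_of (filter full (take (Suc h) (W @ ?new)))"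
        unfolding take' using c s1 out lX by (simp add: full_def)
      show "\<forall>Y\<in>set (W @ ?new). Y \<noteq> [] \<longrightarrow> butlast Y \<in> set (take (Suc h) (W @ ?new))"
        unfolding take' using parents by auto
      show "\<forall>X\<in>set (take (Suc h) (W @ ?new)). \<forall>b. length X < k - 1 \<longrightarrow> relevant (X @ [b]) \<longrightarrow> X @ [b] \<in> set (W @ ?new)"
      proof (intro ballI allI impI)
        fix X' b assume X': "X' \<in> set (take (Suc h) (W @ ?new))" "length X' < k - 1" "relevant (X' @ [b])"
        show "X' @ [b] \<in> set (W @ ?new)"
        proof (cases "X' = X")
          case True
          then show ?thesis using X'(3) relevant_symbol[OF X'(3)] by auto
        next
          case False
          then show ?thesis using X' closed unfolding take' by auto
        qed
      qed
      show "distinct (W @ ?new)" using W(2) notin by (auto simp: distinct_map inj_on_def)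
    qed (use h h' s1 c W Nil in auto)
    then show ?thesis by blast
  qed
qed

lemma visit_loop:
  assumes s: "regs s 0 = i" "regs s 1 = k" "regs s 23 = 0" "regs s 24 = 1"
    "marks 0 (touched (sources v)) s" "marks 1 (sources v) s" "\<forall>a\<in>{2, 3, 4}. arrs s a 0 = 0"
  shows "ends I w (While (Bin Less (Reg 23) (Reg 24)) visit_body) s (\<lambda>t s'.
    (\<exists>W. distinct W \<and> set W = {Y. relevant Y} \<and> outp s' = outp s @ map row_of (filter full W)) \<and>
    t \<le> visit_cost * card {Y. relevant Y} + 4)"
proof -
  let ?e = "Bin Less (Reg 23) (Reg 24)"
  define Inv where "Inv = visit_inv (outp s)"
  define \<Phi> where "\<Phi> = (\<lambda>(W :: sym list list, h). visit_cost * (card {Y. relevant Y} - h))"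
  have "ends I w (While ?e visit_body) s (\<lambda>t s'. \<exists>g. Inv g s' \<and> eval w s' ?e = 0 \<and>
    t + \<Phi> g \<le> \<Phi> ([[]], 0) + (1 + ecost ?e))"
  proof (rule ends_While)
    have "\<not> good []" using m by (auto simp: good_def sources_def)
    then show "Inv ([[]], 0) s"
      using s relevant_Nil row_of_Nil by (simp add: Inv_def visit_inv_def queue_def)
  next
    fix g s' assume inv: "Inv g s'" "eval w s' ?e \<noteq> 0"
    obtain W h where g: "g = (W, h)" by (cases g)
    have h: "h < length W" using inv by (auto simp: Inv_def g visit_inv_def queue_def split: if_splits)
    obtain W' where W': "Inv (W', Suc h) (effect I w visit_body s')"
      using visit_step[OF _ h, of "outp s" s'] inv(1) by (auto simp: Inv_def g)
    have "distinct W" "set W \<subseteq> {Y. relevant Y}" using inv(1) by (auto simp: Inv_def g visit_inv_def)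
    then have "length W \<le> card {Y. relevant Y}"
      using card_mono[OF finite_relevant] distinct_card by metis
    then have "card {Y. relevant Y} - h = Suc (card {Y. relevant Y} - Suc h)" using h by simp
    then have eq: "\<Phi> g = visit_cost + \<Phi> (W', Suc h)" by (simp add: \<Phi>_def g)
    have "t + (1 + ecost ?e) \<le> visit_cost" if "t \<le> max_cost visit_body" for t
      using that by (simp add: visit_cost_def)
    then have "Inv (W', Suc h) (effect I w visit_body s') \<and> t + (1 + ecost ?e) + \<Phi> (W', Suc h) \<le> \<Phi> g"
      if "t \<le> max_cost visit_body" for t using that W' unfolding eq by (meson add_le_mono1)
    then show "ends I w visit_body s' (\<lambda>t s''. \<exists>g'. Inv g' s'' \<and> t + (1 + ecost ?e) + \<Phi> g' \<le> \<Phi> g)"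
      by (intro ends_loop_free) (simp, blast)
  qed
  then show ?thesis
  proof (rule ends_mono)
    fix t s'
    assume "\<exists>g. Inv g s' \<and> eval w s' ?e = 0 \<and> t + \<Phi> g \<le> \<Phi> ([[]], 0) + (1 + ecost ?e)"
    then obtain W h where g: "visit_inv (outp s) (W, h) s'" "eval w s' ?e = 0" "t \<le> \<Phi> ([[]], 0) + 4"
      by (auto simp: Inv_def)
    then have h: "h = length W" by (auto simp: visit_inv_def queue_def split: if_splits)
    have closed: "\<And>X b. X \<in> set W \<Longrightarrow> length X < k - 1 \<Longrightarrow> relevant (X @ [b]) \<Longrightarrow> X @ [b] \<in> set W"
      and W: "[] \<in> set W" "\<forall>Y\<in>set W. relevant Y" "distinct W" "outp s' = outp s @ map row_of (filter full W)"
      using g(1) by (auto simp: visit_inv_def h)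
    have "relevant Y \<Longrightarrow> Y \<in> set W" for Y
    proof (induction Y rule: rev_induct)
      case Nil
      then show ?case using W by simp
    next
      case (snoc b X)
      then have "length X < k - 1" by (auto simp: relevant_def label_def)
      then show ?case using snoc closed relevant_butlast by blast
    qed
    then have "set W = {Y. relevant Y}" using W(2) by auto
    then show "(\<exists>W. distinct W \<and> set W = {Y. relevant Y} \<and> outp s' = outp s @ map row_of (filter full W)) \<and>
      t \<le> visit_cost * card {Y. relevant Y} + 4"
      using W(3,4) g(3) by (auto simp: \<Phi>_def)
  qed
qed

lemma finite_foverlaps: "finite (foverlaps R k m v)"
proof -
  have "foverlaps R k m v \<subseteq> solid_nodes R k" by (auto simp: foverlaps_def p_nodes_def)
  then show ?thesis using finite_solid finite_subset by blast
qed

lemma label_extends: "label Y \<Longrightarrow> \<exists>v'\<in>p_nodes R k. prefix Y v'"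
proof -
  assume Y: "label Y"
  then obtain x where x: "x \<in> rc_closure R" "prefix Y x" by (auto simp: label_def read_prefix_def)
  then have "prefix (take (k - 1) x) x" "length (take (k - 1) x) = k - 1"
    using read_length[OF x(1)] take_is_prefix by auto
  then have "take (k - 1) x \<in> p_nodes R k" using x(1) by (auto simp: p_node_iff read_prefix_def)
  moreover have "prefix Y (take (k - 1) x)"
    using x(2) Y \<open>length (take (k - 1) x) = k - 1\<close> take_is_prefix
    by (metis label_def prefix_length_prefix)
  ultimately show ?thesis by blast
qed

lemma relevant_prefix_foverlaps:
  assumes "relevant Y" "Y \<noteq> []" shows "\<exists>v'\<in>foverlaps R k m v. prefix Y v'"
proof -
  have in_F: "v' \<in> foverlaps R k m v" if "X \<in> sources v" "v' \<in> p_nodes R k" "prefix X v'" for X v'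
    unfolding foverlaps_eq using that by blast
  consider X where "X \<in> sources v" "prefix Y X" | X where "X \<in> sources v" "prefix X Y"
    using assms by (auto simp: relevant_def touched_def good_def)
  then show ?thesis
  proof cases
    case 1
    then have "label X" using label_source by (auto simp: label_def)
    then obtain v' where "v' \<in> p_nodes R k" "prefix X v'" using label_extends by blast
    then show ?thesis using in_F 1 prefix_order.trans by blast
  next
    case 2
    obtain v' where "v' \<in> p_nodes R k" "prefix Y v'"
      using label_extends assms(1) by (auto simp: relevant_def)
    then show ?thesis using in_F 2 prefix_order.trans by blast
  qed
qed

lemma card_relevant: "card {Y. relevant Y} \<le> 1 + k * card (foverlaps R k m v)"
proof -
  have "{Y. relevant Y} \<subseteq> insert [] (\<Union>v'\<in>foverlaps R k m v. set (prefixes v'))"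
    using relevant_prefix_foverlaps by (auto simp: in_set_prefixes) blast
  then have "card {Y. relevant Y} \<le> card (insert [] (\<Union>v'\<in>foverlaps R k m v. set (prefixes v')))"
    using finite_foverlaps by (intro card_mono) auto
  also have "\<dots> \<le> 1 + card (\<Union>v'\<in>foverlaps R k m v. set (prefixes v'))"
    by (simp add: card_insert_le_m1 card_insert_if finite_foverlaps)
  also have "card (\<Union>v'\<in>foverlaps R k m v. set (prefixes v')) \<le> (\<Sum>v'\<in>foverlaps R k m v. card (set (prefixes v')))"
    by (rule card_UN_le[OF finite_foverlaps])
  also have "\<dots> \<le> (\<Sum>v'\<in>foverlaps R k m v. k)"
  proof (rule sum_mono)
    fix v' assume "v' \<in> foverlaps R k m v"
    then have "length v' = k - 1" by (auto simp: foverlaps_def p_node_iff)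
    then show "card (set (prefixes v')) \<le> k" using card_length[of "prefixes v'"] k2 by simp
  qed
  finally show ?thesis by (simp add: mult.commute)
qed

lemma card_touched: "card (touched (sources v)) \<le> card {Y. relevant Y}"
proof (rule card_mono[OF finite_relevant], rule subsetI)
  fix Y assume Y: "Y \<in> touched (sources v)"
  have "label Y"
  proof (cases "Y = []")
    case False
    then obtain X where X: "X \<in> sources v" "prefix Y X" using Y by (auto simp: touched_def)
    then show ?thesis using label_source[OF X(1)] read_prefix_mono prefix_length_le[OF X(2)]
      unfolding label_def by (meson order_trans)
  qed (simp add: label_Nil)
  then show "Y \<in> {Y. relevant Y}" using Y by (simp add: relevant_def)
qed

lemma relevant_full: "length Y = k - 1 \<Longrightarrow> relevant Y \<longleftrightarrow> Y \<in> p_nodes R k \<and> good Y"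
proof -
  assume Y: "length Y = k - 1"
  have "Y \<notin> touched (sources v)"
  proof
    assume "Y \<in> touched (sources v)"
    then consider "Y = []" | X where "X \<in> sources v" "prefix Y X" by (auto simp: touched_def)
    then show False
    proof cases
      case 1
      then show False using Y k2 by simp
    next
      case 2
      then show False using Y label_source[OF 2(1)] prefix_length_le[OF 2(2)] by simp
    qed
  qed
  then show ?thesis using Y by (auto simp: relevant_def label_def p_node_iff)
qed

lemma enum_prog_correct:
  "\<exists>t ys. runs I w enum_prog [i, k, m] t ys \<and> enumerates R k ys (foverlaps R k m v) \<and>
    t \<le> enum_cost * (k * max 1 (card (foverlaps R k m v)))"
proof -
  let ?F = "foverlaps R k m v"
  let ?c = "card {Y. relevant Y}"
  obtain ps where ps: "enclose_chain BP 0 ps (answer I BP_Leaf_Select i 0)" "\<forall>p\<in>set ps. 0 < p \<and> p < length BP"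
    "distinct (map (leaf_rank BP) ps)" "set (map (leaf_rank BP) ps) = row_of ` sources v"
    "answer I BP_Leaf_Select i 0 < length BP"
    using overlap_chain[OF v i m(1)] by blast
  have len_ps: "length ps \<le> k"
  proof -
    have "length ps = card (row_of ` sources v)" using distinct_card[OF ps(3)] ps(4) by simp
    then show ?thesis using card_image_le[OF finite_sources, of row_of] card_sources by simp
  qed
  define out where "out = (if v \<in> p_nodes R k then [i] else [])"
  define B where "B = max_cost walk_init + (walk_cost * k + 2) + max_cost source_init +
    (source_cost * k + mark_cost * ?c + 2) + max_cost visit_init + (visit_cost * ?c + 4)"
  define Q where "Q = (\<lambda>t (s' :: mstate). (\<exists>W. distinct W \<and> set W = {Y. relevant Y} \<and>
    outp s' = out @ map row_of (filter full W)) \<and> t \<le> B)"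
  have "ends I w enum_prog (init_state [i, k, m]) Q"
    unfolding enum_prog_def
  proof (rule ends_Seq, rule ends_loop_free, simp, rule ends_Seq)
    fix t1 assume t1: "t1 \<le> max_cost walk_init"
    let ?s1 = "effect I w walk_init (init_state [i, k, m])"
    have wk: "word w (k - 1) = k - 1" using fits'(3) by (intro word_id) simp
    have s1: "regs ?s1 3 = i" "regs ?s1 5 = k - 1" "regs ?s1 0 = i" "regs ?s1 1 = k"
      "arrs ?s1 a j = 0" "outp ?s1 = []" for a j
      using wk by (simp_all add: walk_init_def)
    show "ends I w (While (Reg 5) walk_body) ?s1 (\<lambda>t2 s2. ends I w (Seq source_init
      (Seq (While (Reg 6) source_body) (Seq visit_init (While (Bin Less (Reg 23) (Reg 24)) visit_body)))) s2
      (\<lambda>t' s'. Q (t1 + (t2 + t')) s'))"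
    proof (rule ends_mono[OF walk_loop[OF s1(1,2)]], rule ends_Seq, rule ends_loop_free, simp, rule ends_Seq)
      fix t2 t3 and s2 :: mstate
      assume s2: "regs s2 3 = (pred_row ^^ (k - 1)) i \<and> regs s2 0 = regs ?s1 0 \<and> regs s2 1 = regs ?s1 1 \<and>
        arrs s2 = arrs ?s1 \<and> outp s2 = outp ?s1 \<and> t2 \<le> walk_cost * k + 2"
        and t3: "t3 \<le> max_cost source_init"
      let ?s3 = "effect I w source_init s2"
      have pn: "regs s2 3 = 0 \<longleftrightarrow> v \<in> p_nodes R k" using s2 pred_walk_p_node[OF v] idx_v by simp
      have wsel: "word w (answer I BP_Leaf_Select i 0) = answer I BP_Leaf_Select i 0"
        using ps(5) fits'(2) by (intro word_id) simp
      have s3: "regs ?s3 6 = last (0 # ps)" "regs ?s3 0 = i" "regs ?s3 1 = k" "outp ?s3 = out"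
        "arrs ?s3 = (\<lambda>_ _. 0)(0 := (\<lambda>_. 0)(0 := 1))"
        using s2 s1 pn wsel enclose_word[OF ps(1,2)]
        by (auto simp: source_init_def out_def fun_eq_iff)
      have nil: "row_of Y = 0 \<longleftrightarrow> Y = []" if "label Y" for Y
        using row_of_inject[of Y "[]"] that label_Nil row_of_Nil by (simp add: label_def)
      have mk: "marks 0 (touched {}) ?s3" "marks 1 {} ?s3"
        using nil by (auto simp: marks_def s3 touched_def)
      show "ends I w (While (Reg 6) source_body) ?s3 (\<lambda>t4 s4. ends I w
        (Seq visit_init (While (Bin Less (Reg 23) (Reg 24)) visit_body)) s4
        (\<lambda>t' s'. Q (t1 + (t2 + (t3 + (t4 + t')))) s'))"
      proof (rule ends_mono[OF source_loop[OF ps(1,2,4) s3(1) mk]], rule ends_Seq, rule ends_loop_free, simp)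
        fix t4 t5 and s4 :: mstate
        assume s4: "marks 0 (touched (sources v)) s4 \<and> marks 1 (sources v) s4 \<and>
          (\<forall>x\<in>{0, 1}. regs s4 x = regs ?s3 x) \<and> (\<forall>a>1. arrs s4 a = arrs ?s3 a) \<and> outp s4 = outp ?s3 \<and>
          t4 \<le> source_cost * length ps + mark_cost * card (touched (sources v)) + 2"
          and t5: "t5 \<le> max_cost visit_init"
        let ?s5 = "effect I w visit_init s4"
        have s5: "regs ?s5 0 = i" "regs ?s5 1 = k" "regs ?s5 23 = 0" "regs ?s5 24 = 1"
          "marks 0 (touched (sources v)) ?s5" "marks 1 (sources v) ?s5" "\<forall>a\<in>{2, 3, 4}. arrs ?s5 a 0 = 0"
          "outp ?s5 = out"
          using s4 s3 by (simp_all add: visit_init_def marks_def)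
        show "ends I w (While (Bin Less (Reg 23) (Reg 24)) visit_body) ?s5
          (\<lambda>t6 s'. Q (t1 + (t2 + (t3 + (t4 + (t5 + t6))))) s')"
        proof (rule ends_mono[OF visit_loop[OF s5(1-7)]])
          fix t6 and s' :: mstate
          assume s6: "(\<exists>W. distinct W \<and> set W = {Y. relevant Y} \<and> outp s' = outp ?s5 @ map row_of (filter full W)) \<and>
            t6 \<le> visit_cost * ?c + 4"
          have "source_cost * length ps \<le> source_cost * k" using len_ps by simp
          moreover have "mark_cost * card (touched (sources v)) \<le> mark_cost * ?c" using card_touched by simp
          ultimately have "t1 + (t2 + (t3 + (t4 + (t5 + t6)))) \<le> B"
            using t1 s2 t3 s4 t5 s6 unfolding B_def by linarith
          then show "Q (t1 + (t2 + (t3 + (t4 + (t5 + t6))))) s'" using s6 s5(8) unfolding Q_def by simp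
        qed
      qed
    qed
  qed
  then obtain t s W where s: "exec I w enum_prog (init_state [i, k, m]) t s" "t \<le> B"
    and W: "distinct W" "set W = {Y. relevant Y}" "outp s = out @ map row_of (filter full W)"
    unfolding ends_def Q_def by blast
  define ys where "ys = out @ map row_of (filter full W)"
  have lab: "label Y" if "Y \<in> set W" for Y using that W(2) by (auto simp: relevant_def)
  have nth: "M ! row_of Y = Y" if "Y \<in> set (filter full W)" for Y
    using that lab[of Y] nth_row_of[of Y] by (auto simp: full_def label_def pad_full)
  have inj: "inj_on row_of (set (filter full W))"
    using lab row_of_inject by (auto simp: inj_on_def label_def)
  have "distinct ys"
    using W(1) inj by (auto simp: ys_def out_def distinct_map full_def)
  moreover have "\<forall>j\<in>set ys. j < N"
    using i lab row_of_less by (auto simp: ys_def out_def label_def)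
  moreover have "(\<lambda>j. M ! j) ` set ys = ?F"
  proof -
    have full_set: "set (filter full W) = {Y \<in> p_nodes R k. good Y \<and> Y \<noteq> v}"
    proof -
      have "full Y \<and> relevant Y \<longleftrightarrow> Y \<in> p_nodes R k \<and> good Y \<and> Y \<noteq> v" for Y
      proof (cases "length Y = k - 1 \<and> Y \<in> p_nodes R k")
        case True
        then have "row_of Y = i \<longleftrightarrow> Y = v"
          using nth_row_of[of Y] i idx_v by (auto simp: pad_full p_node_iff)
        then show ?thesis using True relevant_full[of Y] by (auto simp: full_def)
      next
        case False
        then show ?thesis using relevant_full[of Y] by (auto simp: full_def p_node_iff)
      qed
      then show ?thesis using W(2) by auto
    qed
    have "(\<lambda>j. M ! j) ` set ys = (if v \<in> p_nodes R k then {v} else {}) \<union> (\<lambda>Y. M ! row_of Y) ` set (filter full W)"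
      using i by (auto simp: ys_def out_def)
    also have "(\<lambda>Y. M ! row_of Y) ` set (filter full W) = set (filter full W)"
      using nth by (simp add: image_cong)
    also have "(if v \<in> p_nodes R k then {v} else {}) \<union> set (filter full W) = ?F"
      unfolding full_set foverlaps_eq by (auto simp: good_def)
    finally show ?thesis .
  qed
  moreover have "B \<le> enum_cost * (k * max 1 (card ?F))"
  proof -
    define K where "K = k * max 1 (card ?F)"
    have k1: "k \<le> K" "1 \<le> K" using k2 by (auto simp: K_def)
    have "k * card ?F \<le> K" by (simp add: K_def)
    then have c: "?c \<le> 2 * K" using card_relevant k1 by linarith
    have "walk_cost * k \<le> walk_cost * K" "source_cost * k \<le> source_cost * K"
      "mark_cost * ?c \<le> mark_cost * (2 * K)" "visit_cost * ?c \<le> visit_cost * (2 * K)"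
      using k1 c mult_le_mono2 by blast+
    moreover have "max_cost walk_init + max_cost source_init + max_cost visit_init + 8
      \<le> (max_cost walk_init + max_cost source_init + max_cost visit_init + 8) * K"
      using k1 by (metis mult.right_neutral mult_le_mono2)
    ultimately have "B \<le> (max_cost walk_init + max_cost source_init + max_cost visit_init + 8) * K +
      walk_cost * K + source_cost * K + mark_cost * (2 * K) + visit_cost * (2 * K)"
      unfolding B_def by linarith
    also have "\<dots> = enum_cost * K" unfolding enum_cost_def by (simp add: algebra_simps)
    finally show ?thesis by (simp add: K_def)
  qed
  ultimately show ?thesis
    using s W(3) unfolding runs_def enumerates_def ys_def by (meson order_trans)
qed

end

theorem theorem6:
  shows "\<exists>P Q c. c > (0 :: real) \<and>
    (\<forall>R k m w v i.
       read_collection R \<and> 2 \<le> k \<and> 1 \<le> m \<and> m < k \<and>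
       v \<in> solid_nodes R k \<and> i < length (rows R k) \<and> rows R k ! i = v \<and>
       word_fits (rboss_index R k m) k w \<longrightarrow>
       (\<exists>t ys. runs (rboss_index R k m) w P [i, k, m] t ys \<and>
          represents R k ys (foverlaps R k m v) \<and>
          real t \<le> c * (real k * log 2 (real sigma))) \<and>
       (\<exists>t ys. runs (rboss_index R k m) w Q [i, k, m] t ys \<and>
          enumerates R k ys (foverlaps R k m v) \<and>
          real t \<le> c * (real k * log 2 (real sigma)) * real (max 1 (card (foverlaps R k m v)))))"
proof (rule exI[of _ overlap_prog], rule exI[of _ enum_prog],
    rule exI[of _ "real (overlap_init_cost + overlap_cost + enum_cost + 1)"], rule conjI,
    goal_cases)
  case 1
  show ?case by simp
next
  case 2
  let ?C = "overlap_init_cost + overlap_cost + enum_cost + 1"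
  have log: "1 \<le> log 2 (real sigma)" by (simp add: sigma_eq le_log_iff)
  have bound: "real t \<le> real ?C * (real k * log 2 (real sigma)) * real x" if "t \<le> ?C * (k * x)" for t k x
  proof -
    have "real t \<le> real (?C * (k * x))" using that by (rule of_nat_mono)
    also have "\<dots> = real ?C * (real k * 1) * real x" by (simp add: algebra_simps)
    also have "\<dots> \<le> real ?C * (real k * log 2 (real sigma)) * real x"
      using log by (intro mult_right_mono mult_left_mono) auto
    finally show ?thesis .
  qed
  show ?case
  proof (intro allI impI, goal_cases)
    case (1 R k m w v i)
    then interpret rboss_machine R k m w v i by unfold_locales auto
    obtain t ys where P: "runs (rboss_index R k m) w overlap_prog [i, k, m] t ys"
      "represents R k ys (foverlaps R k m v)" "t \<le> overlap_init_cost + overlap_cost * k"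
      using overlap_prog_correct by blast
    have "t \<le> overlap_init_cost * k + overlap_cost * k"
      using P(3) mult_le_mono2[of 1 k overlap_init_cost] k2 by linarith
    also have "\<dots> \<le> ?C * (k * 1)" by (simp add: algebra_simps)
    finally have "real t \<le> real ?C * (real k * log 2 (real sigma))" using bound[of t k 1] by simp
    then have P': "\<exists>t ys. runs (rboss_index R k m) w overlap_prog [i, k, m] t ys \<and>
      represents R k ys (foverlaps R k m v) \<and> real t \<le> real ?C * (real k * log 2 (real sigma))"
      using P by blast
    obtain t ys where Q: "runs (rboss_index R k m) w enum_prog [i, k, m] t ys"
      "enumerates R k ys (foverlaps R k m v)" "t \<le> enum_cost * (k * max 1 (card (foverlaps R k m v)))"
      using enum_prog_correct by blast
    have "t \<le> ?C * (k * max 1 (card (foverlaps R k m v)))"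
      using Q(3) by (rule order_trans) (intro mult_le_mono1, simp)
    then have Q': "\<exists>t ys. runs (rboss_index R k m) w enum_prog [i, k, m] t ys \<and>
      enumerates R k ys (foverlaps R k m v) \<and>
      real t \<le> real ?C * (real k * log 2 (real sigma)) * real (max 1 (card (foverlaps R k m v)))"
      using Q bound by blast
    show ?case using P' Q' by (rule conjI)
  qed
qed

end
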